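(* Let $(\mathfrak{X},\Gamma,\Phi)$ be a nilpotent Cantor action. If the Steinitz order $\Pi[\mathfrak{G}(\Phi)]$ has prime multiplicities at most $2$ for all but a finite set of primes, then the action is stable.
   Context: A Cantor action $(\mathfrak{X}, \Gamma, \Phi)$ consists of a countable group $\Gamma$, a Cantor space $\mathfrak{X}$ and a minimal action $\Phi \colon \Gamma \times \mathfrak{X} \to \mathfrak{X}$ by homeomorphisms (every orbit is dense). It is equicontinuous if, for a metric $d_{\mathfrak{X}}$ compatible with the topology, for all $\varepsilon>0$ there is $\delta>0$ such that $d_{\mathfrak{X}}(x,y)<\delta$ implies $d_{\mathfrak{X}}(\gamma x,\gamma y)<\varepsilon$ for all $\gamma\in\Gamma$. A nilpotent Cantor action is a minimal equicontinuous Cantor action $(\mathfrak{X},\Gamma,\Phi)$ where $\Gamma$ contains a finitely generated nilpotent subgroup $\Gamma_0\subset\Gamma$ of finite index. For an equicontinuous Cantor action, $\mathfrak{G}(\Phi) = \overline{\Phi(\Gamma)} \subset \mathrm{Homeo}(\mathfrak{X})$ denotes the closure in the uniform topology, a profinite group acting on $\mathfrak{X}$; this action is denoted $\widehat\Phi$. A Steinitz number is a formal product $\Pi=\prod_{p} p^{n(p)}$ over all primes, with $0 \leq n(p) \leq \infty$; the multiplicity of the prime $p$ in $\Pi$ is $n(p)$. $LCM$ of a collection takes the supremum of exponents at each prime. The Steinitz order of $\mathfrak{G}(\Phi)$ is $\Pi[\mathfrak{G}(\Phi)] = LCM\{\#\, \mathfrak{G}(\Phi)/\mathfrak{N}\mid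 \mathfrak{N}\subset\mathfrak{G}(\Phi)\text{ open normal subgroup}\}$. An action $\Psi\colon H\times\mathfrak{X}\to\mathfrak{X}$ of a topological group $H$ on a Cantor metric space $(\mathfrak{X},d_{\mathfrak{X}})$ is locally quasi-analytic if there exists $\varepsilon>0$ such that for any non-empty open set $U\subset\mathfrak{X}$ with $\mathrm{diam}(U)<\varepsilon$ and any non-empty open subset $V\subset U$: if $g\in H$ satisfies $\Psi(g)(V)=V$ and $\Psi(g)|V$ is the identity map on $V$, then $\Psi(g)$ acts as the identity on all of $U$. An equicontinuous Cantor action $(\mathfrak{X},\Gamma,\Phi)$ is stable if the induced action $\widehat\Phi\colon\mathfrak{G}(\Phi)\times\mathfrak{X}\to\mathfrak{X}$ is locally quasi-analytic. *)

theory Defs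
  imports
    "HOL-Analysis.Analysis"
    "HOL-Algebra.Group_Action"
    "HOL-Algebra.Generated_Groups"
    "HOL-Computational_Algebra.Primes"
begin

section \<open>Finitely generated and nilpotent groups\<close>

definition finitely_generated_group :: "('g, 'b) monoid_scheme \<Rightarrow> bool" where
  "finitely_generated_group G \<longleftrightarrow>
     group G \<and> (\<exists>S. finite S \<and> S \<subseteq> carrier G \<and> generate G S = carrier G)"

text \<open>The indexing starts at 0, with the whole group.\<close>

primrec lower_central_series :: "('g, 'b) monoid_scheme \<Rightarrow> nat \<Rightarrow> 'g set" where
  "lower_central_series G 0 = carrier G"
| "lower_central_series G (Suc n) =
     generate G {a \<otimes>\<^bsub>G\<^esub> b \<otimes>\<^bsub>G\<^esub> inv\<^bsub>G\<^esub> a \<otimes>\<^bsub>G\<^esub> inv\<^bsub>G\<^esub> b |a b.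
       a \<in> lower_central_series G n \<and> b \<in> carrier G}"

definition nilpotent_group :: "('g, 'b) monoid_scheme \<Rightarrow> bool" where
  "nilpotent_group G \<longleftrightarrow> group G \<and> (\<exists>n. lower_central_series G n = {\<one>\<^bsub>G\<^esub>})"

definition virtually_fg_nilpotent :: "('g, 'b) monoid_scheme \<Rightarrow> bool" where
  "virtually_fg_nilpotent G \<longleftrightarrow>
     (\<exists>H. subgroup H G \<and> finite (rcosets\<^bsub>G\<^esub> H) \<and>
          finitely_generated_group (G\<lparr>carrier := H\<rparr>) \<and> nilpotent_group (G\<lparr>carrier := H\<rparr>))"


section \<open>Cantor actions\<close>

text \<open>Cantor spaces in the sense of Brouwer's characterization: nonempty, compact, metrizable,
  perfect and totally disconnected. Metrizability comes from the type class.\<close>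

definition cantor_space :: "'x::metric_space set \<Rightarrow> bool" where
  "cantor_space S \<longleftrightarrow>
     S \<noteq> {} \<and> compact S \<and> (\<forall>x\<in>S. x islimpt S) \<and>
     (\<forall>C\<subseteq>S. connected C \<longrightarrow> (\<exists>x. C \<subseteq> {x}))"

definition Homeo :: "('x::topological_space \<Rightarrow> 'x) set" where
  "Homeo = {f. \<exists>g. homeomorphism UNIV UNIV f g}"

text \<open>The Cantor space is the whole type \<open>'x\<close>, and its \<open>dist\<close> is the chosen compatible metric.
  The action need not be effective.\<close>

locale cantor_action = group_action \<Gamma> UNIV \<Phi>
  for \<Gamma> :: "('g, 'b) monoid_scheme" (structure) and \<Phi> :: "'g \<Rightarrow> 'x::metric_space \<Rightarrow> 'x" +
  assumes cantor: "cantor_space (UNIV :: 'x set)"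
    and countable: "countable (carrier \<Gamma>)"
    and homeo: "g \<in> carrier \<Gamma> \<Longrightarrow> \<Phi> g \<in> Homeo"
    and minimal: "closure (orbit \<Gamma> \<Phi> x) = UNIV"

locale equicontinuous_cantor_action = cantor_action +
  assumes equicontinuous:
    "\<forall>\<epsilon>>0. \<exists>\<delta>>0. \<forall>x y. dist x y < \<delta> \<longrightarrow> (\<forall>g\<in>carrier \<Gamma>. dist (\<Phi> g x) (\<Phi> g y) < \<epsilon>)"

locale nilpotent_cantor_action = equicontinuous_cantor_action +
  assumes virtually_nilpotent: "virtually_fg_nilpotent \<Gamma>"


section \<open>The closure of the action in the homeomorphism group\<close>

text \<open>The metric of \<open>cfunspace\<close> is the supremum distance on bounded continuous functions; on a
  compact space these are all the continuous functions.\<close>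

definition uniform_topology :: "('x::metric_space \<Rightarrow> 'x) topology" where
  "uniform_topology =
     subtopology (mtopology_of (cfunspace (euclidean :: 'x topology) euclidean_metric)) Homeo"

definition closure_group ::
  "('g, 'b) monoid_scheme \<Rightarrow> ('g \<Rightarrow> 'x::metric_space \<Rightarrow> 'x) \<Rightarrow> ('x \<Rightarrow> 'x) monoid" where
  "closure_group \<Gamma> \<Phi> =
     (BijGroup UNIV)\<lparr>carrier := uniform_topology closure_of (\<Phi> ` carrier \<Gamma>)\<rparr>"


section \<open>Steinitz numbers\<close>

text \<open>The function gives the multiplicity of each prime; its values at other numbers carry no
  meaning.\<close>

type_synonym steinitz = "nat \<Rightarrow> enat"

definition steinitz_of_nat :: "nat \<Rightarrow> steinitz" where
  "steinitz_of_nat n = (\<lambda>p. if prime p then enat (multiplicity p n) else 0)"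

definition steinitz_LCM :: "steinitz set \<Rightarrow> steinitz" where
  "steinitz_LCM A = (\<lambda>p. SUP s\<in>A. s p)"

text \<open>Meant for profinite \<open>G\<close>: there the quotients by open normal subgroups are finite, so that
  \<^const>\<open>order\<close> is their actual number of elements.\<close>

definition steinitz_order :: "'h topology \<Rightarrow> ('h, 'b) monoid_scheme \<Rightarrow> steinitz" where
  "steinitz_order T G =
     steinitz_LCM {steinitz_of_nat (order (G Mod N)) |N.
       N \<lhd> G \<and> openin (subtopology T (carrier G)) N}"


section \<open>Stability\<close>

definition locally_quasi_analytic ::
  "('h, 'b) monoid_scheme \<Rightarrow> ('h \<Rightarrow> 'x::metric_space \<Rightarrow> 'x) \<Rightarrow> bool" where
  "locally_quasi_analytic H \<Psi> \<longleftrightarrow>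
     (\<exists>\<epsilon>>0. \<forall>U V. open U \<and> U \<noteq> {} \<and> diameter U < \<epsilon> \<and> open V \<and> V \<noteq> {} \<and> V \<subseteq> U \<longrightarrow>
        (\<forall>g\<in>carrier H. \<Psi> g ` V = V \<and> (\<forall>x\<in>V. \<Psi> g x = x) \<longrightarrow> (\<forall>x\<in>U. \<Psi> g x = x)))"

text \<open>The elements of the closure are themselves homeomorphisms, and they act by evaluation.\<close>

definition stable_action ::
  "('g, 'b) monoid_scheme \<Rightarrow> ('g \<Rightarrow> 'x::metric_space \<Rightarrow> 'x) \<Rightarrow> bool" where
  "stable_action \<Gamma> \<Phi> \<longleftrightarrow> locally_quasi_analytic (closure_group \<Gamma> \<Phi>) (\<lambda>f x. f x)"

end

theory Submission
  imports
    Defs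
    "HOL-Algebra.Multiplicative_Group"
    "HOL-Algebra.Zassenhaus"
    "HOL-Number_Theory.Cong"
begin

text \<open>Let \<open>H\<close> be a finitely generated nilpotent subgroup of finite index, \<open>G\<close> the closure of its image,
  and \<open>F n\<close> the subgroup of \<open>G\<close> that fixes pointwise the \<open>n\<close>-th set of a shrinking clopen
  neighbourhood basis of a point \<open>x\<close>. Stability means that the increasing chain \<open>F n\<close> becomes
  stationary. A finite nilpotent group whose order has multiplicity at most 2 at a prime \<open>p\<close> has
  central \<open>p\<close>-elements, so modulo its center \<open>Z\<close> the group \<open>G\<close> involves only the finitely many
  exceptional primes. As \<open>H\<close> is polycyclic, \<open>G / Z\<close> has a finite series with procyclic factors at
  finitely many primes, and therefore satisfies the ascending chain condition on closed subgroups;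
  so \<open>F n Z\<close> becomes stationary. Finally, a central element fixing \<open>x\<close> fixes the closure of the orbit
  of \<open>x\<close> under \<open>H\<close>, which is a neighbourhood of \<open>x\<close>; hence \<open>F n \<inter> Z\<close> becomes stationary as well,
  and with it \<open>F n\<close>.\<close>

section \<open>Central series with cyclic factors\<close>

text \<open>The chain \<open>F n\<close> cannot be controlled by algebra in \<open>G\<close> itself:
  infinitely many primes may occur, and already the product of the groups of order \<open>p\<close>
  over all primes \<open>p\<close> has infinite strictly increasing chains of closed subgroups. The
  factor \<open>Z\<close> absorbs these primes, and on \<open>Z\<close> it is the action that gives
  stationarity. The bound 2 comes from the existence of nonabelian groups of order
  \<open>p^3\<close>: a noncentral \<open>p\<close>-element forces one factor \<open>p\<close> from
  a central subgroup, one from the index of a centralizer and one from the quotient of the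
  centralizer by the central subgroup. Finitely many primes suffice for the chain condition because
  a closed subgroup of a procyclic group amounts to a supernatural number, and decreasing exponents
  in the naturals with infinity become constant. Minimality is given for \<Gamma>, the series only
  for \<open>H\<close>. So finite index is used twice: the \<open>H\<close>-orbit of
  \<open>x\<close> need not be dense, and stability concerns the closure of all of \<Gamma>.
  Profinite groups are handled through their finite quotients, compactness being Konig's
  lemma.\<close>

lemma (in group) subgroup_centralizer:
  assumes "b \<in> carrier G"
  shows "subgroup {x \<in> carrier G. x \<otimes> b = b \<otimes> x} G"
proof (rule subgroupI)
  fix x assume "x \<in> {x \<in> carrier G. x \<otimes> b = b \<otimes> x}"
  then have x: "x \<in> carrier G" "x \<otimes> b = b \<otimes> x" by auto
  have "b \<otimes> inv x = inv x \<otimes> (x \<otimes> b) \<otimes> inv x"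
    using x(1) assms by (simp add: m_assoc[symmetric])
  also have "\<dots> = inv x \<otimes> b" unfolding x(2) using x(1) assms by (simp add: m_assoc)
  finally show "inv x \<in> {x \<in> carrier G. x \<otimes> b = b \<otimes> x}" using x by simp
next
  fix x y assume "x \<in> {x \<in> carrier G. x \<otimes> b = b \<otimes> x}" "y \<in> {x \<in> carrier G. x \<otimes> b = b \<otimes> x}"
  then show "x \<otimes> y \<in> {x \<in> carrier G. x \<otimes> b = b \<otimes> x}"
    using assms by (auto simp: m_assoc) (simp flip: m_assoc)
qed (use assms in auto)

lemma (in group_hom) subgroup_vimage:
  assumes "subgroup K H"
  shows "subgroup {x \<in> carrier G. h x \<in> K} G"
  using subgroup.m_closed[OF assms] subgroup.m_inv_closed[OF assms] subgroup.one_closed[OF assms]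
  by (intro G.subgroupI) auto

lemma (in group) commutator_eq_one_iff:
  assumes "x \<in> carrier G" "y \<in> carrier G"
  shows "x \<otimes> y \<otimes> inv x \<otimes> inv y = \<one> \<longleftrightarrow> x \<otimes> y = y \<otimes> x"
proof -
  have "x \<otimes> y \<otimes> inv x \<otimes> inv y = (x \<otimes> y) \<otimes> inv (y \<otimes> x)"
    using assms by (simp add: inv_mult_group m_assoc)
  then show ?thesis
    using assms by (metis inv_closed inv_equality inv_inv m_closed r_inv)
qed

lemma (in normal) group_hom_Mod: "group_hom G (G Mod H) (\<lambda>x. H #> x)"
  using r_coset_hom_Mod factorgroup_is_group is_group
  by (simp add: group_hom_def group_hom_axioms_def)

lemma (in normal) r_coset_eq_one_iff:
  assumes "x \<in> carrier G"
  shows "H #> x = H \<longleftrightarrow> x \<in> H"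
  using assms by (metis coset_join1 coset_join2 is_subgroup subset)

lemma (in normal) commutator_in_iff:
  assumes "x \<in> carrier G" "y \<in> carrier G"
  shows "x \<otimes> y \<otimes> inv x \<otimes> inv y \<in> H
    \<longleftrightarrow> (H #> x) \<otimes>\<^bsub>G Mod H\<^esub> (H #> y) = (H #> y) \<otimes>\<^bsub>G Mod H\<^esub> (H #> x)"
proof -
  interpret h: group_hom G "G Mod H" "\<lambda>x. H #> x" by (rule group_hom_Mod)
  have "x \<otimes> y \<otimes> inv x \<otimes> inv y \<in> H \<longleftrightarrow> H #> (x \<otimes> y \<otimes> inv x \<otimes> inv y) = \<one>\<^bsub>G Mod H\<^esub>"
    using assms r_coset_eq_one_iff[of "x \<otimes> y \<otimes> inv x \<otimes> inv y"] by simp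
  also have "\<dots> \<longleftrightarrow> (H #> x) \<otimes>\<^bsub>G Mod H\<^esub> (H #> y) \<otimes>\<^bsub>G Mod H\<^esub> inv\<^bsub>G Mod H\<^esub> (H #> x) \<otimes>\<^bsub>G Mod H\<^esub>
      inv\<^bsub>G Mod H\<^esub> (H #> y) = \<one>\<^bsub>G Mod H\<^esub>"
    using assms by (simp only: h.hom_mult h.hom_inv m_closed inv_closed)
  also have "\<dots> \<longleftrightarrow> (H #> x) \<otimes>\<^bsub>G Mod H\<^esub> (H #> y) = (H #> y) \<otimes>\<^bsub>G Mod H\<^esub> (H #> x)"
    using assms h.hom_closed by (intro h.H.commutator_eq_one_iff)
  finally show ?thesis .
qed

text \<open>Both sets are the preimage of the centralizer of the coset of \<open>b\<close>. This
  replaces commutator identities: for a generated subgroup the condition need only be checked on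
  generators.\<close>

lemma (in normal) subgroup_commuting_mod:
  assumes "b \<in> carrier G"
  shows "subgroup {x \<in> carrier G. x \<otimes> b \<otimes> inv x \<otimes> inv b \<in> H} G"
    and "subgroup {x \<in> carrier G. b \<otimes> x \<otimes> inv b \<otimes> inv x \<in> H} G"
proof -
  interpret h: group_hom G "G Mod H" "\<lambda>x. H #> x" by (rule group_hom_Mod)
  let ?C = "{u \<in> carrier (G Mod H). u \<otimes>\<^bsub>G Mod H\<^esub> (H #> b) = (H #> b) \<otimes>\<^bsub>G Mod H\<^esub> u}"
  have *: "subgroup {x \<in> carrier G. H #> x \<in> ?C} G"
    using assms by (intro h.subgroup_vimage h.H.subgroup_centralizer h.hom_closed)
  have "{x \<in> carrier G. x \<otimes> b \<otimes> inv x \<otimes> inv b \<in> H} = {x \<in> carrier G. H #> x \<in> ?C}"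
    using assms h.hom_closed by (auto simp: commutator_in_iff simp del: mult_FactGroup)
  then show "subgroup {x \<in> carrier G. x \<otimes> b \<otimes> inv x \<otimes> inv b \<in> H} G" using * by simp
  have "{x \<in> carrier G. b \<otimes> x \<otimes> inv b \<otimes> inv x \<in> H} = {x \<in> carrier G. H #> x \<in> ?C}"
    using assms h.hom_closed by (auto simp: commutator_in_iff simp del: mult_FactGroup)
  then show "subgroup {x \<in> carrier G. b \<otimes> x \<otimes> inv b \<otimes> inv x \<in> H} G" using * by simp
qed

text \<open>The conjugate of \<open>x\<close> by \<open>y\<close> is \<open>x\<close> times the
  commutator of \<open>inv x\<close> and \<open>y\<close>. The terms of a central series thus obtain
  normality from their commutator condition.\<close>

lemma (in group) normal_of_commutators:
  assumes "subgroup N G" "\<And>x y. x \<in> N \<Longrightarrow> y \<in> carrier G \<Longrightarrow> x \<otimes> y \<otimes> inv x \<otimes> inv y \<in> N"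
  shows "N \<lhd> G"
  unfolding normal_inv_iff
proof (intro conjI ballI)
  fix y x assume yx: "y \<in> carrier G" "x \<in> N"
  then have x: "x \<in> carrier G" "inv x \<in> N"
    using assms(1) by (auto simp: subgroup.mem_carrier subgroup.m_inv_closed)
  have "inv (inv x \<otimes> y \<otimes> inv (inv x) \<otimes> inv y) \<in> N"
    using assms(1) assms(2)[OF x(2) yx(1)] by (simp add: subgroup.m_inv_closed)
  moreover have "inv (inv x \<otimes> y \<otimes> inv (inv x) \<otimes> inv y) = y \<otimes> inv x \<otimes> inv y \<otimes> x"
    using yx x by (simp add: inv_mult_group m_assoc)
  ultimately have "x \<otimes> inv (y \<otimes> inv x \<otimes> inv y \<otimes> x) \<otimes> inv \<one> \<in> N"
    using assms(1) yx by (simp add: subgroup.m_inv_closed subgroup.m_closed x)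
  moreover have "x \<otimes> inv (y \<otimes> inv x \<otimes> inv y \<otimes> x) \<otimes> inv \<one> = x \<otimes> (inv x \<otimes> (y \<otimes> x \<otimes> inv y))"
    using yx x by (simp add: inv_mult_group m_assoc)
  ultimately show "y \<otimes> x \<otimes> inv y \<in> N"
    using yx x by (simp add: m_assoc[symmetric])
qed fact

section \<open>The lower central series and generators of its layers\<close>

context group
begin

lemma lower_central_series_normal: "lower_central_series G n \<lhd> G"
proof (induction n)
  case 0
  show ?case by (simp add: normal_self)
next
  case (Suc n)
  let ?L = "lower_central_series G n"
  interpret L: normal ?L G by (rule Suc)
  show ?case unfolding lower_central_series.simps
  proof (rule normal_generateI)
    fix h g assume "h \<in> {a \<otimes> b \<otimes> inv a \<otimes> inv b |a b. a \<in> ?L \<and> b \<in> carrier G}" and g: "g \<in> carrier G"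
    then obtain a b where ab: "a \<in> ?L" "b \<in> carrier G" "h = a \<otimes> b \<otimes> inv a \<otimes> inv b" by auto
    have "g \<otimes> h \<otimes> inv g = (g \<otimes> a \<otimes> inv g) \<otimes> (g \<otimes> b \<otimes> inv g) \<otimes> inv (g \<otimes> a \<otimes> inv g) \<otimes> inv (g \<otimes> b \<otimes> inv g)"
      using ab g by (simp add: inv_mult_group m_assoc inv_solve_left) (simp add: m_assoc[symmetric])
    moreover have "g \<otimes> a \<otimes> inv g \<in> ?L" using ab g by (simp add: L.inv_op_closed2)
    ultimately show "g \<otimes> h \<otimes> inv g \<in> {a \<otimes> b \<otimes> inv a \<otimes> inv b |a b. a \<in> ?L \<and> b \<in> carrier G}"
      using g ab by blast
  qed auto
qed

lemma lower_central_series_subgroup: "subgroup (lower_central_series G n) G"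
  by (simp add: lower_central_series_normal normal_imp_subgroup)

lemma lower_central_series_in_carrier: "x \<in> lower_central_series G n \<Longrightarrow> x \<in> carrier G"
  by (rule subgroup.mem_carrier[OF lower_central_series_subgroup])

lemma commutator_in_lower_central_series:
  assumes "x \<in> lower_central_series G n" "y \<in> carrier G"
  shows "x \<otimes> y \<otimes> inv x \<otimes> inv y \<in> lower_central_series G (Suc n)"
  unfolding lower_central_series.simps using assms by (intro generate.incl) blast

declare lower_central_series.simps(2) [simp del]

lemma lower_central_series_decreasing:
  "lower_central_series G (Suc n) \<subseteq> lower_central_series G n"
proof -
  interpret L: normal "lower_central_series G n" G by (rule lower_central_series_normal)
  show ?thesis unfolding lower_central_series.simps
  proof (rule generate_subgroup_incl)
    show "{a \<otimes> b \<otimes> inv a \<otimes> inv b |a b. a \<in> lower_central_series G n \<and> b \<in> carrier G} \<subseteq> lower_central_series G n"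
    proof safe
      fix a b assume ab: "a \<in> lower_central_series G n" "b \<in> carrier G"
      then have "a \<otimes> (b \<otimes> inv a \<otimes> inv b) \<in> lower_central_series G n"
        by (simp add: L.inv_op_closed2)
      then show "a \<otimes> b \<otimes> inv a \<otimes> inv b \<in> lower_central_series G n"
        using ab by (simp add: m_assoc)
    qed
  qed (rule lower_central_series_subgroup)
qed

text \<open>Modulo the next term but one, the commutator is a homomorphism in each argument; hence the
  commutators of generators suffice.\<close>

lemma lower_central_series_layer_finitely_generated:
  assumes "finite S" "S \<subseteq> carrier G" "generate G S = carrier G"
  shows "\<exists>T. finite T \<and> T \<subseteq> lower_central_series G n \<and>
    lower_central_series G n = generate G (T \<union> lower_central_series G (Suc n))"
proof (induction n)
  case 0
  have "generate G (S \<union> lower_central_series G (Suc 0)) = carrier G"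
  proof
    have "S \<union> lower_central_series G (Suc 0) \<subseteq> carrier G"
      using assms lower_central_series_in_carrier by blast
    then show "generate G (S \<union> lower_central_series G (Suc 0)) \<subseteq> carrier G" by (rule generate_incl)
    show "carrier G \<subseteq> generate G (S \<union> lower_central_series G (Suc 0))"
      using mono_generate[of S "S \<union> lower_central_series G (Suc 0)"] assms(3) by simp
  qed
  then show ?case using assms by (intro exI[of _ S]) auto
next
  case (Suc n)
  let ?L = "lower_central_series G"
  obtain T where T: "finite T" "T \<subseteq> ?L n" "?L n = generate G (T \<union> ?L (Suc n))" using Suc by blast
  \<comment> \<open>Commutators of generators of the layer with generators of the group;
    \<open>H\<close> is the candidate for the whole next term.\<close>
  define U where "U = (\<lambda>(a, b). a \<otimes> b \<otimes> inv a \<otimes> inv b) ` (T \<times> S)"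
  define H where "H = generate G (U \<union> ?L (Suc (Suc n)))"
  have U: "U \<subseteq> ?L (Suc n)"
  proof
    fix u assume "u \<in> U"
    then obtain a b where "a \<in> T" "b \<in> S" "u = a \<otimes> b \<otimes> inv a \<otimes> inv b" unfolding U_def by auto
    then show "u \<in> ?L (Suc n)"
      using T(2) assms(2) commutator_in_lower_central_series by blast
  qed
  then have UL: "U \<union> ?L (Suc (Suc n)) \<subseteq> ?L (Suc n)"
    using lower_central_series_decreasing by (metis Un_least)
  then have HL: "H \<subseteq> ?L (Suc n)"
    unfolding H_def by (intro generate_subgroup_incl lower_central_series_subgroup)
  have incl: "U \<subseteq> H" "?L (Suc (Suc n)) \<subseteq> H" unfolding H_def by (auto intro: generate.incl)
  have Hsub: "subgroup H G" unfolding H_def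
    using UL lower_central_series_in_carrier by (intro generate_is_subgroup) blast
  \<comment> \<open>Conjugation changes elements of \<open>H\<close> only by elements of
    \<open>?L (Suc (Suc n))\<close>, which \<open>H\<close> contains. Normality allows computing
    modulo \<open>H\<close>.\<close>
  have "H \<lhd> G"
    using Hsub
  proof (rule normal_of_commutators)
    fix x y assume "x \<in> H" "y \<in> carrier G"
    then have "x \<otimes> y \<otimes> inv x \<otimes> inv y \<in> ?L (Suc (Suc n))"
      using HL by (intro commutator_in_lower_central_series) auto
    then show "x \<otimes> y \<otimes> inv x \<otimes> inv y \<in> H" using incl(2) by blast
  qed
  then interpret H: normal H G .
  \<comment> \<open>The second argument stays a generator while the first is extended from
    \<open>T\<close> to \<open>?L n\<close>; on \<open>?L (Suc n)\<close> the commutators lie in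
    \<open>H\<close> anyway. Fact \<open>2\<close> frees the second argument.\<close>
  have 1: "x \<otimes> b \<otimes> inv x \<otimes> inv b \<in> H" if "b \<in> S" "x \<in> ?L n" for x b
  proof -
    have b: "b \<in> carrier G" using that assms by auto
    have "T \<union> ?L (Suc n) \<subseteq> {x \<in> carrier G. x \<otimes> b \<otimes> inv x \<otimes> inv b \<in> H}"
    proof
      fix x assume "x \<in> T \<union> ?L (Suc n)"
      then consider "x \<in> T" | "x \<in> ?L (Suc n)" by blast
      then show "x \<in> {x \<in> carrier G. x \<otimes> b \<otimes> inv x \<otimes> inv b \<in> H}"
      proof cases
        case 1
        then have "x \<otimes> b \<otimes> inv x \<otimes> inv b \<in> U" using that(1) unfolding U_def by force
        then show ?thesis using incl 1 T(2) lower_central_series_in_carrier by blast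
      next
        case 2
        then show ?thesis
          using incl b commutator_in_lower_central_series lower_central_series_in_carrier by blast
      qed
    qed
    then have "?L n \<subseteq> {x \<in> carrier G. x \<otimes> b \<otimes> inv x \<otimes> inv b \<in> H}"
      unfolding T(3) by (rule generate_subgroup_incl) (rule H.subgroup_commuting_mod(1)[OF b])
    then show ?thesis using that by blast
  qed
  have 2: "x \<otimes> y \<otimes> inv x \<otimes> inv y \<in> H" if x: "x \<in> ?L n" and y: "y \<in> carrier G" for x y
  proof -
    have "S \<subseteq> {y \<in> carrier G. x \<otimes> y \<otimes> inv x \<otimes> inv y \<in> H}" using assms 1 x by blast
    then have "carrier G \<subseteq> {y \<in> carrier G. x \<otimes> y \<otimes> inv x \<otimes> inv y \<in> H}"
      unfolding assms(3)[symmetric]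
      by (rule generate_subgroup_incl)
        (use H.subgroup_commuting_mod(2)[OF lower_central_series_in_carrier[OF x]] assms(3) in simp)
    then show ?thesis using y by blast
  qed
  have "?L (Suc n) \<subseteq> H"
    unfolding lower_central_series.simps(2)[of G n]
    by (rule generate_subgroup_incl) (use 2 Hsub in auto)
  then show ?case
    using HL U T(1) assms(1) unfolding H_def by (intro exI[of _ U]) (auto simp: U_def)
qed

end

text \<open>In each step \<open>N / N'\<close> is cyclic, generated by the class of
  \<open>a\<close>, and central in the quotient by \<open>N'\<close>. The conditions are stated on
  elements so that they pass to homomorphic images and, level by level, to closures. The series
  grows upwards, so rule induction starts at the trivial subgroup.\<close>

inductive central_cyclic_series :: "('g, 'b) monoid_scheme \<Rightarrow> 'g set \<Rightarrow> bool" for G (structure) where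
  one: "central_cyclic_series G {\<one>}"
| step: "\<lbrakk>central_cyclic_series G N'; subgroup N G; N' \<subseteq> N; a \<in> N;
    \<And>x. x \<in> N \<Longrightarrow> \<exists>k::int. \<exists>y\<in>N'. x = a [^] k \<otimes> y;
    \<And>x y. x \<in> N \<Longrightarrow> y \<in> carrier G \<Longrightarrow> x \<otimes> y \<otimes> inv x \<otimes> inv y \<in> N'\<rbrakk>
    \<Longrightarrow> central_cyclic_series G N"

context group
begin

lemma central_cyclic_series_subgroup: "central_cyclic_series G N \<Longrightarrow> subgroup N G"
  by (induction rule: central_cyclic_series.induct) (auto simp: triv_subgroup)

lemma central_cyclic_series_normal: "central_cyclic_series G N \<Longrightarrow> N \<lhd> G"
proof (induction rule: central_cyclic_series.induct)
  case one
  show ?case by (rule one_is_normal)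
next
  case (step N' N a)
  then show ?case by (intro normal_of_commutators) auto
qed

lemma subgroup_powers_mult:
  assumes "M \<lhd> G" "a \<in> carrier G"
  shows "subgroup {a [^] (k::int) \<otimes> y | k y. y \<in> M} G"
proof -
  interpret M: normal M G by fact
  have move: "y \<otimes> a [^] k = a [^] k \<otimes> (inv (a [^] k) \<otimes> y \<otimes> a [^] k)" if "y \<in> M" for y and k::int
    using that assms by (simp add: m_assoc[symmetric])
  show ?thesis
  proof (rule subgroupI)
    fix u assume "u \<in> {a [^] (k::int) \<otimes> y | k y. y \<in> M}"
    then obtain k :: int and y where u: "u = a [^] k \<otimes> y" "y \<in> M" by auto
    have "inv u = inv y \<otimes> a [^] (-k)" using u assms by (simp add: inv_mult_group int_pow_neg)
    also have "\<dots> = a [^] (-k) \<otimes> (inv (a [^] (-k)) \<otimes> inv y \<otimes> a [^] (-k))" using u by (intro move) simp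
    finally show "inv u \<in> {a [^] (k::int) \<otimes> y | k y. y \<in> M}"
      using u assms M.inv_op_closed1[of "a [^] (-k)" "inv y"] by (auto simp del: int_pow_neg)
  next
    fix u v assume "u \<in> {a [^] (k::int) \<otimes> y | k y. y \<in> M}" "v \<in> {a [^] (k::int) \<otimes> y | k y. y \<in> M}"
    then obtain k l :: int and y z where uv: "u = a [^] k \<otimes> y" "y \<in> M" "v = a [^] l \<otimes> z" "z \<in> M" by auto
    have "u \<otimes> v = a [^] k \<otimes> (y \<otimes> a [^] l) \<otimes> z" using uv assms by (simp add: m_assoc)
    also have "\<dots> = a [^] (k + l) \<otimes> ((inv (a [^] l) \<otimes> y \<otimes> a [^] l) \<otimes> z)"
      unfolding move[OF uv(2)] using uv assms by (simp add: m_assoc int_pow_mult)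
    finally show "u \<otimes> v \<in> {a [^] (k::int) \<otimes> y | k y. y \<in> M}"
      using uv assms M.inv_op_closed1[of "a [^] l" y] by blast
  next
    have "a [^] (0::int) \<otimes> \<one> \<in> {a [^] (k::int) \<otimes> y | k y. y \<in> M}" using M.one_closed by blast
    then show "{a [^] (k::int) \<otimes> y | k y. y \<in> M} \<noteq> {}" by blast
  qed (use assms in auto)
qed

text \<open>The elements of \<open>T\<close> are adjoined one at a time, each giving one cyclic
  step. All intermediate subgroups lie between \<open>M\<close> and \<open>L\<close>, so their
  commutators with the whole group fall into \<open>M\<close>.\<close>

lemma central_cyclic_series_extend:
  assumes "central_cyclic_series G M" "finite T" "T \<subseteq> L" "subgroup L G" "M \<subseteq> L"
    and "\<And>x y. x \<in> L \<Longrightarrow> y \<in> carrier G \<Longrightarrow> x \<otimes> y \<otimes> inv x \<otimes> inv y \<in> M"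
  shows "central_cyclic_series G (generate G (T \<union> M))"
  using assms(2,3)
proof (induction T rule: finite_induct)
  case empty
  have "generate G M = M"
    using central_cyclic_series_subgroup[OF assms(1)]
    by (metis generateI order_refl subgroup.subset)
  then show ?case using assms(1) by simp
next
  case (insert a T)
  let ?N' = "generate G (T \<union> M)" and ?N = "generate G (insert a T \<union> M)"
  have L: "insert a T \<union> M \<subseteq> L" "insert a T \<union> M \<subseteq> carrier G"
    using insert.prems assms(5) subgroup.subset[OF assms(4)] by blast+
  have NL: "?N \<subseteq> L" using L(1) assms(4) by (rule generate_subgroup_incl)
  have cc: "central_cyclic_series G ?N'" using insert.IH insert.prems by blast
  have N: "subgroup ?N G" using L by (intro generate_is_subgroup)
  have MN': "M \<subseteq> ?N'" and aN: "a \<in> ?N" by (auto intro: generate.incl)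
  have a: "a \<in> carrier G" using L by auto
  let ?A = "{a [^] (k::int) \<otimes> y | k y. y \<in> ?N'}"
  have A: "subgroup ?A G"
    using central_cyclic_series_normal[OF cc] a by (rule subgroup_powers_mult)
  have "insert a T \<union> M \<subseteq> ?A"
  proof
    fix x assume x: "x \<in> insert a T \<union> M"
    have N'1: "\<one> \<in> ?N'" by (rule generate.one)
    show "x \<in> ?A"
    proof (cases "x = a")
      case True
      then have "x = a [^] (1::int) \<otimes> \<one>" using a by simp
      then show ?thesis using N'1 by blast
    next
      case False
      then have "x \<in> ?N'" using x by (auto intro: generate.incl)
      moreover have "x = a [^] (0::int) \<otimes> x" using x L by auto
      ultimately show ?thesis by blast
    qed
  qed
  then have "?N \<subseteq> ?A" using A by (rule generate_subgroup_incl)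
  moreover have "?N' \<subseteq> ?N" by (rule mono_generate) auto
  ultimately show ?case
    using assms(6) NL MN' by (intro central_cyclic_series.step[OF cc N _ aN]) blast+
qed

theorem finitely_generated_nilpotent_central_cyclic_series:
  assumes "finitely_generated_group G" "nilpotent_group G"
  shows "central_cyclic_series G (carrier G)"
proof -
  obtain S where S: "finite S" "S \<subseteq> carrier G" "generate G S = carrier G"
    using assms(1) unfolding finitely_generated_group_def by blast
  obtain c where c: "lower_central_series G c = {\<one>}"
    using assms(2) unfolding nilpotent_group_def by blast
  \<comment> \<open>The index \<open>c - n\<close> runs through the lower central series from its
    trivial term upwards.\<close>
  have "central_cyclic_series G (lower_central_series G (c - n))" if "n \<le> c" for n
    using that
  proof (induction n)
    case 0
    then show ?case using c central_cyclic_series.one by simp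
  next
    case (Suc n)
    let ?m = "c - Suc n"
    have m: "Suc ?m = c - n" using Suc by simp
    obtain T where T: "finite T" "T \<subseteq> lower_central_series G ?m"
      "lower_central_series G ?m = generate G (T \<union> lower_central_series G (Suc ?m))"
      using lower_central_series_layer_finitely_generated[OF S] by blast
    have "central_cyclic_series G (lower_central_series G (Suc ?m))"
      using Suc m by simp
    then have "central_cyclic_series G (generate G (T \<union> lower_central_series G (Suc ?m)))"
      using T lower_central_series_subgroup lower_central_series_decreasing commutator_in_lower_central_series
      by (intro central_cyclic_series_extend[where L = "lower_central_series G ?m"]) blast+
    then show ?case by (simp only: T(3)[symmetric])
  qed
  from this[of c] show ?thesis by simp
qed

text \<open>Climbing the series from below, consider the first term that is not inside
  \<open>K\<close>: commutators of its elements lie in the preceding term, hence in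
  \<open>K\<close>. For \<open>K\<close> the preimage of a proper normal subgroup this yields a
  nontrivial central element of the quotient.\<close>

lemma central_cyclic_series_non_central:
  assumes "central_cyclic_series G N" "\<not> N \<subseteq> K" "\<one> \<in> K"
  shows "\<exists>z\<in>carrier G - K. \<forall>y\<in>carrier G. z \<otimes> y \<otimes> inv z \<otimes> inv y \<in> K"
  using assms
proof (induction rule: central_cyclic_series.induct)
  case one
  then show ?case by auto
next
  case (step N' N a)
  show ?case
  proof (cases "N' \<subseteq> K")
    case True
    obtain z where z: "z \<in> N" "z \<notin> K" using step.prems by blast
    then have "z \<in> carrier G" using step.hyps subgroup.mem_carrier by metis
    then show ?thesis using z True step.hyps(6) by blast
  next
    case False
    then show ?thesis using step.IH step.prems(2) by blast
  qed
qed

end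


section \<open>Central elements of finite nilpotent groups\<close>

context group
begin

text \<open>As \<open>z\<close> is central, each further factor moved past the other element costs
  another \<open>z [^] k\<close>, so the exponent is linear in \<open>i\<close>.\<close>

lemma commute_up_to_central_pow:
  fixes k i :: nat
  assumes "g \<in> carrier G" "h \<in> carrier G" "z \<in> carrier G"
    and zc: "\<And>x. x \<in> carrier G \<Longrightarrow> z \<otimes> x = x \<otimes> z" and gh: "g \<otimes> h = z [^] k \<otimes> (h \<otimes> g)"
  shows "g [^] i \<otimes> h = z [^] (k * i) \<otimes> (h \<otimes> g [^] i)"
    and "g \<otimes> h [^] i = z [^] (k * i) \<otimes> (h [^] i \<otimes> g)"
proof -
  have zp: "z [^] (m::nat) \<otimes> x = x \<otimes> z [^] m" if "x \<in> carrier G" for x m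
    by (rule group_commutes_pow) (simp_all add: zc that assms)
  show "g [^] i \<otimes> h = z [^] (k * i) \<otimes> (h \<otimes> g [^] i)"
  proof (induction i)
    case (Suc i)
    have "g [^] Suc i \<otimes> h = g [^] i \<otimes> (g \<otimes> h)" using assms(1-3) by (simp add: m_assoc)
    also have "\<dots> = (g [^] i \<otimes> z [^] k) \<otimes> (h \<otimes> g)" unfolding gh using assms(1-3) by (simp add: m_assoc)
    also have "\<dots> = z [^] k \<otimes> (g [^] i \<otimes> h) \<otimes> g"
      using assms(1-3) by (simp add: zp[of "g [^] i", symmetric] m_assoc)
    also have "\<dots> = z [^] (k * Suc i) \<otimes> (h \<otimes> g [^] Suc i)"
      unfolding Suc using assms(1-3) by (simp add: m_assoc nat_pow_mult[symmetric] add.commute)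
    finally show ?case .
  qed (use assms in simp)
  show "g \<otimes> h [^] i = z [^] (k * i) \<otimes> (h [^] i \<otimes> g)"
  proof (induction i)
    case (Suc i)
    have "g \<otimes> h [^] Suc i = (g \<otimes> h [^] i) \<otimes> h" using assms(1-3) by (simp add: m_assoc)
    also have "\<dots> = z [^] (k * i) \<otimes> (h [^] i \<otimes> z [^] k) \<otimes> (h \<otimes> g)"
      unfolding Suc using assms(1-3) gh by (simp add: m_assoc)
    also have "\<dots> = z [^] (k * i) \<otimes> z [^] k \<otimes> (h [^] i \<otimes> (h \<otimes> g))"
      using assms(1-3) by (simp add: zp[of "h [^] i", symmetric] m_assoc)
    also have "\<dots> = z [^] (k * Suc i) \<otimes> (h [^] Suc i \<otimes> g)"
      using assms(1-3) by (simp add: m_assoc nat_pow_mult add.commute)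
    finally show ?case .
  qed (use assms in simp)
qed

text \<open>Otherwise \<open>q\<close> divides \<open>t\<close>, the centralizer \<open>C\<close> of \<open>g\<close> has index \<open>q\<close>, and the order of
  \<open>C / \<langle>z\<rangle>\<close> is prime to \<open>q\<close>; so \<open>g\<close> has a power with exponent prime to \<open>q\<close> in \<open>\<langle>z\<rangle>\<close>.\<close>

lemma central_if_central_modulo_prime:
  fixes q t :: nat
  assumes fin: "finite (carrier G)" and g: "g \<in> carrier G" and z: "z \<in> carrier G"
    and zc: "\<And>x. x \<in> carrier G \<Longrightarrow> z \<otimes> x = x \<otimes> z"
    and q: "prime q" "ord z = q"
    and comm: "\<And>x. x \<in> carrier G \<Longrightarrow> \<exists>k::nat. g \<otimes> x = z [^] k \<otimes> (x \<otimes> g)"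
    and t: "g [^] t = \<one>" "q dvd t \<Longrightarrow> \<not> q ^ 3 dvd order G"
    and h: "h \<in> carrier G"
  shows "g \<otimes> h = h \<otimes> g"
proof (rule ccontr)
  assume neq: "g \<otimes> h \<noteq> h \<otimes> g"
  obtain k :: nat where k: "g \<otimes> h = z [^] k \<otimes> (h \<otimes> g)" using comm h by blast
  have z_eq: "z [^] (m::nat) = \<one> \<longleftrightarrow> q dvd m" for m using pow_eq_id[OF z] q by simp
  have cancel: "q dvd m" if "x \<in> carrier G" "x = z [^] (m::nat) \<otimes> x" for m x
    using that z by (metis z_eq nat_pow_closed r_cancel_one')
  note pows = commute_up_to_central_pow[OF g h z zc k]
  have "\<not> q dvd k" using k neq z_eq[of k] h g by auto
  then have qk: "q dvd k * m \<longleftrightarrow> q dvd m" for m using q by (simp add: prime_dvd_mult_iff)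
  \<comment> \<open>Powers of \<open>g\<close> commuting with \<open>h\<close>, and powers of
    \<open>h\<close> commuting with \<open>g\<close>, have exponents divisible by
    \<open>q\<close>.\<close>
  have gpow: "q dvd m" if "g [^] m \<otimes> h = h \<otimes> g [^] m" for m
    using pows(1)[of m] that g h qk cancel[of "h \<otimes> g [^] m" "k * m"] by simp
  have hpow: "q dvd m" if "g \<otimes> h [^] m = h [^] m \<otimes> g" for m
    using pows(2)[of m] that g h qk cancel[of "h [^] m \<otimes> g" "k * m"] by simp
  have "q dvd t" using gpow[of t] t(1) h by simp
  then have not3: "\<not> q ^ 3 dvd order G" by (rule t(2))
  define C where "C = {x \<in> carrier G. x \<otimes> g = g \<otimes> x}"
  have C: "subgroup C G" unfolding C_def using g by (rule subgroup_centralizer)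
  have Ccar: "C \<subseteq> carrier G" unfolding C_def by auto
  \<comment> \<open>The elements \<open>inv (h [^] i)\<close> with \<open>i < q\<close> represent
    the left cosets of \<open>C\<close>: two in one coset would give a power of \<open>h\<close>
    with positive exponent below \<open>q\<close> that commutes with \<open>g\<close>, and the
    factor by which \<open>g\<close> and \<open>x\<close> fail to commute can be cancelled by a
    power of \<open>h\<close>. So \<open>C\<close> has index \<open>q\<close>.\<close>
  have "bij_betw (\<lambda>(i, c). inv (h [^] i) \<otimes> c) ({..<q} \<times> C) (carrier G)"
    unfolding bij_betw_def
  proof
    have lt: False if "i < j" "j < q" "c \<in> C" "d \<in> C" "inv (h [^] i) \<otimes> c = inv (h [^] j) \<otimes> d"
      for i j :: nat and c d
    proof -
      have cd: "c \<in> carrier G" "d \<in> carrier G" using that Ccar by auto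
      have "h [^] j = h [^] (j - i) \<otimes> h [^] i" using that h by (simp add: nat_pow_mult)
      then have "d = h [^] (j - i) \<otimes> h [^] i \<otimes> (inv (h [^] i) \<otimes> c)"
        unfolding that(5) using cd h by (simp add: m_assoc[symmetric])
      also have "\<dots> = h [^] (j - i) \<otimes> c"
        using cd h by (simp add: m_assoc) (simp add: m_assoc[symmetric])
      finally have "h [^] (j - i) = d \<otimes> inv c" using cd h by (simp add: m_assoc)
      then have "h [^] (j - i) \<in> C"
        using that C by (simp add: subgroup.m_closed subgroup.m_inv_closed)
      then have "q dvd j - i" using hpow unfolding C_def by simp
      then show False using that by (auto dest: dvd_imp_le)
    qed
    show "inj_on (\<lambda>(i, c). inv (h [^] i) \<otimes> c) ({..<q} \<times> C)"
    proof (rule inj_onI, clarsimp)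
      fix i j c d assume ij: "i < q" "j < q" and cd: "c \<in> C" "d \<in> C"
        and eq: "inv (h [^] i) \<otimes> c = inv (h [^] j) \<otimes> d"
      have "i = j" using lt[of i j c d] lt[of j i d c] ij cd eq by (metis linorder_neqE_nat)
      moreover have "c = d" using eq cd Ccar h unfolding \<open>i = j\<close> by (auto simp: subset_iff)
      ultimately show "i = j \<and> c = d" by simp
    qed
    show "(\<lambda>(i, c). inv (h [^] i) \<otimes> c) ` ({..<q} \<times> C) = carrier G"
    proof safe
      fix x assume x: "x \<in> carrier G"
      obtain m :: nat where m: "g \<otimes> x = z [^] m \<otimes> (x \<otimes> g)" using comm x by blast
      have "coprime k q" using \<open>\<not> q dvd k\<close> q by (metis prime_imp_coprime coprime_commute)
      then obtain i0 where i0: "[k * i0 = 1] (mod q)" using cong_solve_coprime_nat by (metis One_nat_def)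
      \<comment> \<open>Chosen so that \<open>k * i + m\<close> vanishes modulo \<open>q\<close>:
        \<open>i0\<close> inverts \<open>k\<close>, and multiplication by \<open>q - 1\<close> is
        negation modulo \<open>q\<close> within the naturals.\<close>
      define i where "i = (i0 * ((q - 1) * m)) mod q"
      have i: "i < q" unfolding i_def using q prime_gt_0_nat by simp
      have "[k * i + m = k * i0 * ((q - 1) * m) + m] (mod q)"
        unfolding i_def mult.assoc
        by (intro cong_add cong_mult cong_refl) (simp add: cong_def)
      also have "[k * i0 * ((q - 1) * m) + m = 1 * ((q - 1) * m) + m] (mod q)"
        by (rule cong_add[OF cong_mult[OF i0 cong_refl] cong_refl])
      also have "1 * ((q - 1) * m) + m = q * m"
        using prime_gt_0_nat[OF q(1)] by (cases q) auto
      finally have dvd: "q dvd k * i + m" by (simp add: cong_def mod_eq_0_iff_dvd)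
      have zpow: "z [^] (m::nat) \<otimes> x = x \<otimes> z [^] m" if "x \<in> carrier G" for x m
        by (rule group_commutes_pow) (simp_all add: zc that z)
      have "g \<otimes> (h [^] i \<otimes> x) = z [^] (k * i) \<otimes> h [^] i \<otimes> (g \<otimes> x)"
        using pows(2)[of i] g h x z by (simp add: m_assoc[symmetric])
      also have "\<dots> = z [^] (k * i) \<otimes> (h [^] i \<otimes> z [^] m) \<otimes> x \<otimes> g"
        unfolding m using g h x z by (simp add: m_assoc)
      also have "\<dots> = z [^] (k * i + m) \<otimes> (h [^] i \<otimes> x \<otimes> g)"
        using g h x z by (simp add: zpow[of "h [^] i", symmetric] m_assoc nat_pow_mult[symmetric])
      also have "\<dots> = h [^] i \<otimes> x \<otimes> g" using z_eq[THEN iffD2, OF dvd] g h x by simp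
      finally have "h [^] i \<otimes> x \<in> C" unfolding C_def using h x by simp
      moreover have "x = inv (h [^] i) \<otimes> (h [^] i \<otimes> x)" using h x by (simp add: m_assoc[symmetric])
      ultimately show "x \<in> (\<lambda>(i, c). inv (h [^] i) \<otimes> c) ` ({..<q} \<times> C)" using i by force
    qed (use Ccar h in auto)
  qed
  then have cardC: "order G = q * card C"
    by (simp add: order_def bij_betw_same_card[symmetric] card_cartesian_product)
  interpret C: group "G\<lparr>carrier := C\<rparr>" using C by (rule subgroup.subgroup_is_group) (rule is_group)
  have zC: "z \<in> C" and gC: "g \<in> C" unfolding C_def using z g zc by auto
  define Z where "Z = generate G {z}"
  have Zpow: "Z = {z [^] i |i::int. i \<in> UNIV}" unfolding Z_def generate_pow[OF z] by simp
  have Zsub: "subgroup Z G" unfolding Z_def using z by (intro generate_is_subgroup) simp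
  have ZC: "Z \<subseteq> C" unfolding Z_def using zC C by (intro generate_subgroup_incl) auto
  have cardZ: "card Z = q" unfolding Z_def using generate_pow_card[OF z] q by simp
  have Zc: "y \<otimes> x = x \<otimes> y" if y: "y \<in> Z" and x: "x \<in> carrier G" for x y
  proof -
    have "{z} \<subseteq> {y \<in> carrier G. y \<otimes> x = x \<otimes> y}" using z zc x by auto
    then have "Z \<subseteq> {y \<in> carrier G. y \<otimes> x = x \<otimes> y}"
      unfolding Z_def by (rule generate_subgroup_incl) (rule subgroup_centralizer[OF x])
    then show ?thesis using y by auto
  qed
  have "subgroup Z (G\<lparr>carrier := C\<rparr>)" using Zsub ZC C by (simp add: subgroup_incl)
  then have "Z \<lhd> G\<lparr>carrier := C\<rparr>"
  proof (rule C.normal_of_commutators)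
    fix x y assume "x \<in> Z" "y \<in> carrier (G\<lparr>carrier := C\<rparr>)"
    then have xy: "x \<in> Z" "y \<in> C" "x \<in> carrier G" "y \<in> carrier G" using ZC Ccar by auto
    then have "x \<otimes> y \<otimes> inv x \<otimes> inv y = \<one>" using Zc commutator_eq_one_iff by simp
    moreover have "inv\<^bsub>G\<lparr>carrier := C\<rparr>\<^esub> x = inv x" "inv\<^bsub>G\<lparr>carrier := C\<rparr>\<^esub> y = inv y"
      using m_inv_consistent[OF C] xy ZC by auto
    ultimately show "x \<otimes>\<^bsub>G\<lparr>carrier := C\<rparr>\<^esub> y \<otimes>\<^bsub>G\<lparr>carrier := C\<rparr>\<^esub> inv\<^bsub>G\<lparr>carrier := C\<rparr>\<^esub> x
        \<otimes>\<^bsub>G\<lparr>carrier := C\<rparr>\<^esub> inv\<^bsub>G\<lparr>carrier := C\<rparr>\<^esub> y \<in> Z"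
      using subgroup.one_closed[OF Zsub] by simp
  qed
  then interpret Z: normal Z "G\<lparr>carrier := C\<rparr>" .
  interpret M: group "G\<lparr>carrier := C\<rparr> Mod Z" by (rule Z.factorgroup_is_group)
  define c where "c = order (G\<lparr>carrier := C\<rparr> Mod Z)"
  have "c * q = card C"
    using C.lagrange[OF Z.is_subgroup] cardZ unfolding c_def by (simp add: FactGroup_def order_def)
  \<comment> \<open>One factor \<open>q\<close> is the index of \<open>C\<close>, the other the
    order of \<open>Z\<close>; a third one in \<open>c\<close> would contradict
    \<open>not3\<close>.\<close>
  then have "order G = q * (q * c)" using cardC by (simp add: ac_simps)
  then have "\<not> q dvd c" using not3 by (auto simp: power3_eq_cube)
  have gZ: "Z #>\<^bsub>G\<lparr>carrier := C\<rparr>\<^esub> g \<in> carrier (G\<lparr>carrier := C\<rparr> Mod Z)"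
    using gC by (auto simp: carrier_FactGroup)
  have "(Z #>\<^bsub>G\<lparr>carrier := C\<rparr>\<^esub> g) [^]\<^bsub>G\<lparr>carrier := C\<rparr> Mod Z\<^esub> c = \<one>\<^bsub>G\<lparr>carrier := C\<rparr> Mod Z\<^esub>"
    using M.pow_order_eq_1[OF gZ] unfolding c_def .
  then have "Z #>\<^bsub>G\<lparr>carrier := C\<rparr>\<^esub> (g [^]\<^bsub>G\<lparr>carrier := C\<rparr>\<^esub> c) = Z"
    using Z.FactGroup_pow[of g c] gC by simp
  moreover have "g [^]\<^bsub>G\<lparr>carrier := C\<rparr>\<^esub> c = g [^] c" by (simp add: nat_pow_consistent[symmetric])
  moreover have "g [^] c \<in> C" using subgroup_int_pow_closed[OF C gC, of "int c"] by (simp add: int_pow_int)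
  ultimately have "g [^] c \<in> Z" using Z.r_coset_eq_one_iff[of "g [^] c"] by simp
  then have "g [^] c \<otimes> h = h \<otimes> g [^] c" using Zc h by blast
  then show False using gpow \<open>\<not> q dvd c\<close> by blast
qed

text \<open>The commutators of \<open>g\<close> are pushed down into smaller and smaller normal
  subgroups \<open>N\<close>. By \<open>nilpotent\<close> the quotient by \<open>N\<close> has a
  central element of prime order \<open>q\<close>; by induction the commutators lie in the preimage
  of its span, and \<open>central_if_central_modulo_prime\<close>, applied to the quotient, makes
  them trivial there. Treating one prime at a time takes the place of the Sylow
  decomposition.\<close>

theorem central_if_prime_powers_small:
  fixes t :: nat
  assumes fin: "finite (carrier G)"
    and nilpotent: "\<And>N. N \<lhd> G \<Longrightarrow> N \<noteq> carrier G \<Longrightarrow>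
      \<exists>z\<in>carrier G - N. \<forall>y\<in>carrier G. z \<otimes> y \<otimes> inv z \<otimes> inv y \<in> N"
    and g: "g \<in> carrier G" and gt: "g [^] t = \<one>"
    and small: "\<And>q. prime q \<Longrightarrow> q dvd t \<Longrightarrow> \<not> q ^ 3 dvd order G"
    and h: "h \<in> carrier G"
  shows "g \<otimes> h = h \<otimes> g"
proof -
  have "g \<otimes> x \<otimes> inv g \<otimes> inv x \<in> N" if "N \<lhd> G" "x \<in> carrier G" for N x
    using that
  proof (induction "card (carrier G) - card N" arbitrary: N x rule: less_induct)
    case less
    interpret N: normal N G by (rule less.prems)
    show ?case
    proof (cases "N = carrier G")
      case False
      let ?Q = "G Mod N" and ?\<pi> = "\<lambda>x. N #> x"
      interpret \<pi>: group_hom G ?Q ?\<pi> by (rule N.group_hom_Mod)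
      obtain z where z: "z \<in> carrier G" "z \<notin> N"
        and zc: "\<And>y. y \<in> carrier G \<Longrightarrow> z \<otimes> y \<otimes> inv z \<otimes> inv y \<in> N"
        using nilpotent[OF less.prems(1) False] by blast
      have Qfin: "finite (carrier ?Q)" using fin by (simp add: carrier_FactGroup)
      define m where "m = \<pi>.H.ord (?\<pi> z)"
      have "m \<noteq> 1" using \<pi>.H.ord_eq_1[OF \<pi>.hom_closed[OF z(1)]] N.r_coset_eq_one_iff[OF z(1)] z(2)
        unfolding m_def by simp
      have m0: "m > 0" unfolding m_def using \<pi>.H.ord_ge_1[OF Qfin \<pi>.hom_closed[OF z(1)]] by simp
      obtain q where q: "prime q" "q dvd m" using prime_factor_nat \<open>m \<noteq> 1\<close> by blast
      \<comment> \<open>This power of \<open>z\<close> has order exactly \<open>q\<close> modulo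
        \<open>N\<close> and is still central there.\<close>
      define w where "w = z [^] (m div q)"
      have w: "w \<in> carrier G" unfolding w_def using z by simp
      have \<pi>w: "?\<pi> w = ?\<pi> z [^]\<^bsub>?Q\<^esub> (m div q)"
        unfolding w_def using z by (simp add: N.FactGroup_pow)
      have mq: "m div q dvd m" "m div q \<noteq> 0" "m div (m div q) = q"
        using q m0 prime_gt_0_nat by (auto simp: dvd_def)
      have ordw: "\<pi>.H.ord (?\<pi> w) = q"
        unfolding \<pi>w using \<pi>.H.ord_pow[OF \<pi>.hom_closed[OF z(1)], of "m div q"] mq
        unfolding m_def[symmetric] by simp
      have wN: "w \<notin> N"
        using \<pi>.H.ord_eq_1[OF \<pi>.hom_closed[OF w]] N.r_coset_eq_one_iff[OF w] ordw q by auto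
      have wc: "?\<pi> w \<otimes>\<^bsub>?Q\<^esub> u = u \<otimes>\<^bsub>?Q\<^esub> ?\<pi> w" if u: "u \<in> carrier ?Q" for u
      proof -
        obtain y where y: "y \<in> carrier G" "u = ?\<pi> y" using u by (auto simp: carrier_FactGroup)
        have "?\<pi> z \<otimes>\<^bsub>?Q\<^esub> u = u \<otimes>\<^bsub>?Q\<^esub> ?\<pi> z"
          using N.commutator_in_iff[OF z(1) y(1)] zc[OF y(1)] y(2) by simp
        then show ?thesis unfolding \<pi>w using u z(1) by (intro \<pi>.H.group_commutes_pow \<pi>.hom_closed)
      qed
      define N' where "N' = {w [^] (k::int) \<otimes> y | k y. y \<in> N}"
      have N'sub: "subgroup N' G" unfolding N'_def using less.prems(1) w by (rule subgroup_powers_mult)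
      have NN': "N \<subseteq> N'"
      proof
        fix x assume "x \<in> N"
        moreover have "x = w [^] (0::int) \<otimes> x" using \<open>x \<in> N\<close> by simp
        ultimately show "x \<in> N'" unfolding N'_def by blast
      qed
      have wN': "w \<in> N'"
      proof -
        have "w = w [^] (1::int) \<otimes> \<one>" using w by simp
        then show ?thesis unfolding N'_def using N.one_closed by blast
      qed
      have \<pi>N': "\<exists>k::int. ?\<pi> x = ?\<pi> w [^]\<^bsub>?Q\<^esub> k" if x: "x \<in> N'" for x
      proof -
        obtain k :: int and y where ky: "x = w [^] k \<otimes> y" "y \<in> N" using x unfolding N'_def by blast
        have "?\<pi> x = ?\<pi> (w [^] k) \<otimes>\<^bsub>?Q\<^esub> ?\<pi> y" unfolding ky(1) using w ky(2) by (intro \<pi>.hom_mult) auto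
        also have "?\<pi> y = \<one>\<^bsub>?Q\<^esub>" using N.r_coset_eq_one_iff[of y] ky by simp
        also have "?\<pi> (w [^] k) \<otimes>\<^bsub>?Q\<^esub> \<one>\<^bsub>?Q\<^esub> = ?\<pi> (w [^] k)"
          using w by (intro \<pi>.H.r_one \<pi>.hom_closed) simp
        also have "\<dots> = ?\<pi> w [^]\<^bsub>?Q\<^esub> k" using w by (rule \<pi>.hom_int_pow)
        finally show ?thesis by blast
      qed
      have N'norm: "N' \<lhd> G"
        using N'sub
      proof (rule normal_of_commutators)
        fix x y assume x: "x \<in> N'" and y: "y \<in> carrier G"
        have xG: "x \<in> carrier G" using N'sub x by (rule subgroup.mem_carrier)
        have \<pi>y: "?\<pi> y \<in> carrier ?Q" using y by (rule \<pi>.hom_closed)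
        have \<pi>wQ: "?\<pi> w \<in> carrier ?Q" using w by (rule \<pi>.hom_closed)
        obtain k :: int where "?\<pi> x = ?\<pi> w [^]\<^bsub>?Q\<^esub> k" using \<pi>N'[OF x] by blast
        moreover have "?\<pi> w [^]\<^bsub>?Q\<^esub> k \<in> {u \<in> carrier ?Q. u \<otimes>\<^bsub>?Q\<^esub> ?\<pi> y = ?\<pi> y \<otimes>\<^bsub>?Q\<^esub> u}"
          using \<pi>.H.subgroup_centralizer[OF \<pi>y] wc[OF \<pi>y] \<pi>wQ
          by (intro \<pi>.H.subgroup_int_pow_closed) blast+
        ultimately have "x \<otimes> y \<otimes> inv x \<otimes> inv y \<in> N"
          using N.commutator_in_iff[OF xG y] by simp
        then show "x \<otimes> y \<otimes> inv x \<otimes> inv y \<in> N'" using NN' by blast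
      qed
      have "N \<subset> N'" using NN' wN wN' by blast
      moreover have "N' \<subseteq> carrier G" using N'sub by (rule subgroup.subset)
      moreover have "finite N'" using fin \<open>N' \<subseteq> carrier G\<close> by (rule rev_finite_subset)
      ultimately have card: "card (carrier G) - card N' < card (carrier G) - card N"
        using fin by (intro diff_less_mono2) (auto intro: psubset_card_mono)
      have comm: "\<exists>k::nat. ?\<pi> g \<otimes>\<^bsub>?Q\<^esub> u = ?\<pi> w [^]\<^bsub>?Q\<^esub> k \<otimes>\<^bsub>?Q\<^esub> (u \<otimes>\<^bsub>?Q\<^esub> ?\<pi> g)" if u: "u \<in> carrier ?Q" for u
      proof -
        obtain y where y: "y \<in> carrier G" "u = ?\<pi> y" using u by (auto simp: carrier_FactGroup)
        have "g \<otimes> y \<otimes> inv g \<otimes> inv y \<in> N'" using less.hyps[OF card N'norm y(1)] .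
        then obtain k :: int where k: "?\<pi> (g \<otimes> y \<otimes> inv g \<otimes> inv y) = ?\<pi> w [^]\<^bsub>?Q\<^esub> k" using \<pi>N' by blast
        have "g \<otimes> y = (g \<otimes> y \<otimes> inv g \<otimes> inv y) \<otimes> (y \<otimes> g)"
          using g y by (simp add: m_assoc) (simp add: m_assoc[symmetric])
        then have "?\<pi> (g \<otimes> y) = ?\<pi> (g \<otimes> y \<otimes> inv g \<otimes> inv y) \<otimes>\<^bsub>?Q\<^esub> ?\<pi> (y \<otimes> g)"
          using g y \<pi>.hom_mult[of "g \<otimes> y \<otimes> inv g \<otimes> inv y" "y \<otimes> g"] by simp
        then have *: "?\<pi> g \<otimes>\<^bsub>?Q\<^esub> u = ?\<pi> w [^]\<^bsub>?Q\<^esub> k \<otimes>\<^bsub>?Q\<^esub> (u \<otimes>\<^bsub>?Q\<^esub> ?\<pi> g)"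
          unfolding k y(2) using g y \<pi>.hom_mult[of g y] \<pi>.hom_mult[of y g] by simp
        \<comment> \<open>Since \<open>w\<close> has order \<open>q\<close> modulo \<open>N\<close>,
          the integer exponent can be replaced by a natural one, as
          \<open>central_if_central_modulo_prime\<close> requires.\<close>
        define l where "l = nat (k mod int q)"
        have "int l = k mod int q" unfolding l_def using q prime_gt_0_nat by simp
        then have "int q dvd k - int l" by (simp add: mod_eq_dvd_iff[symmetric])
        then have "?\<pi> w [^]\<^bsub>?Q\<^esub> int l = ?\<pi> w [^]\<^bsub>?Q\<^esub> k"
          using \<pi>.H.int_pow_eq[OF \<pi>.hom_closed[OF w], of "int l" k] ordw by simp
        then show ?thesis using * by (metis int_pow_int)
      qed
      have "\<not> q ^ 3 dvd order ?Q" if "q dvd t"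
      proof -
        have "order ?Q dvd order G"
          using lagrange[OF N.is_subgroup] by (metis FactGroup_def dvd_triv_left order_def partial_object.select_convs(1))
        then show ?thesis using small[OF q(1) that] dvd_trans by blast
      qed
      moreover have "?\<pi> g [^]\<^bsub>?Q\<^esub> t = \<one>\<^bsub>?Q\<^esub>"
        using N.FactGroup_pow[OF g, of t] gt by (simp add: N.subset)
      ultimately have "?\<pi> g \<otimes>\<^bsub>?Q\<^esub> ?\<pi> x = ?\<pi> x \<otimes>\<^bsub>?Q\<^esub> ?\<pi> g"
        using \<pi>.H.central_if_central_modulo_prime[OF Qfin \<pi>.hom_closed[OF g] \<pi>.hom_closed[OF w] wc q(1) ordw comm]
          \<pi>.hom_closed[OF less.prems(2)] by blast
      then show ?thesis using N.commutator_in_iff[OF g less.prems(2)] by simp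
    qed (use g less.prems in simp)
  qed
  from this[OF one_is_normal h] show ?thesis using commutator_eq_one_iff[OF g h] by simp
qed

end


section \<open>Groups with a sequence of finite quotients\<close>

text \<open>The numbers \<open>v n N\<close> are truncations, at the bounds \<open>e N\<close>, of
  one value in the naturals with infinity. If some entry is below its bound, it is that value,
  remains visible for all later \<open>n\<close>, and decreases only finitely often. Otherwise every
  \<open>v n N\<close> equals \<open>e N\<close>.\<close>

lemma stationary_of_min:
  fixes v :: "nat \<Rightarrow> nat \<Rightarrow> nat"
  assumes dec: "\<And>m n N. m \<le> n \<Longrightarrow> v n N \<le> v m N"
    and min: "\<And>n N N'. N \<le> N' \<Longrightarrow> v n N = min (v n N') (e N)"
  shows "\<exists>n0. \<forall>n\<ge>n0. \<forall>N. v n N = v n0 N"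
proof (cases "\<exists>n1 N1. v n1 N1 < e N1")
  case True
  then obtain n1 N1 where 1: "v n1 N1 < e N1" by blast
  obtain n0 where n0: "n0 \<ge> n1" "\<And>n. n \<ge> n1 \<Longrightarrow> v n0 N1 \<le> v n N1"
    using ex_has_least_nat[of "\<lambda>n. n \<ge> n1" n1 "\<lambda>n. v n N1"] by blast
  have *: "v n N = (if N1 \<le> N then v n N1 else min (v n N1) (e N))" if "n \<ge> n1" for n N
  proof -
    have "v n N1 < e N1" using dec[OF that, of N1] 1 by linarith
    then have "v n N = v n N1" if "N1 \<le> N"
      using min[OF that, of n] by (simp add: min_def split: if_splits)
    moreover have "v n N = min (v n N1) (e N)" if "\<not> N1 \<le> N"
      by (rule min) (use that in simp)
    ultimately show ?thesis by simp
  qed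
  have "v n N = v n0 N" if "n \<ge> n0" for n N
  proof -
    have "v n N1 = v n0 N1" using dec[OF that, of N1] n0 that by (intro antisym) auto
    then show ?thesis using *[of n N] *[of n0 N] n0 that by simp
  qed
  then show ?thesis by blast
next
  case False
  then have "v n N = e N" for n N using min[of N N n] by (metis min.cobounded2 order_refl le_neq_implies_less)
  then show ?thesis by simp
qed

text \<open>At each prime, divisibility and gcd become order and minimum of multiplicities, so
  \<open>stationary_of_min\<close> applies. Finiteness of \<open>S\<close> gives a common threshold;
  at all other primes the multiplicities are 0.\<close>

lemma stationary_of_gcd:
  fixes i :: "nat \<Rightarrow> nat \<Rightarrow> nat"
  assumes fin: "finite S" and pos: "\<And>n N. 0 < i n N" "\<And>N. 0 < e N"
    and dec: "\<And>m n N. m \<le> n \<Longrightarrow> i n N dvd i m N"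
    and gcd: "\<And>n N N'. N \<le> N' \<Longrightarrow> i n N = gcd (i n N') (e N)"
    and S: "\<And>p n N. prime p \<Longrightarrow> p dvd i n N \<Longrightarrow> p \<in> S"
  shows "\<exists>n0. \<forall>n\<ge>n0. \<forall>N. i n N = i n0 N"
proof -
  have "\<exists>n0. \<forall>n\<ge>n0. \<forall>N. multiplicity p (i n N) = multiplicity p (i n0 N)" if "prime p" for p
  proof (rule stationary_of_min)
    show "multiplicity p (i n N) \<le> multiplicity p (i m N)" if "m \<le> n" for m n N
      by (rule dvd_imp_multiplicity_le[OF dec[OF that]]) (use pos(1)[of m N] in simp)
    show "multiplicity p (i n N) = min (multiplicity p (i n N')) (multiplicity p (e N))" if "N \<le> N'" for n N N'
      unfolding gcd[OF that, of n]
      by (rule multiplicity_gcd) (use pos(1)[of n N'] pos(2)[of N] \<open>prime p\<close> in simp_all)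
  qed
  then obtain n0 where n0: "\<And>p n N. prime p \<Longrightarrow> n \<ge> n0 p \<Longrightarrow>
      multiplicity p (i n N) = multiplicity p (i (n0 p) N)" by metis
  define n1 where "n1 = Max (insert 0 (n0 ` S))"
  have n1: "n0 p \<le> n1" if "p \<in> S" for p unfolding n1_def using fin that by (intro Max_ge) auto
  have "i n N = i n1 N" if n: "n \<ge> n1" for n N
  proof (rule multiplicity_eq_nat)
    fix p :: nat assume p: "prime p"
    show "multiplicity p (i n N) = multiplicity p (i n1 N)"
    proof (cases "p \<in> S")
      case True
      then show ?thesis using n0[OF p, of n N] n0[OF p, of n1 N] n1[OF True] n by simp
    next
      case False
      then show ?thesis using S[OF p] by (metis not_dvd_imp_multiplicity_0)
    qed
  qed (use pos in auto)
  then show ?thesis by blast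
qed

lemma split_prime_factors:
  fixes m :: nat
  assumes "m > 0"
  shows "\<exists>s t. m = s * t \<and> (\<forall>p. prime p \<longrightarrow> p dvd s \<longrightarrow> p \<in> S) \<and> (\<forall>p. prime p \<longrightarrow> p dvd t \<longrightarrow> p \<notin> S)"
  using assms
proof (induction m rule: less_induct)
  case (less m)
  show ?case
  proof (cases "m = 1")
    case True
    then show ?thesis by (intro exI[of _ 1]) auto
  next
    case False
    then obtain p where p: "prime p" "p dvd m" using prime_factor_nat by blast
    then obtain k where k: "m = p * k" by blast
    have "k < m" "k > 0" using less.prems k prime_gt_1_nat[OF p(1)] by auto
    then obtain s t where st: "k = s * t" "\<forall>p. prime p \<longrightarrow> p dvd s \<longrightarrow> p \<in> S" "\<forall>p. prime p \<longrightarrow> p dvd t \<longrightarrow> p \<notin> S"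
      using less.IH by metis
    have q: "q dvd p * x \<longleftrightarrow> q = p \<or> q dvd x" if "prime q" for q x
      using that p by (metis primes_dvd_imp_eq prime_dvd_mult_iff dvd_refl)
    show ?thesis
    proof (cases "p \<in> S")
      case True
      then show ?thesis using st k q by (intro exI[of _ "p * s"] exI[of _ t]) (auto simp: mult.assoc)
    next
      case False
      then show ?thesis using st k q by (intro exI[of _ s] exI[of _ "p * t"]) (auto simp: mult.left_commute)
    qed
  qed
qed

text \<open>The exponents in question form a subgroup of the integers, nonzero because of
  \<open>e\<close>, and \<open>i\<close> is its positive generator.\<close>

lemma (in group) power_index:
  assumes H: "subgroup H G" and a: "a \<in> carrier G" and e: "0 < e" "a [^] (e::nat) \<in> H"
  obtains i :: nat where "0 < i" "\<And>k::int. a [^] k \<in> H \<longleftrightarrow> int i dvd k"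
proof -
  define i where "i = (LEAST i. 0 < i \<and> a [^] (i::nat) \<in> H)"
  have i: "0 < i" "a [^] i \<in> H" using LeastI[of "\<lambda>i. 0 < i \<and> a [^] i \<in> H" e] e unfolding i_def by auto
  have least: "\<not> (j < i \<and> 0 < j \<and> a [^] j \<in> H)" for j :: nat using not_less_Least i_def by blast
  have mult: "a [^] (int i * l) \<in> H" for l
  proof -
    have "a [^] (int i * l) = (a [^] i) [^] l" using a by (simp add: int_pow_pow int_pow_int[symmetric])
    then show ?thesis using subgroup_int_pow_closed[OF H i(2)] by simp
  qed
  have "a [^] k \<in> H \<longleftrightarrow> int i dvd k" for k :: int
  proof
    assume k: "a [^] k \<in> H"
    define j where "j = nat (k mod int i)"
    have j: "int j = k mod int i" "j < i" unfolding j_def using i by (auto simp: nat_less_iff)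
    have "a [^] (k mod int i) = a [^] k \<otimes> inv (a [^] (int i * (k div int i)))"
      using a by (simp add: int_pow_diff[symmetric] minus_mult_div_eq_mod)
    then have "a [^] j \<in> H"
      using k mult H j by (metis int_pow_int subgroup.m_closed subgroup.m_inv_closed)
    then have "j = 0" using least[of j] j by simp
    then show "int i dvd k" using j by (simp add: dvd_eq_mod_eq_0)
  next
    assume "int i dvd k"
    then show "a [^] k \<in> H" using mult by (auto elim: dvdE)
  qed
  then show ?thesis using that i by blast
qed

text \<open>A profinite group, presented by a sequence of finite quotients.\<close>

locale finite_quotients = group G for G :: "('a, 'b) monoid_scheme" (structure) +
  fixes P :: "nat \<Rightarrow> ('c, 'd) monoid_scheme" and \<pi> :: "nat \<Rightarrow> 'a \<Rightarrow> 'c"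
  assumes quotient_hom: "group_hom G (P n) (\<pi> n)"
    and quotient_surj: "\<pi> n ` carrier G = carrier (P n)"
    and quotient_finite: "finite (carrier (P n))"
    and quotient_refine: "\<lbrakk>x \<in> carrier G; y \<in> carrier G; \<pi> (Suc n) x = \<pi> (Suc n) y\<rbrakk> \<Longrightarrow> \<pi> n x = \<pi> n y"
    and separated: "\<lbrakk>x \<in> carrier G; y \<in> carrier G; \<And>n. \<pi> n x = \<pi> n y\<rbrakk> \<Longrightarrow> x = y"
    and complete: "\<lbrakk>\<And>n. f n \<in> carrier G; \<And>n. \<pi> n (f (Suc n)) = \<pi> n (f n)\<rbrakk>
      \<Longrightarrow> \<exists>x\<in>carrier G. \<forall>n. \<pi> n x = \<pi> n (f n)"
begin

sublocale Q: group_hom G "P n" "\<pi> n" for n by (rule quotient_hom)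

lemma quotient_refine_le:
  assumes "m \<le> n" "x \<in> carrier G" "y \<in> carrier G" "\<pi> n x = \<pi> n y"
  shows "\<pi> m x = \<pi> m y"
  using assms(1,4) by (induction n rule: dec_induct) (auto intro: quotient_refine assms(2,3))

lemma quotient_pow_order: "x \<in> carrier G \<Longrightarrow> \<pi> n (x [^] order (P n)) = \<pi> n \<one>"
  by (simp add: Q.hom_nat_pow Q.H.pow_order_eq_1)

lemma order_quotient_pos: "0 < order (P n)"
  using quotient_finite Q.H.order_gt_0_iff_finite by blast

text \<open>One of the finitely many classes at level \<open>n\<close> contains witnesses for
  infinitely many \<open>M\<close>, hence for all \<open>M\<close>, as the conditions
  decrease.\<close>

lemma pigeonhole_quotient:
  fixes D :: "nat \<Rightarrow> 'a \<Rightarrow> bool"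
  assumes D: "\<And>M. \<exists>x\<in>carrier G. D M x" and dec: "\<And>M M' x. M \<le> M' \<Longrightarrow> x \<in> carrier G \<Longrightarrow> D M' x \<Longrightarrow> D M x"
  shows "\<exists>y\<in>carrier G. \<forall>M. \<exists>x\<in>carrier G. D M x \<and> \<pi> n x = \<pi> n y"
proof -
  obtain c where c: "\<And>M. c M \<in> carrier G" "\<And>M. D M (c M)" using D by metis
  have "finite (range (\<lambda>M. \<pi> n (c M)))"
    using c by (intro finite_subset[OF _ quotient_finite[of n]]) auto
  then obtain M0 where inf: "infinite {M. \<pi> n (c M) = \<pi> n (c M0)}"
    using pigeonhole_infinite[of "UNIV :: nat set" "\<lambda>M. \<pi> n (c M)"] by auto
  show ?thesis
  proof (rule bexI[of _ "c M0"], rule allI)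
    fix M
    obtain M' where "M' \<ge> M" "\<pi> n (c M') = \<pi> n (c M0)"
      using inf unfolding infinite_nat_iff_unbounded_le by blast
    then show "\<exists>x\<in>carrier G. D M x \<and> \<pi> n x = \<pi> n (c M0)" using c dec by blast
  qed (rule c)
qed

text \<open>Konig's lemma. \<open>?good n y\<close> says that the class of \<open>y\<close> at level
  \<open>n\<close> meets every condition; such a class contains a good class of the next level, and
  \<open>complete\<close> gives an element common to the chosen classes. As \<open>C n\<close>
  depends only on the image at level \<open>n\<close>, that element satisfies it.\<close>

lemma compactness:
  assumes nonempty: "\<And>n. \<exists>x\<in>carrier G. C n x"
    and dec: "\<And>m n x. m \<le> n \<Longrightarrow> x \<in> carrier G \<Longrightarrow> C n x \<Longrightarrow> C m x"
    and sat: "\<And>n x y. \<lbrakk>x \<in> carrier G; y \<in> carrier G; \<pi> n x = \<pi> n y; C n x\<rbrakk> \<Longrightarrow> C n y"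
  obtains x where "x \<in> carrier G" "\<And>n. C n x"
proof -
  let ?good = "\<lambda>n y. y \<in> carrier G \<and> (\<forall>M. \<exists>x\<in>carrier G. C M x \<and> \<pi> n x = \<pi> n y)"
  have "\<exists>f. \<forall>n. ?good n (f n) \<and> \<pi> n (f (Suc n)) = \<pi> n (f n)"
  proof (rule dependent_nat_choice)
    have "\<exists>y\<in>carrier G. \<forall>M. \<exists>x\<in>carrier G. C M x \<and> \<pi> 0 x = \<pi> 0 y"
      by (rule pigeonhole_quotient) (use nonempty dec in blast)+
    then show "\<exists>y. ?good 0 y" by blast
  next
    fix y n assume y: "?good n y"
    have "\<exists>w\<in>carrier G. \<forall>M. \<exists>x\<in>carrier G. (C M x \<and> \<pi> n x = \<pi> n y) \<and> \<pi> (Suc n) x = \<pi> (Suc n) w"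
      by (rule pigeonhole_quotient) (use y dec in blast)+
    then obtain w where w: "w \<in> carrier G"
      "\<forall>M. \<exists>x\<in>carrier G. (C M x \<and> \<pi> n x = \<pi> n y) \<and> \<pi> (Suc n) x = \<pi> (Suc n) w"
      by blast
    have "\<pi> n w = \<pi> n y" using w quotient_refine by metis
    then show "\<exists>w. ?good (Suc n) w \<and> \<pi> n w = \<pi> n y" using w by blast
  qed
  then obtain f where f: "\<And>n. ?good n (f n)" "\<And>n. \<pi> n (f (Suc n)) = \<pi> n (f n)" by blast
  obtain x where x: "x \<in> carrier G" "\<And>n. \<pi> n x = \<pi> n (f n)" using complete[of f] f by blast
  have "C n x" for n using f(1)[of n] x sat by metis
  then show ?thesis using that x by blast
qed

text \<open>Closure in the profinite topology, whose basic open sets are the fibres of the maps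
  \<open>\<pi> n\<close>. Closedness of \<open>A\<close> is expressed as
  \<open>closure_set A \<subseteq> A\<close>.\<close>

definition closure_set :: "'a set \<Rightarrow> 'a set" where
  "closure_set A = {x \<in> carrier G. \<forall>n. \<exists>a\<in>A. \<pi> n x = \<pi> n a}"

lemma subset_closure_set: "A \<subseteq> carrier G \<Longrightarrow> A \<subseteq> closure_set A"
  unfolding closure_set_def by blast

lemma closure_set_idem:
  "closure_set (closure_set A) \<subseteq> closure_set A"
  unfolding closure_set_def by (auto, metis)

lemma subgroup_closure_set:
  assumes "subgroup A G"
  shows "subgroup (closure_set A) G"
proof (rule subgroupI)
  note A = subgroup.mem_carrier[OF assms]
  show "closure_set A \<noteq> {}" using subgroup.one_closed[OF assms] unfolding closure_set_def by blast
  fix x assume x: "x \<in> closure_set A"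
  show "inv x \<in> closure_set A" unfolding closure_set_def
  proof safe
    fix n
    obtain a where "a \<in> A" "\<pi> n x = \<pi> n a" using x unfolding closure_set_def by blast
    then show "\<exists>b\<in>A. \<pi> n (inv x) = \<pi> n b" using x A subgroup.m_inv_closed[OF assms]
      unfolding closure_set_def by (intro bexI[of _ "inv a"]) auto
  qed (use x in \<open>auto simp: closure_set_def\<close>)
  fix y assume y: "y \<in> closure_set A"
  show "x \<otimes> y \<in> closure_set A" unfolding closure_set_def
  proof safe
    fix n
    obtain a where a: "a \<in> A" "\<pi> n x = \<pi> n a" using x unfolding closure_set_def by blast
    obtain b where b: "b \<in> A" "\<pi> n y = \<pi> n b" using y unfolding closure_set_def by blast
    show "\<exists>c\<in>A. \<pi> n (x \<otimes> y) = \<pi> n c" using x y a b A subgroup.m_closed[OF assms]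
      unfolding closure_set_def by (intro bexI[of _ "a \<otimes> b"]) auto
  qed (use x y in \<open>auto simp: closure_set_def\<close>)
qed (auto simp: closure_set_def)

text \<open>The component of \<open>a\<close> at the primes outside \<open>S\<close> is a limit of powers of \<open>a\<close>. The hypothesis
  on the orders makes it central.\<close>

lemma central_component:
  assumes nilpotent: "\<And>n N. N \<lhd> P n \<Longrightarrow> N \<noteq> carrier (P n) \<Longrightarrow>
      \<exists>z\<in>carrier (P n) - N. \<forall>y\<in>carrier (P n).
        z \<otimes>\<^bsub>P n\<^esub> y \<otimes>\<^bsub>P n\<^esub> inv\<^bsub>P n\<^esub> z \<otimes>\<^bsub>P n\<^esub> inv\<^bsub>P n\<^esub> y \<in> N"
    and small: "\<And>n p. prime p \<Longrightarrow> p \<notin> S \<Longrightarrow> \<not> p ^ 3 dvd order (P n)"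
    and a: "a \<in> carrier G"
  obtains z where "z \<in> carrier G" "\<And>x. x \<in> carrier G \<Longrightarrow> z \<otimes> x = x \<otimes> z"
    "\<And>n. \<exists>u::nat. \<pi> n z = \<pi> n (a [^] u)"
    "\<And>n. \<exists>s::nat. s > 0 \<and> (\<forall>p. prime p \<longrightarrow> p dvd s \<longrightarrow> p \<in> S) \<and> \<pi> n (a [^] s) = \<pi> n (z [^] s)"
proof -
  define m where "m n = Q.H.ord n (\<pi> n a)" for n
  have m_pos: "m n > 0" for n
    unfolding m_def using Q.H.ord_ge_1[OF quotient_finite] a by (simp add: Suc_le_lessD)
  \<comment> \<open>The order of \<open>a\<close> at level \<open>n\<close> is split into its part
    \<open>s n\<close> at the primes in \<open>S\<close> and its part \<open>t n\<close> at the
    others.\<close>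
  obtain s t where st: "\<And>n. m n = s n * t n" "\<And>n p. prime p \<Longrightarrow> p dvd s n \<Longrightarrow> p \<in> S"
    "\<And>n p. prime p \<Longrightarrow> p dvd t n \<Longrightarrow> p \<notin> S"
    using split_prime_factors[OF m_pos, where S = S] by metis
  have pos: "s n > 0" "t n > 0" for n using m_pos[of n] unfolding st(1) by auto
  have coprime: "coprime (s n) (t k)" for n k
  proof (rule ccontr)
    assume "\<not> coprime (s n) (t k)"
    then obtain p where "prime p" "p dvd gcd (s n) (t k)" using prime_factor_nat by (metis coprime_iff_gcd_eq_1)
    then show False using st(2)[of p n] st(3)[of p k] by simp
  qed
  have mdvd: "m n dvd m n'" if "n \<le> n'" for n n'
  proof -
    have "\<pi> n' (a [^] m n') = \<pi> n' \<one>" unfolding m_def using a by (simp add: Q.hom_nat_pow)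
    then have "\<pi> n (a [^] m n') = \<pi> n \<one>" using a by (intro quotient_refine_le[OF that]) auto
    then show ?thesis unfolding m_def[of n] using a by (simp add: Q.hom_nat_pow Q.H.pow_eq_id)
  qed
  have sdvd: "s n dvd s n'" and tdvd: "t n dvd t n'" if "n \<le> n'" for n n'
  proof -
    have "s n dvd s n' * t n'" "t n dvd s n' * t n'" using mdvd[OF that] unfolding st(1) by (auto intro: dvd_mult_left dvd_mult_right)
    then show "s n dvd s n'" "t n dvd t n'"
      using coprime[of n n'] coprime[of n' n]
      by (auto simp: coprime_dvd_mult_left_iff coprime_dvd_mult_right_iff coprime_commute)
  qed
  \<comment> \<open>For such an exponent, \<open>a [^] u\<close> is trivial at the primes in
    \<open>S\<close> and agrees with \<open>a\<close> at the others; the Chinese remainder theorem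
    provides it. The congruences at one level imply those at lower levels, so compactness yields a
    limit.\<close>
  let ?C = "\<lambda>n x. \<exists>u::nat. s n dvd u \<and> [u = 1] (mod t n) \<and> \<pi> n x = \<pi> n (a [^] u)"
  obtain z where z: "z \<in> carrier G" "\<And>n. ?C n z"
  proof (rule compactness[of ?C])
    fix n
    obtain u where "[u = 0] (mod s n)" "[u = 1] (mod t n)"
      using binary_chinese_remainder_nat[OF coprime] by blast
    then show "\<exists>x\<in>carrier G. ?C n x" using a
      by (intro bexI[of _ "a [^] u"] exI[of _ u]) (auto simp: cong_0_iff)
  next
    fix k n x assume kn: "k \<le> n" and x: "x \<in> carrier G" and C: "?C n x"
    then obtain u where u: "s n dvd u" "[u = 1] (mod t n)" "\<pi> n x = \<pi> n (a [^] u)" by blast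
    then show "?C k x" using sdvd[OF kn] tdvd[OF kn] quotient_refine_le[OF kn x _ u(3)] a
      by (intro exI[of _ u]) (auto intro: dvd_trans cong_dvd_modulus_nat)
  next
    fix n x y assume "\<pi> n x = \<pi> n y" "?C n x"
    then show "?C n y" by simp
  qed blast
  have central: "z \<otimes> x = x \<otimes> z" if x: "x \<in> carrier G" for x
  proof (rule separated)
    fix n
    obtain u where u: "s n dvd u" "\<pi> n z = \<pi> n (a [^] u)" using z by blast
    \<comment> \<open>Hence the order of \<open>z\<close> at level \<open>n\<close> divides
      \<open>t n\<close>, whose primes lie outside \<open>S\<close>.\<close>
    have "m n dvd u * t n" unfolding st(1) using u(1) by (rule mult_dvd_mono) simp
    then have "\<pi> n z [^]\<^bsub>P n\<^esub> t n = \<one>\<^bsub>P n\<^esub>"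
      unfolding u(2) m_def using a by (simp add: Q.hom_nat_pow Q.H.nat_pow_pow Q.H.pow_eq_id)
    then have "\<pi> n z \<otimes>\<^bsub>P n\<^esub> \<pi> n x = \<pi> n x \<otimes>\<^bsub>P n\<^esub> \<pi> n z"
      using z x st(3) small
      by (intro Q.H.central_if_prime_powers_small[OF quotient_finite nilpotent]) auto
    then show "\<pi> n (z \<otimes> x) = \<pi> n (x \<otimes> z)" using z x by simp
  qed (use x z in auto)
  have "\<pi> n (a [^] s n) = \<pi> n (z [^] s n)" for n
  proof -
    obtain u where u: "[u = 1] (mod t n)" "\<pi> n z = \<pi> n (a [^] u)" using z by blast
    \<comment> \<open>\<open>t n\<close> divides \<open>1 - u\<close>, and \<open>s n\<close>
      supplies the missing factor of \<open>m n\<close>; so the power \<open>s n\<close> removes the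
      difference between \<open>a\<close> and \<open>z\<close>.\<close>
    have "int (t n) dvd 1 - int u" using u(1) by (metis cong_iff_dvd_diff cong_int_iff cong_sym of_nat_1)
    then have "int (m n) dvd int (s n) * (1 - int u)" unfolding st(1) of_nat_mult by (intro mult_dvd_mono) auto
    then have "int (m n) dvd int (s n) - int (u * s n)" by (simp add: algebra_simps)
    then have "\<pi> n a [^]\<^bsub>P n\<^esub> int (u * s n) = \<pi> n a [^]\<^bsub>P n\<^esub> int (s n)"
      unfolding m_def using Q.H.int_pow_eq[OF Q.hom_closed[OF a], of n "int (u * s n)" "int (s n)"] by blast
    then have "\<pi> n a [^]\<^bsub>P n\<^esub> (u * s n) = \<pi> n a [^]\<^bsub>P n\<^esub> s n"
      by (simp only: int_pow_int)
    then show ?thesis using a z(1) u(2) by (simp add: Q.hom_nat_pow Q.H.nat_pow_pow)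
  qed
  then show ?thesis using that[OF z(1) central] z(2) st(2) pos(1) by blast
qed

end


section \<open>Chains of closed subgroups\<close>

context finite_quotients
begin

text \<open>For a subgroup this is its product with the kernel at level \<open>n\<close>, an open
  subgroup; the intersection over all \<open>n\<close> is the closure.\<close>

definition thicken :: "nat \<Rightarrow> 'a set \<Rightarrow> 'a set" where
  "thicken n A = {x \<in> carrier G. \<exists>a\<in>A. \<pi> n x = \<pi> n a}"

lemma thickenI: "x \<in> carrier G \<Longrightarrow> a \<in> A \<Longrightarrow> \<pi> n x = \<pi> n a \<Longrightarrow> x \<in> thicken n A"
  unfolding thicken_def by blast

lemma subgroup_thicken:
  assumes "subgroup A G"
  shows "subgroup (thicken n A) G"
proof (rule subgroupI)
  note A = subgroup.mem_carrier[OF assms]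
  show "thicken n A \<noteq> {}" using subgroup.one_closed[OF assms] unfolding thicken_def by blast
  fix x assume "x \<in> thicken n A"
  then obtain a where x: "x \<in> carrier G" "a \<in> A" "\<pi> n x = \<pi> n a" unfolding thicken_def by blast
  then show "inv x \<in> thicken n A"
    using A subgroup.m_inv_closed[OF assms] by (intro thickenI[of _ "inv a"]) auto
  fix y assume "y \<in> thicken n A"
  then obtain b where y: "y \<in> carrier G" "b \<in> A" "\<pi> n y = \<pi> n b" unfolding thicken_def by blast
  then show "x \<otimes> y \<in> thicken n A"
    using x A subgroup.m_closed[OF assms] by (intro thickenI[of _ "a \<otimes> b"]) auto
qed (auto simp: thicken_def)

lemma power_in_thicken:
  assumes "subgroup A G" "a \<in> carrier G"
  shows "a [^] order (P n) \<in> thicken n A"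
  using assms subgroup.one_closed[OF assms(1)] quotient_pow_order[OF assms(2)]
  by (intro thickenI[of _ \<one>]) auto

text \<open>At level \<open>N\<close> the powers of \<open>a\<close> in \<open>(Q n \<inter> M) M'\<close> are those with exponent divisible by \<open>i n N\<close>.
  As \<open>i n N = gcd (i n N') (e N)\<close> for \<open>N \<le> N'\<close>, the \<open>i n N\<close> are truncations of a supernatural number,
  which decreases with \<open>n\<close> and involves only the primes in \<open>S\<close>.\<close>

lemma stationary_step:
  fixes Q :: "nat \<Rightarrow> 'a set"
  assumes M': "M' \<lhd> G" "closure_set M' \<subseteq> M'" and M: "subgroup M G" "M' \<subseteq> M" and a: "a \<in> M"
    and gen: "\<And>x n. x \<in> M \<Longrightarrow> \<exists>k::int. \<exists>y\<in>M'. \<pi> n x = \<pi> n (a [^] k \<otimes> y)"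
    and Q: "\<And>n. subgroup (Q n) G" "\<And>n. closure_set (Q n) \<subseteq> Q n"
    and Qmono: "\<And>m n. m \<le> n \<Longrightarrow> Q m \<subseteq> Q n"
    and fin: "finite S"
    and tors: "\<And>n. \<exists>s::nat. s > 0 \<and> (\<forall>p. prime p \<longrightarrow> p dvd s \<longrightarrow> p \<in> S) \<and>
        (\<exists>z\<in>Q 0 \<inter> M. \<pi> n (a [^] s) = \<pi> n z)"
    and stat: "\<exists>n0. \<forall>n\<ge>n0. Q n \<inter> M' = Q n0 \<inter> M'"
  shows "\<exists>n0. \<forall>n\<ge>n0. Q n \<inter> M = Q n0 \<inter> M"
proof -
  interpret M': normal M' G by (rule M')
  have aG: "a \<in> carrier G" using M(1) a by (rule subgroup.mem_carrier)
  \<comment> \<open>\<open>B n\<close> lies between \<open>M'\<close> and \<open>M\<close>. Modulo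
    \<open>M'\<close> it is the part of a procyclic group covered by \<open>Q n\<close>, and
    \<open>i n N\<close> below measures its index at level \<open>N\<close>.\<close>
  define B where "B n = M' <#> (Q n \<inter> M)" for n
  have QM: "subgroup (Q n \<inter> M) G" for n using Q(1) M(1) by (rule subgroups_Inter_pair)
  have QMG: "x \<in> carrier G" if "x \<in> Q n \<inter> M" for x n using QM that by (rule subgroup.mem_carrier)
  have B: "subgroup (B n) G" for n unfolding B_def using M'(1) QM by (rule mult_norm_subgroup)
  have in_B: "x \<in> B n \<longleftrightarrow> (\<exists>m\<in>M'. \<exists>q\<in>Q n \<inter> M. x = m \<otimes> q)" for x n
    unfolding B_def set_mult_def by blast
  have thickB: "\<exists>m\<in>M'. \<exists>q\<in>Q n \<inter> M. \<pi> N x = \<pi> N (m \<otimes> q)" if x: "x \<in> thicken N (B n)" for x n N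
  proof -
    obtain b where b: "b \<in> B n" "\<pi> N x = \<pi> N b" using x unfolding thicken_def by blast
    obtain m q where "m \<in> M'" "q \<in> Q n \<inter> M" "b = m \<otimes> q" using in_B[THEN iffD1, OF b(1)] by blast
    then show ?thesis using b(2) by blast
  qed
  have M'B: "M' \<subseteq> B n" for n
  proof
    fix m assume "m \<in> M'"
    then have "m = m \<otimes> \<one>" by simp
    then show "m \<in> B n" unfolding in_B using \<open>m \<in> M'\<close> subgroup.one_closed[OF QM] by blast
  qed
  have QB: "Q n \<inter> M \<subseteq> B n" for n
  proof
    fix q assume q: "q \<in> Q n \<inter> M"
    then have "q = \<one> \<otimes> q" using QMG[OF q] by simp
    then show "q \<in> B n" unfolding in_B using q M'.one_closed by blast
  qed
  have Bmono: "B m \<subseteq> B n" if "m \<le> n" for m n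
    using Qmono[OF that] unfolding B_def set_mult_def by blast
  define index where "index A = (SOME i::nat. 0 < i \<and> (\<forall>k::int. a [^] k \<in> A \<longleftrightarrow> int i dvd k))" for A
  have index: "0 < index (thicken N A)" "a [^] k \<in> thicken N A \<longleftrightarrow> int (index (thicken N A)) dvd k"
    if A: "subgroup A G" for A N and k :: int
  proof -
    obtain i :: nat where "0 < i" "\<And>k::int. a [^] k \<in> thicken N A \<longleftrightarrow> int i dvd k"
      by (rule power_index[OF subgroup_thicken[OF A, of N] aG order_quotient_pos power_in_thicken[OF A aG]]) blast
    then have "\<exists>i::nat. 0 < i \<and> (\<forall>k::int. a [^] k \<in> thicken N A \<longleftrightarrow> int i dvd k)" by blast
    from someI_ex[OF this]
    show "0 < index (thicken N A)" "a [^] k \<in> thicken N A \<longleftrightarrow> int (index (thicken N A)) dvd k"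
      unfolding index_def by blast+
  qed
  define i where "i n N = index (thicken N (B n))" for n N
  define e where "e N = index (thicken N M')" for N
  have i: "0 < i n N" "a [^] k \<in> thicken N (B n) \<longleftrightarrow> int (i n N) dvd k" for n N and k :: int
    unfolding i_def using index[OF B] by blast+
  have e: "0 < e N" "a [^] k \<in> thicken N M' \<longleftrightarrow> int (e N) dvd k" for N and k :: int
    unfolding e_def using index[OF M'.is_subgroup] by blast+
  have "\<exists>n0. \<forall>n\<ge>n0. \<forall>N. i n N = i n0 N"
  proof (rule stationary_of_gcd[OF fin i(1) e(1)])
    show "i n N dvd i m N" if "m \<le> n" for m n N
    proof -
      have "a [^] int (i m N) \<in> thicken N (B m)" unfolding i(2) by simp
      then have "a [^] int (i m N) \<in> thicken N (B n)" using Bmono[OF that] unfolding thicken_def by blast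
      then show ?thesis unfolding i(2) by simp
    qed
    show "i n N = gcd (i n N') (e N)" if N: "N \<le> N'" for n N N'
    proof (rule dvd_antisym)
      have "a [^] int (e N) \<in> thicken N M'" unfolding e(2) by simp
      then have "a [^] int (e N) \<in> thicken N (B n)" using M'B unfolding thicken_def by blast
      then have 1: "i n N dvd e N" unfolding i(2) by simp
      have "a [^] int (i n N') \<in> thicken N' (B n)" unfolding i(2) by simp
      then have "a [^] int (i n N') \<in> thicken N (B n)"
        using quotient_refine_le[OF N] subgroup.mem_carrier[OF B] unfolding thicken_def by blast
      then have "i n N dvd i n N'" unfolding i(2) by simp
      then show "i n N dvd gcd (i n N') (e N)" using 1 by simp
      \<comment> \<open>Conversely, the element \<open>q\<close> that matches this power of
        \<open>a\<close> up to \<open>M'\<close> at level \<open>N\<close> is expressed through a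
        power \<open>a [^] l\<close> at the finer level \<open>N'\<close>. Then
        \<open>i n N'\<close> divides \<open>l\<close> and \<open>e N\<close> divides
        \<open>i n N - l\<close>, so the gcd divides \<open>i n N\<close>.\<close>
      have "a [^] int (i n N) \<in> thicken N (B n)" unfolding i(2) by simp
      from thickB[OF this]
      obtain m q where mq: "m \<in> M'" "q \<in> Q n \<inter> M" "\<pi> N (a [^] int (i n N)) = \<pi> N (m \<otimes> q)"
        by blast
      obtain l :: int and y where ly: "y \<in> M'" "\<pi> N' q = \<pi> N' (a [^] l \<otimes> y)" using gen mq(2) by blast
      note car = QMG[OF mq(2)] M'.mem_carrier[OF mq(1)] M'.mem_carrier[OF ly(1)]
      have "(q \<otimes> inv y \<otimes> inv q) \<otimes> q \<in> B n"
        unfolding in_B using mq(2) ly(1) car by (metis M'.inv_op_closed2 M'.m_inv_closed)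
      moreover have "(q \<otimes> inv y \<otimes> inv q) \<otimes> q = q \<otimes> inv y" using car by (simp add: m_assoc)
      moreover have "\<pi> N' (a [^] l) = \<pi> N' (q \<otimes> inv y)"
        using ly(2) car aG by (simp add: Q.H.m_assoc)
      ultimately have "a [^] l \<in> thicken N' (B n)" using aG by (metis thickenI int_pow_closed)
      then have l: "int (i n N') dvd l" unfolding i(2) .
      have "\<pi> N q = \<pi> N (a [^] l \<otimes> y)" using quotient_refine_le[OF N _ _ ly(2)] car aG by simp
      then have "\<pi> N (a [^] int (i n N)) = \<pi> N (m \<otimes> (a [^] l \<otimes> y))" using mq(3) car aG by simp
      then have "\<pi> N (a [^] int (i n N) \<otimes> inv (a [^] l)) = \<pi> N (m \<otimes> (a [^] l \<otimes> y) \<otimes> inv (a [^] l))"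
        using car aG by (simp del: Q.hom_mult Q.hom_inv add: Q.hom_mult[of "a [^] int (i n N)"] Q.hom_mult[of "m \<otimes> (a [^] l \<otimes> y)"])
      moreover have "m \<otimes> (a [^] l \<otimes> y) \<otimes> inv (a [^] l) = m \<otimes> (a [^] l \<otimes> y \<otimes> inv (a [^] l))"
        using car aG by (simp add: m_assoc)
      moreover have "m \<otimes> (a [^] l \<otimes> y \<otimes> inv (a [^] l)) \<in> M'"
        using mq(1) ly(1) aG by (intro M'.m_closed M'.inv_op_closed2) auto
      moreover have "a [^] int (i n N) \<otimes> inv (a [^] l) = a [^] (int (i n N) - l)"
        using aG by (simp add: int_pow_diff)
      ultimately have "a [^] (int (i n N) - l) \<in> thicken N M'" using aG by (metis thickenI int_pow_closed)
      then have "int (e N) dvd int (i n N) - l" unfolding e(2) .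
      then have "int (gcd (i n N') (e N)) dvd int (i n N) - l"
        by (meson dvd_trans gcd_dvd2 int_dvd_int_iff)
      moreover have "int (gcd (i n N') (e N)) dvd l" using l by (meson dvd_trans gcd_dvd1 int_dvd_int_iff)
      ultimately have "int (gcd (i n N') (e N)) dvd (int (i n N) - l) + l" by (rule dvd_add)
      then show "gcd (i n N') (e N) dvd i n N" by simp
    qed
    show "p \<in> S" if p: "prime p" "p dvd i n N" for p n N
    proof -
      \<comment> \<open>By \<open>tors\<close> a power of \<open>a\<close> whose exponent involves
        only primes in \<open>S\<close> agrees at level \<open>N\<close> with an element of
        \<open>Q 0 \<inter> M\<close>, which lies in every \<open>B n\<close>.\<close>
      obtain s z where s: "\<And>p. prime p \<Longrightarrow> p dvd s \<Longrightarrow> p \<in> S" "z \<in> Q 0 \<inter> M" "\<pi> N (a [^] (s::nat)) = \<pi> N z"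
        using tors[of N] by blast
      have "z \<in> B n" using s(2) Qmono[of 0 n] QB by blast
      then have "a [^] int s \<in> thicken N (B n)" using s(3) aG by (simp add: int_pow_int thickenI)
      then have "i n N dvd s" unfolding i(2) by simp
      then show ?thesis using p s(1) dvd_trans by blast
    qed
  qed
  then obtain n1 where n1: "\<And>n N. n \<ge> n1 \<Longrightarrow> i n N = i n1 N" by blast
  obtain n2 where n2: "\<And>n. n \<ge> n2 \<Longrightarrow> Q n \<inter> M' = Q n2 \<inter> M'" using stat by blast
  define n0 where "n0 = max n1 n2"
  have "Q n \<inter> M \<subseteq> Q n0" if n: "n \<ge> n0" for n
  proof
    fix q assume q: "q \<in> Q n \<inter> M"
    note qG = QMG[OF q]
    \<comment> \<open>The aim is to write \<open>q\<close> as an element \<open>x\<close> of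
      \<open>Q n0\<close> times an element of \<open>M'\<close>. Equality of the numbers
      \<open>i n N\<close> achieves this at every level, and compactness in the limit. The second
      factor lies in \<open>Q n \<inter> M'\<close>, which is stationary.\<close>
    let ?C = "\<lambda>N x. (\<exists>u\<in>Q n0. \<pi> N x = \<pi> N u) \<and> (\<exists>m\<in>M'. \<pi> N (inv x \<otimes> q) = \<pi> N m)"
    obtain x where x: "x \<in> carrier G" "\<And>N. ?C N x"
    proof (rule compactness[of ?C])
      fix N
      obtain k :: int and y where ky: "y \<in> M'" "\<pi> N q = \<pi> N (a [^] k \<otimes> y)" using gen q by blast
      have y: "y \<in> carrier G" using ky by simp
      have "(q \<otimes> inv y \<otimes> inv q) \<otimes> q \<in> B n"
        unfolding in_B using q ky(1) qG by (metis M'.inv_op_closed2 M'.m_inv_closed)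
      moreover have "(q \<otimes> inv y \<otimes> inv q) \<otimes> q = q \<otimes> inv y" using qG y by (simp add: m_assoc)
      moreover have "\<pi> N (a [^] k) = \<pi> N (q \<otimes> inv y)"
        using ky(2) qG y aG by (simp add: Q.H.m_assoc)
      ultimately have "a [^] k \<in> thicken N (B n)" using aG by (metis thickenI int_pow_closed)
      then have "a [^] k \<in> thicken N (B n0)"
        unfolding i(2) using n1[of n N] n1[of n0 N] n unfolding n0_def by simp
      from thickB[OF this]
      obtain m u where mu: "m \<in> M'" "u \<in> Q n0 \<inter> M" "\<pi> N (a [^] k) = \<pi> N (m \<otimes> u)"
        by blast
      note uG = QMG[OF mu(2)] M'.mem_carrier[OF mu(1)]
      have "\<pi> N q = \<pi> N (a [^] k) \<otimes>\<^bsub>P N\<^esub> \<pi> N y" using ky(2) aG y by simp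
      then have "\<pi> N q = \<pi> N (m \<otimes> u) \<otimes>\<^bsub>P N\<^esub> \<pi> N y" unfolding mu(3) .
      then have "\<pi> N (inv u \<otimes> q) = \<pi> N (inv u \<otimes> m \<otimes> u \<otimes> y)"
        using uG qG y by (simp add: Q.H.m_assoc)
      moreover have "inv u \<otimes> m \<otimes> u \<otimes> y \<in> M'"
        using mu(1) ky(1) uG by (intro M'.m_closed M'.inv_op_closed1) auto
      ultimately show "\<exists>x\<in>carrier G. ?C N x" using mu(2) uG by blast
    next
      fix N N' x assume "N \<le> N'" "x \<in> carrier G" "?C N' x"
      then show "?C N x"
        using quotient_refine_le[of N N'] qG subgroup.mem_carrier[OF Q(1)[of n0]] M'.mem_carrier
        by (meson m_closed inv_closed)
    next
      fix N x y assume "x \<in> carrier G" "y \<in> carrier G" "\<pi> N x = \<pi> N y" "?C N x"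
      then show "?C N y" using qG by simp
    qed blast
    have xQ: "x \<in> Q n0" using x Q(2)[of n0] unfolding closure_set_def by blast
    have "inv x \<otimes> q \<in> M'" using x qG M'(2) unfolding closure_set_def by blast
    moreover have "inv x \<otimes> q \<in> Q n"
      using xQ q Qmono[OF n] Q(1)[of n] by (auto intro!: subgroup.m_closed subgroup.m_inv_closed)
    ultimately have "inv x \<otimes> q \<in> Q n0" using n2[of n] n2[of n0] n unfolding n0_def by auto
    then have "x \<otimes> (inv x \<otimes> q) \<in> Q n0" using xQ Q(1) by (simp add: subgroup.m_closed)
    then show "q \<in> Q n0" using x(1) qG by (simp add: m_assoc[symmetric])
  qed
  then have "\<forall>n\<ge>n0. Q n \<inter> M = Q n0 \<inter> M" using Qmono by blast
  then show ?thesis by blast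
qed

end

section \<open>Profinite groups with a dense image of a nilpotent group\<close>

locale finite_quotients_dense_hom = group_hom \<Delta> G \<phi> + finite_quotients G P \<pi>
  for \<Delta> (structure) and G (structure) and \<phi> and P \<pi> +
  assumes dense: "x \<in> carrier G \<Longrightarrow> \<exists>d\<in>carrier \<Delta>. \<pi> n x = \<pi> n (\<phi> d)"
begin

text \<open>By density \<open>\<Delta>\<close> maps onto each finite quotient, so pulling
  \<open>N\<close> back to \<open>\<Delta>\<close> reduces the claim to
  \<open>central_cyclic_series_non_central\<close>.\<close>

lemma nilpotent_quotient:
  assumes "central_cyclic_series \<Delta> (carrier \<Delta>)" "N \<lhd> P n" "N \<noteq> carrier (P n)"
  shows "\<exists>z\<in>carrier (P n) - N. \<forall>y\<in>carrier (P n).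
    z \<otimes>\<^bsub>P n\<^esub> y \<otimes>\<^bsub>P n\<^esub> inv\<^bsub>P n\<^esub> z \<otimes>\<^bsub>P n\<^esub> inv\<^bsub>P n\<^esub> y \<in> N"
proof -
  interpret N: normal N "P n" by fact
  let ?K = "{d \<in> carrier \<Delta>. \<pi> n (\<phi> d) \<in> N}"
  have onto: "\<exists>d\<in>carrier \<Delta>. y = \<pi> n (\<phi> d)" if "y \<in> carrier (P n)" for y
    using that quotient_surj[of n] dense by (metis imageE)
  have 1: "\<not> carrier \<Delta> \<subseteq> ?K" using onto assms(3) N.subset by blast
  have 2: "\<one>\<^bsub>\<Delta>\<^esub> \<in> ?K" using N.one_closed by simp
  obtain d where d: "d \<in> carrier \<Delta> - ?K"
    "\<forall>x\<in>carrier \<Delta>. d \<otimes>\<^bsub>\<Delta>\<^esub> x \<otimes>\<^bsub>\<Delta>\<^esub> inv\<^bsub>\<Delta>\<^esub> d \<otimes>\<^bsub>\<Delta>\<^esub> inv\<^bsub>\<Delta>\<^esub> x \<in> ?K"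
    using G.central_cyclic_series_non_central[OF assms(1) 1 2] by (rule bexE)
  show ?thesis
  proof (intro bexI[of _ "\<pi> n (\<phi> d)"] ballI)
    fix y assume "y \<in> carrier (P n)"
    then obtain x where x: "x \<in> carrier \<Delta>" "y = \<pi> n (\<phi> x)" using onto by blast
    show "\<pi> n (\<phi> d) \<otimes>\<^bsub>P n\<^esub> y \<otimes>\<^bsub>P n\<^esub> inv\<^bsub>P n\<^esub> \<pi> n (\<phi> d) \<otimes>\<^bsub>P n\<^esub> inv\<^bsub>P n\<^esub> y \<in> N"
      using bspec[OF d(2) x(1)] d(1) x by simp
  qed (use d in auto)
qed

text \<open>At each level both elements can be replaced by images from \<open>\<Delta>\<close>,
  whose commutator is in the image of \<open>N'\<close>. So the closures of the images form a
  central series of the profinite group.\<close>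

lemma closure_image_central_step:
  assumes N: "subgroup N \<Delta>" and N': "subgroup N' \<Delta>"
    and comm: "\<And>x y. x \<in> N \<Longrightarrow> y \<in> carrier \<Delta> \<Longrightarrow> x \<otimes>\<^bsub>\<Delta>\<^esub> y \<otimes>\<^bsub>\<Delta>\<^esub> inv\<^bsub>\<Delta>\<^esub> x \<otimes>\<^bsub>\<Delta>\<^esub> inv\<^bsub>\<Delta>\<^esub> y \<in> N'"
    and x: "x \<in> closure_set (\<phi> ` N)" and y: "y \<in> carrier G"
  shows "x \<otimes>\<^bsub>G\<^esub> y \<otimes>\<^bsub>G\<^esub> inv\<^bsub>G\<^esub> x \<otimes>\<^bsub>G\<^esub> inv\<^bsub>G\<^esub> y \<in> closure_set (\<phi> ` N')"
proof -
  have xG: "x \<in> carrier G" using x unfolding closure_set_def by blast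
  have "\<exists>c\<in>\<phi> ` N'. \<pi> n (x \<otimes>\<^bsub>G\<^esub> y \<otimes>\<^bsub>G\<^esub> inv\<^bsub>G\<^esub> x \<otimes>\<^bsub>G\<^esub> inv\<^bsub>G\<^esub> y) = \<pi> n c" for n
  proof -
    obtain d where d: "d \<in> N" "\<pi> n x = \<pi> n (\<phi> d)" using x unfolding closure_set_def by blast
    obtain b where b: "b \<in> carrier \<Delta>" "\<pi> n y = \<pi> n (\<phi> b)" using dense[OF y] by blast
    have dG: "d \<in> carrier \<Delta>" using subgroup.mem_carrier[OF N d(1)] .
    show ?thesis
      by (rule bexI[OF _ imageI[OF comm[OF d(1) b(1)]]]) (use d(2) b dG xG y in simp)
  qed
  then show ?thesis using xG y unfolding closure_set_def by simp
qed

text \<open>Since \<open>F n \<inter> Z\<close> does not depend on \<open>n\<close>, where \<open>Z\<close> is the center, it suffices that the chain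
  \<open>F n Z\<close> is stationary.\<close>

theorem closed_subgroup_chain_stationary:
  fixes F :: "nat \<Rightarrow> 'c set"
  assumes ccs: "central_cyclic_series \<Delta> (carrier \<Delta>)"
    and fin: "finite S"
    and small: "\<And>n p. prime p \<Longrightarrow> p \<notin> S \<Longrightarrow> \<not> p ^ 3 dvd order (P n)"
    and F: "\<And>n. subgroup (F n) G" "\<And>n. closure_set (F n) \<subseteq> F n" "\<And>m n. m \<le> n \<Longrightarrow> F m \<subseteq> F n"
    and central: "\<And>n z. z \<in> F n \<Longrightarrow> (\<And>x. x \<in> carrier G \<Longrightarrow> z \<otimes>\<^bsub>G\<^esub> x = x \<otimes>\<^bsub>G\<^esub> z) \<Longrightarrow> z \<in> F 0"
  shows "\<exists>n0. \<forall>n\<ge>n0. F n = F n0"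
proof -
  define Z where "Z = {z \<in> carrier G. \<forall>x\<in>carrier G. z \<otimes>\<^bsub>G\<^esub> x = x \<otimes>\<^bsub>G\<^esub> z}"
  have ZG: "z \<in> carrier G" if "z \<in> Z" for z using that unfolding Z_def by blast
  have Zc: "z \<otimes>\<^bsub>G\<^esub> x = x \<otimes>\<^bsub>G\<^esub> z" if "z \<in> Z" "x \<in> carrier G" for z x using that unfolding Z_def by blast
  have Zsub: "subgroup Z G"
  proof -
    have "Z = (\<Inter>x\<in>carrier G. {z \<in> carrier G. z \<otimes>\<^bsub>G\<^esub> x = x \<otimes>\<^bsub>G\<^esub> z})" unfolding Z_def by auto
    then show ?thesis using H.subgroup_centralizer by (auto intro!: H.subgroups_Inter)
  qed
  have Znorm: "Z \<lhd> G"
    using Zsub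
  proof (rule H.normal_of_commutators)
    fix x y assume "x \<in> Z" "y \<in> carrier G"
    then have "x \<otimes>\<^bsub>G\<^esub> y \<otimes>\<^bsub>G\<^esub> inv\<^bsub>G\<^esub> x \<otimes>\<^bsub>G\<^esub> inv\<^bsub>G\<^esub> y = \<one>\<^bsub>G\<^esub>"
      using H.commutator_eq_one_iff[of x y] Zc ZG by blast
    then show "x \<otimes>\<^bsub>G\<^esub> y \<otimes>\<^bsub>G\<^esub> inv\<^bsub>G\<^esub> x \<otimes>\<^bsub>G\<^esub> inv\<^bsub>G\<^esub> y \<in> Z"
      by (simp only: subgroup.one_closed[OF Zsub])
  qed
  have Zclosed: "closure_set Z \<subseteq> Z"
  proof
    fix z assume z: "z \<in> closure_set Z"
    then have zG: "z \<in> carrier G" unfolding closure_set_def by blast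
    have "z \<otimes>\<^bsub>G\<^esub> x = x \<otimes>\<^bsub>G\<^esub> z" if x: "x \<in> carrier G" for x
    proof (rule separated)
      fix n
      obtain c where c: "c \<in> Z" "\<pi> n z = \<pi> n c" using z unfolding closure_set_def by blast
      have "\<pi> n (c \<otimes>\<^bsub>G\<^esub> x) = \<pi> n (x \<otimes>\<^bsub>G\<^esub> c)" using Zc[OF c(1) x] by simp
      then show "\<pi> n (z \<otimes>\<^bsub>G\<^esub> x) = \<pi> n (x \<otimes>\<^bsub>G\<^esub> z)" using c zG x ZG by simp
    qed (use zG x in auto)
    then show "z \<in> Z" unfolding Z_def using zG by blast
  qed
  define Q where "Q n = Z <#>\<^bsub>G\<^esub> F n" for n
  note FG = subgroup.mem_carrier[OF F(1)]
  have in_Q: "x \<in> Q n \<longleftrightarrow> (\<exists>z\<in>Z. \<exists>f\<in>F n. x = z \<otimes>\<^bsub>G\<^esub> f)" for x n unfolding Q_def set_mult_def by blast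
  have Qsub: "subgroup (Q n) G" for n unfolding Q_def using Znorm F(1) by (rule H.mult_norm_subgroup)
  have ZQ: "Z \<subseteq> Q n" for n
  proof
    fix z assume z: "z \<in> Z"
    then have "z = z \<otimes>\<^bsub>G\<^esub> \<one>\<^bsub>G\<^esub>" using ZG by simp
    then show "z \<in> Q n" unfolding in_Q using z subgroup.one_closed[OF F(1)] by blast
  qed
  have FQ: "F n \<subseteq> Q n" for n
  proof
    fix f assume f: "f \<in> F n"
    then have "f = \<one>\<^bsub>G\<^esub> \<otimes>\<^bsub>G\<^esub> f" using FG by simp
    then show "f \<in> Q n" unfolding in_Q using f subgroup.one_closed[OF Zsub] by blast
  qed
  \<comment> \<open>The product of the closed subgroups \<open>Z\<close> and \<open>F n\<close> is
    closed because compactness selects a factor \<open>z\<close> that works at all levels at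
    once.\<close>
  have Qclosed: "closure_set (Q n) \<subseteq> Q n" for n
  proof
    fix q assume q: "q \<in> closure_set (Q n)"
    then have qG: "q \<in> carrier G" unfolding closure_set_def by blast
    let ?C = "\<lambda>N z. (\<exists>u\<in>Z. \<pi> N z = \<pi> N u) \<and> (\<exists>f\<in>F n. \<pi> N (inv\<^bsub>G\<^esub> z \<otimes>\<^bsub>G\<^esub> q) = \<pi> N f)"
    obtain z where z: "z \<in> carrier G" "\<And>N. ?C N z"
    proof (rule compactness[of ?C])
      fix N
      obtain z f where zf: "z \<in> Z" "f \<in> F n" "\<pi> N q = \<pi> N (z \<otimes>\<^bsub>G\<^esub> f)"
        using q unfolding closure_set_def mem_Collect_eq Bex_def in_Q by blast
      have "\<pi> N (inv\<^bsub>G\<^esub> z \<otimes>\<^bsub>G\<^esub> q) = \<pi> N (inv\<^bsub>G\<^esub> z \<otimes>\<^bsub>G\<^esub> (z \<otimes>\<^bsub>G\<^esub> f))"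
        using zf ZG FG qG by simp
      also have "inv\<^bsub>G\<^esub> z \<otimes>\<^bsub>G\<^esub> (z \<otimes>\<^bsub>G\<^esub> f) = f" using zf ZG FG by (simp add: H.m_assoc[symmetric])
      finally show "\<exists>z\<in>carrier G. ?C N z" using zf ZG by blast
    next
      fix N N' x assume "N \<le> N'" "x \<in> carrier G" "?C N' x"
      then show "?C N x"
        using quotient_refine_le[of N N'] qG FG ZG by (meson H.m_closed H.inv_closed)
    next
      fix N x y assume "x \<in> carrier G" "y \<in> carrier G" "\<pi> N x = \<pi> N y" "?C N x"
      then show "?C N y" using qG by simp
    qed blast
    have "z \<in> Z" using z Zclosed unfolding closure_set_def by blast
    moreover have "inv\<^bsub>G\<^esub> z \<otimes>\<^bsub>G\<^esub> q \<in> F n" using z qG F(2)[of n] unfolding closure_set_def by blast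
    moreover have "q = z \<otimes>\<^bsub>G\<^esub> (inv\<^bsub>G\<^esub> z \<otimes>\<^bsub>G\<^esub> q)" using z(1) qG by (simp add: H.m_assoc[symmetric])
    ultimately show "q \<in> Q n" unfolding in_Q by blast
  qed
  have Qmono: "Q m \<subseteq> Q n" if "m \<le> n" for m n
    using F(3)[OF that] unfolding Q_def set_mult_def by blast
  \<comment> \<open>Intersecting with the closures of the terms of the series allows one procyclic
    factor to be treated at a time, from the trivial subgroup up to the whole group.\<close>
  have "\<exists>n0. \<forall>n\<ge>n0. Q n \<inter> closure_set (\<phi> ` N) = Q n0 \<inter> closure_set (\<phi> ` N)"
    if "central_cyclic_series \<Delta> N" for N
    using that
  proof (induction rule: central_cyclic_series.induct)
    case one
    have "closure_set (\<phi> ` {\<one>\<^bsub>\<Delta>\<^esub>}) \<subseteq> {\<one>\<^bsub>G\<^esub>}"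
      unfolding closure_set_def using separated[of _ "\<one>\<^bsub>G\<^esub>"] by auto
    then have "Q n \<inter> closure_set (\<phi> ` {\<one>\<^bsub>\<Delta>\<^esub>}) = closure_set (\<phi> ` {\<one>\<^bsub>\<Delta>\<^esub>})" for n
      using subgroup.one_closed[OF Qsub[of n]] by blast
    then show ?case by simp
  next
    case (step N' N d)
    let ?M = "closure_set (\<phi> ` N)" and ?M' = "closure_set (\<phi> ` N')"
    have N'sub: "subgroup N' \<Delta>" using step.hyps(1) by (rule G.central_cyclic_series_subgroup)
    note NG = subgroup.mem_carrier[OF step.hyps(2)] and N'G = subgroup.mem_carrier[OF N'sub]
    have sub: "subgroup ?M G" "subgroup ?M' G"
      using step.hyps(2) N'sub by (auto intro!: subgroup_closure_set subgroup_img_is_subgroup)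
    have "?M' \<subseteq> ?M" using step.hyps(3) unfolding closure_set_def by blast
    have img: "\<phi> ` N \<subseteq> carrier G" "\<phi> ` N' \<subseteq> carrier G" using NG N'G by auto
    have norm: "?M' \<lhd> G"
    proof (rule H.normal_of_commutators[OF sub(2)])
      fix x y assume "x \<in> ?M'" "y \<in> carrier G"
      then show "x \<otimes>\<^bsub>G\<^esub> y \<otimes>\<^bsub>G\<^esub> inv\<^bsub>G\<^esub> x \<otimes>\<^bsub>G\<^esub> inv\<^bsub>G\<^esub> y \<in> ?M'"
        using \<open>?M' \<subseteq> ?M\<close> closure_image_central_step[OF step.hyps(2) N'sub step.hyps(6)] by blast
    qed
    have dM: "\<phi> d \<in> ?M"
      by (rule subsetD[OF subset_closure_set[OF img(1)] imageI[OF step.hyps(4)]])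
    have gen: "\<exists>k::int. \<exists>y\<in>?M'. \<pi> n x = \<pi> n (\<phi> d [^]\<^bsub>G\<^esub> k \<otimes>\<^bsub>G\<^esub> y)" if x: "x \<in> ?M" for x n
    proof -
      obtain b where b: "b \<in> N" "\<pi> n x = \<pi> n (\<phi> b)" using x unfolding closure_set_def by blast
      obtain k :: int and c where kc: "c \<in> N'" "b = d [^]\<^bsub>\<Delta>\<^esub> k \<otimes>\<^bsub>\<Delta>\<^esub> c" using step.hyps(5)[OF b(1)] by blast
      have "\<phi> b = \<phi> d [^]\<^bsub>G\<^esub> k \<otimes>\<^bsub>G\<^esub> \<phi> c"
        unfolding kc(2) using NG[OF step.hyps(4)] N'G[OF kc(1)] by (simp add: hom_int_pow)
      moreover have "\<phi> c \<in> ?M'" by (rule subsetD[OF subset_closure_set[OF img(2)] imageI[OF kc(1)]])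
      ultimately show ?thesis using b(2) by metis
    qed
    \<comment> \<open>The central component of \<open>\<phi> d\<close> lies in \<open>Z\<close>,
      hence in \<open>Q 0\<close>, and in \<open>?M\<close> as a limit of powers of
      \<open>\<phi> d\<close>. This is where the passage from \<open>F n\<close> to
      \<open>Q n\<close> confines the indices to the primes in \<open>S\<close>.\<close>
    have tors: "\<exists>s::nat. s > 0 \<and> (\<forall>p. prime p \<longrightarrow> p dvd s \<longrightarrow> p \<in> S) \<and>
        (\<exists>z\<in>Q 0 \<inter> ?M. \<pi> n (\<phi> d [^]\<^bsub>G\<^esub> s) = \<pi> n z)" for n
    proof -
      have dG: "\<phi> d \<in> carrier G" using NG step.hyps(4) by simp
      obtain z where z: "z \<in> carrier G" "\<And>x. x \<in> carrier G \<Longrightarrow> z \<otimes>\<^bsub>G\<^esub> x = x \<otimes>\<^bsub>G\<^esub> z"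
        "\<And>n. \<exists>u::nat. \<pi> n z = \<pi> n (\<phi> d [^]\<^bsub>G\<^esub> u)"
        "\<And>n. \<exists>s::nat. s > 0 \<and> (\<forall>p. prime p \<longrightarrow> p dvd s \<longrightarrow> p \<in> S) \<and> \<pi> n (\<phi> d [^]\<^bsub>G\<^esub> s) = \<pi> n (z [^]\<^bsub>G\<^esub> s)"
        by (rule central_component[where S = S, OF nilpotent_quotient[OF ccs] small dG that])
      have "z \<in> closure_set ?M"
        unfolding closure_set_def[of ?M] using z(1,3) H.subgroup_int_pow_closed[OF sub(1) dM]
        by (auto simp flip: int_pow_int)
      then have "z \<in> ?M" using closure_set_idem by blast
      moreover have "z \<in> Q 0" using z(1,2) ZQ unfolding Z_def by blast
      ultimately have "z [^]\<^bsub>G\<^esub> s \<in> Q 0 \<inter> ?M" for s :: nat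
        using H.subgroup_int_pow_closed[OF H.subgroups_Inter_pair[OF Qsub[of 0] sub(1)], of z "int s"]
        by (simp add: int_pow_int)
      then show ?thesis using z(4)[of n] by blast
    qed
    show ?case
      by (rule stationary_step[OF norm closure_set_idem sub(1) \<open>?M' \<subseteq> ?M\<close> dM gen Qsub Qclosed Qmono fin tors step.IH])
  qed
  then obtain n0 where n0: "\<And>n. n \<ge> n0 \<Longrightarrow>
      Q n \<inter> closure_set (\<phi> ` carrier \<Delta>) = Q n0 \<inter> closure_set (\<phi> ` carrier \<Delta>)" using ccs by blast
  have "carrier G \<subseteq> closure_set (\<phi> ` carrier \<Delta>)" using dense unfolding closure_set_def by blast
  then have Qn0: "Q n = Q n0" if "n \<ge> n0" for n
    using n0[OF that] subgroup.subset[OF Qsub] by blast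
  \<comment> \<open>Dividing \<open>g\<close> by its factor in \<open>F n0\<close> leaves a central
    element of \<open>F n\<close>, which lies in \<open>F 0\<close> already.\<close>
  have "F n \<subseteq> F n0" if n: "n \<ge> n0" for n
  proof
    fix g assume g: "g \<in> F n"
    then have "g \<in> Q n0" using FQ Qn0[OF n] by blast
    then obtain z f where zf: "z \<in> Z" "f \<in> F n0" "g = z \<otimes>\<^bsub>G\<^esub> f" unfolding in_Q by blast
    have "g \<otimes>\<^bsub>G\<^esub> inv\<^bsub>G\<^esub> f \<in> F n"
      using g zf(2) F(3)[OF n] by (intro subgroup.m_closed[OF F(1)] subgroup.m_inv_closed[OF F(1)]) auto
    moreover have "g \<otimes>\<^bsub>G\<^esub> inv\<^bsub>G\<^esub> f = z" using zf ZG FG by (simp add: H.m_assoc)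
    ultimately have "z \<in> F 0" using central Zc[OF zf(1)] by simp
    then have "z \<in> F n0" using F(3)[of 0 n0] by blast
    then show "g \<in> F n0" unfolding zf(3) using zf(2) by (rule subgroup.m_closed[OF F(1)])
  qed
  then have "\<forall>n\<ge>n0. F n = F n0" using F(3) by blast
  then show ?thesis by blast
qed

end


section \<open>Invariant clopen partitions\<close>

context cantor_action
begin

lemma compact_UNIV: "compact (UNIV :: 'x set)"
  using cantor unfolding cantor_space_def by blast

lemma act_mult: "\<lbrakk>g \<in> carrier \<Gamma>; h \<in> carrier \<Gamma>\<rbrakk> \<Longrightarrow> \<Phi> (g \<otimes> h) x = \<Phi> g (\<Phi> h x)"
  by (rule composition_rule) simp_all

lemma act_one [simp]: "\<Phi> \<one> x = x"
  using id_eq_one by (metis UNIV_I restrict_apply')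

lemma act_group: "group \<Gamma>"
  using group_hom group_hom.axioms(1) by blast

lemma act_inv_left [simp]: "g \<in> carrier \<Gamma> \<Longrightarrow> \<Phi> (inv g) (\<Phi> g x) = x"
  using act_mult[of "inv g" g x] act_group by (simp add: group.l_inv)

lemma act_inv_right [simp]: "g \<in> carrier \<Gamma> \<Longrightarrow> \<Phi> g (\<Phi> (inv g) x) = x"
  using act_mult[of g "inv g" x] act_group by (simp add: group.r_inv)

text \<open>Total disconnectedness makes \<open>{x}\<close> a component, and in a compact Hausdorff
  space a component inside an open set can be split off by a clopen set.\<close>

lemma clopen_neighbourhood:
  fixes x :: 'x
  assumes "open U" "x \<in> U"
  obtains C where "open C" "closed C" "x \<in> C" "C \<subseteq> U"
proof -
  let ?X = "euclidean :: 'x topology"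
  let ?C = "connected_component_of_set ?X x"
  have "connected ?C" using connectedin_connected_component_of[of ?X x] by simp
  then obtain y where "?C \<subseteq> {y}" using cantor unfolding cantor_space_def by blast
  moreover have "x \<in> ?C" by (simp add: connected_component_of_refl)
  ultimately have C: "?C = {x}" by blast
  have 1: "compact_space ?X" using compact_UNIV by (simp add: compact_space_def)
  have 2: "{x} \<in> connected_components_of ?X"
    unfolding C[symmetric] by (simp add: connected_component_in_connected_components_of)
  obtain A B where AB: "openin ?X A" "openin ?X B" "disjnt A B" "A \<union> B = topspace ?X" "{x} \<subseteq> A" "A \<subseteq> U"
    using wilder_locally_compact_component_thm[of ?X "{x}" U] 1 2 assms
    by (auto simp: compact_imp_locally_compact_space)
  have "A = - B" using AB(3,4) by (auto simp: disjnt_def)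
  then have "closed A" using AB(2) by (simp add: open_closed)
  then show ?thesis using that[of A] AB by simp
qed

end

section \<open>Invariant clopen equivalence relations from equicontinuity\<close>

context equicontinuous_cantor_action
begin

text \<open>Chains whose steps stay shorter than \<open>\<delta>\<close> under the whole group; in a compact totally
  disconnected space such chains cannot travel far.\<close>

definition close_pairs :: "real \<Rightarrow> ('c \<times> 'c) set" where
  "close_pairs \<delta> = {(x, y). \<forall>g\<in>carrier \<Gamma>. dist (\<Phi> g x) (\<Phi> g y) < \<delta>}"

text \<open>A \<Gamma>-invariant equivalence relation with finitely many classes, all clopen. The
  classes of a point form its shrinking neighbourhood basis, and the action on the set of classes
  yields the finite quotients.\<close>

definition level :: "nat \<Rightarrow> ('c \<times> 'c) set" where
  "level n = (close_pairs (1 / real (Suc n)))\<^sup>*"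

lemma level_refl [simp]: "(x, x) \<in> level n"
  unfolding level_def by simp

lemma level_trans: "(x, y) \<in> level n \<Longrightarrow> (y, z) \<in> level n \<Longrightarrow> (x, z) \<in> level n"
  unfolding level_def by (rule rtrancl_trans)

lemma level_sym: "(x, y) \<in> level n \<Longrightarrow> (y, x) \<in> level n"
proof -
  have "sym (close_pairs \<delta>)" for \<delta> unfolding close_pairs_def sym_def by (simp add: dist_commute)
  then show "(x, y) \<in> level n \<Longrightarrow> (y, x) \<in> level n"
    unfolding level_def using sym_rtrancl by (metis symD)
qed

lemma level_antimono:
  assumes "m \<le> n" "(x, y) \<in> level n"
  shows "(x, y) \<in> level m"
proof -
  have "1 / real (Suc n) \<le> 1 / real (Suc m)" using assms(1) by (simp add: frac_le)
  then have "close_pairs (1 / real (Suc n)) \<subseteq> close_pairs (1 / real (Suc m))"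
    unfolding close_pairs_def by (auto intro: less_le_trans)
  then show ?thesis using assms(2) rtrancl_mono unfolding level_def by blast
qed

lemma level_act:
  assumes "(x, y) \<in> level n" "g \<in> carrier \<Gamma>"
  shows "(\<Phi> g x, \<Phi> g y) \<in> level n"
  using assms(1) unfolding level_def
proof (induction rule: rtrancl_induct)
  case (step y z)
  have "dist (\<Phi> h (\<Phi> g y)) (\<Phi> h (\<Phi> g z)) < 1 / real (Suc n)" if "h \<in> carrier \<Gamma>" for h
    using step(2) that assms(2) act_group unfolding close_pairs_def
    by (auto simp: act_mult[symmetric] group.subgroup_self subgroup.m_closed)
  then have "(\<Phi> g y, \<Phi> g z) \<in> close_pairs (1 / real (Suc n))" unfolding close_pairs_def by blast
  then show ?case using step(3) by (rule rtrancl_into_rtrancl[rotated])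
qed simp

text \<open>Equicontinuity enters here: sufficiently close points stay close under the whole group,
  so they form a chain of one step.\<close>

lemma level_uniform:
  obtains \<delta> where "\<delta> > 0" "\<And>x y. dist x y < \<delta> \<Longrightarrow> (x, y) \<in> level n"
proof -
  obtain \<delta> where \<delta>: "\<delta> > 0" "\<And>x y g. dist x y < \<delta> \<Longrightarrow> g \<in> carrier \<Gamma> \<Longrightarrow> dist (\<Phi> g x) (\<Phi> g y) < 1 / real (Suc n)"
    using equicontinuous[rule_format, of "1 / real (Suc n)"] by auto
  have "(x, y) \<in> level n" if "dist x y < \<delta>" for x y
    unfolding level_def using \<delta>(2)[OF that] by (intro r_into_rtrancl) (simp add: close_pairs_def)
  then show ?thesis using that \<delta>(1) by blast
qed

text \<open>\<open>e\<close> is a Lebesgue number of the cover by \<open>C\<close> and its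
  complement.\<close>

lemma clopen_gap:
  assumes "open C" "closed (C :: 'c set)"
  shows "\<exists>e>0. \<forall>x y. x \<in> C \<longrightarrow> dist x y < e \<longrightarrow> y \<in> C"
proof -
  obtain e where e: "0 < e" "\<And>x. x \<in> UNIV \<Longrightarrow> \<exists>A\<in>{C, - C}. ball x e \<subseteq> A"
    using Heine_Borel_lemma[OF compact_UNIV, of "{C, - C}"] assms by auto
  have "y \<in> C" if "x \<in> C" "dist x y < e" for x y
    using e(2)[of x] that e(1) by (auto simp: subset_iff mem_ball)
  then show ?thesis using e(1) by blast
qed

text \<open>Finitely many clopen sets of small diameter cover the space. A chain whose steps are
  shorter than the gaps of all of them never leaves the set in which it starts.\<close>

lemma level_small:
  assumes "\<epsilon> > 0"
  obtains n where "\<And>x y. (x, y) \<in> level n \<Longrightarrow> dist x y < \<epsilon>"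
proof -
  let ?\<C> = "{C :: 'c set. open C \<and> closed C \<and> (\<forall>x\<in>C. \<forall>y\<in>C. dist x y < \<epsilon>)}"
  have cover: "UNIV \<subseteq> \<Union>?\<C>"
  proof
    fix x :: 'c
    obtain C where C: "open C" "closed C" "x \<in> C" "C \<subseteq> ball x (\<epsilon> / 2)"
      using clopen_neighbourhood[of "ball x (\<epsilon> / 2)" x] assms by auto
    have "dist y z < \<epsilon>" if "y \<in> C" "z \<in> C" for y z
    proof (rule dist_triangle_half_r)
      show "dist x y < \<epsilon> / 2" "dist x z < \<epsilon> / 2" using C(4) that by (meson mem_ball subsetD)+
    qed
    then show "x \<in> \<Union>?\<C>" using C by blast
  qed
  have "\<And>C. C \<in> ?\<C> \<Longrightarrow> open C" by blast
  note finite_subcover = compactE[OF compact_UNIV cover this]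
  obtain \<D> where \<D>: "\<D> \<subseteq> ?\<C>" "finite \<D>" "UNIV \<subseteq> \<Union>\<D>"
    by (rule finite_subcover[OF _ that])
  have "\<forall>C\<in>\<D>. \<exists>e>0. \<forall>x y. x \<in> C \<longrightarrow> dist x y < e \<longrightarrow> y \<in> C"
  proof
    fix C assume "C \<in> \<D>"
    then have "open C" "closed C" using \<D>(1) by auto
    then show "\<exists>e>0. \<forall>x y. x \<in> C \<longrightarrow> dist x y < e \<longrightarrow> y \<in> C" by (rule clopen_gap)
  qed
  then obtain e where e: "\<And>C. C \<in> \<D> \<Longrightarrow> e C > 0" "\<And>C x y. C \<in> \<D> \<Longrightarrow> x \<in> C \<Longrightarrow> dist x y < e C \<Longrightarrow> y \<in> C"
    by metis
  have "\<D> \<noteq> {}" using \<D>(3) by auto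
  define d where "d = Min (e ` \<D>)"
  have "d > 0" unfolding d_def using \<D>(2) \<open>\<D> \<noteq> {}\<close> e(1) by simp
  then obtain n where n: "1 / real (Suc n) < d" by (metis nat_approx_posE)
  have "dist x y < \<epsilon>" if "(x, y) \<in> level n" for x y
  proof -
    obtain C where C: "C \<in> \<D>" "x \<in> C" using \<D>(3) by blast
    have "d \<le> e C" unfolding d_def using C(1) \<D>(2) by simp
    have "y \<in> C" using that unfolding level_def
    proof (induction rule: rtrancl_induct)
      case (step y z)
      have "\<one> \<in> carrier \<Gamma>" by (rule monoid.one_closed[OF group.is_monoid[OF act_group]])
      then have "dist (\<Phi> \<one> y) (\<Phi> \<one> z) < 1 / real (Suc n)"
        using step(2) unfolding close_pairs_def by blast
      then show ?case using e(2)[OF C(1) step(3)] n \<open>d \<le> e C\<close> by simp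
    qed (rule C)
    then show ?thesis using C \<D>(1) by blast
  qed
  then show ?thesis by (rule that)
qed

lemma level_separated:
  assumes "\<And>n. (x, y) \<in> level n"
  shows "x = y"
proof (rule ccontr)
  assume "x \<noteq> y"
  then obtain n where "\<And>u v. (u, v) \<in> level n \<Longrightarrow> dist u v < dist x y"
    using level_small[of "dist x y"] by auto
  then show False using assms by blast
qed

lemma level_class_open: "open (level n `` {x})"
proof -
  obtain \<delta> where "\<delta> > 0" "\<And>x y. dist x y < \<delta> \<Longrightarrow> (x, y) \<in> level n" using level_uniform[of n] by blast
  then have "\<exists>e>0. ball y e \<subseteq> level n `` {x}" if "y \<in> level n `` {x}" for y
    using that level_trans by (intro exI[of _ \<delta>]) (auto simp: mem_ball)
  then show ?thesis unfolding open_contains_ball by blast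
qed

lemma level_class_closed: "closed (level n `` {x})"
proof -
  have "- (level n `` {x}) = (\<Union>y\<in>- (level n `` {x}). level n `` {y})"
  proof (intro equalityI subsetI)
    fix z assume "z \<in> (\<Union>y\<in>- (level n `` {x}). level n `` {y})"
    then obtain y where "(x, y) \<notin> level n" "(y, z) \<in> level n" by blast
    then show "z \<in> - (level n `` {x})" using level_trans level_sym by (metis ComplI Image_singleton_iff)
  qed (use level_refl in blast)
  then have "open (- (level n `` {x}))" using level_class_open by (metis (no_types, lifting) open_UN)
  then show ?thesis by (simp add: closed_def)
qed

lemma level_neighbourhood:
  assumes "open V" "y \<in> V"
  obtains m where "m \<ge> n" "level m `` {y} \<subseteq> V"
proof -
  obtain e where e: "e > 0" "ball y e \<subseteq> V" using assms by (meson openE)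
  obtain m where m: "\<And>x y. (x, y) \<in> level m \<Longrightarrow> dist x y < e" using level_small[OF e(1)] by blast
  have "level (max m n) `` {y} \<subseteq> V"
    using e(2) m level_antimono[of m "max m n"] by (auto simp: mem_ball subset_iff)
  then show ?thesis using that[of "max m n"] by simp
qed

lemma level_finite: "\<exists>R. finite R \<and> (\<forall>x. \<exists>r\<in>R. (r, x) \<in> level n)"
proof -
  have cover: "UNIV \<subseteq> (\<Union>x\<in>UNIV. level n `` {x})" by auto
  obtain R where "R \<subseteq> UNIV" "finite R" "UNIV \<subseteq> (\<Union>x\<in>R. level n `` {x})"
    by (rule compactE_image[OF compact_UNIV level_class_open cover that])
  then show ?thesis by (intro exI[of _ R]) auto
qed

text \<open>For limits of group elements this means inducing the same permutation of the classes at
  level \<open>n\<close>. These relations replace the uniform metric.\<close>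

definition near :: "nat \<Rightarrow> ('c \<Rightarrow> 'c) \<Rightarrow> ('c \<Rightarrow> 'c) \<Rightarrow> bool" where
  "near n f g \<longleftrightarrow> (\<forall>x. (f x, g x) \<in> level n)"

lemma near_refl [simp]: "near n f f"
  unfolding near_def by simp

lemma near_sym: "near n f g \<Longrightarrow> near n g f"
  unfolding near_def using level_sym by blast

lemma near_trans: "near n f g \<Longrightarrow> near n g h \<Longrightarrow> near n f h"
  unfolding near_def using level_trans by blast

lemma near_antimono: "m \<le> n \<Longrightarrow> near n f g \<Longrightarrow> near m f g"
  unfolding near_def using level_antimono by blast

lemma near_separated: "(\<And>n. near n f g) \<Longrightarrow> f = g"
  unfolding near_def using level_separated by blast

lemma near_comp_right: "near n f g \<Longrightarrow> near n (f \<circ> h) (g \<circ> h)"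
  unfolding near_def by simp

text \<open>The uniform closure among all maps; for a subgroup \<open>H\<close>, bijectivity and
  continuity are consequences. Keeping \<open>H\<close> variable covers the nilpotent subgroup and
  \<Gamma> itself.\<close>

definition limits :: "'a set \<Rightarrow> ('c \<Rightarrow> 'c) set" where
  "limits H = {f. \<forall>n. \<exists>h\<in>H. near n f (\<Phi> h)}"

lemma limitsE:
  assumes "f \<in> limits H"
  obtains h where "h \<in> H" "near n f (\<Phi> h)"
  using assms unfolding limits_def by blast

lemma act_in_limits: "h \<in> H \<Longrightarrow> \<Phi> h \<in> limits H"
  unfolding limits_def using near_refl by blast

lemma limits_mono: "H \<subseteq> H' \<Longrightarrow> limits H \<subseteq> limits H'"
  unfolding limits_def by blast

lemma limits_level:
  assumes "f \<in> limits H" "H \<subseteq> carrier \<Gamma>" "(x, y) \<in> level n"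
  shows "(f x, f y) \<in> level n"
proof -
  obtain h where h: "h \<in> H" "near n f (\<Phi> h)" using assms(1) by (rule limitsE)
  then have "(\<Phi> h x, \<Phi> h y) \<in> level n" using level_act assms by blast
  then show ?thesis using h(2) unfolding near_def by (meson level_sym level_trans)
qed

lemma near_comp_left:
  assumes "f \<in> limits H" "H \<subseteq> carrier \<Gamma>" "near n g h"
  shows "near n (f \<circ> g) (f \<circ> h)"
  using assms(3) limits_level[OF assms(1,2)] unfolding near_def by simp

text \<open>At each point the classes of the images are nested nonempty closed sets, so by
  compactness they have a common point.\<close>

lemma near_complete:
  assumes "\<And>n. near n (f (Suc n)) (f n)"
  obtains g where "\<And>n. near n g (f n)"
proof -
  have "\<exists>y. \<forall>n. (y, f n x) \<in> level n" for x
  proof -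
    let ?C = "\<lambda>n. level n `` {f n x}"
    have dec: "?C (Suc n) \<subseteq> ?C n" for n
    proof
      fix y assume "y \<in> ?C (Suc n)"
      then have "(f (Suc n) x, y) \<in> level n" using level_antimono[of n "Suc n"] by auto
      moreover have "(f n x, f (Suc n) x) \<in> level n" using assms[of n] level_sym unfolding near_def by blast
      ultimately show "y \<in> ?C n" using level_trans by blast
    qed
    have "\<Inter>(range ?C) \<noteq> {}"
    proof (rule compact_space_imp_nest)
      show "compact_space (euclidean :: 'c topology)" using compact_UNIV by (simp add: compact_space_def)
      show "closedin euclidean (?C n)" for n using level_class_closed by simp
      show "?C n \<noteq> {}" for n using level_refl by blast
      show "decseq ?C" using dec by (rule decseq_SucI)
    qed
    then show ?thesis using level_sym by blast
  qed
  then obtain g where "\<And>x n. (g x, f n x) \<in> level n" by metis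
  then show ?thesis using that unfolding near_def by blast
qed

end


section \<open>The closure as a profinite group\<close>

lemma carrier_BijGroup_UNIV [simp]: "carrier (BijGroup UNIV) = {f. bij f}"
  by (auto simp: BijGroup_def Bij_def)

lemma mult_BijGroup_UNIV [simp]: "bij f \<Longrightarrow> bij g \<Longrightarrow> f \<otimes>\<^bsub>BijGroup UNIV\<^esub> g = f \<circ> g"
  by (auto simp: BijGroup_def Bij_def compose_def)

lemma one_BijGroup_UNIV [simp]: "\<one>\<^bsub>BijGroup UNIV\<^esub> = id"
  by (auto simp: BijGroup_def)

lemma Homeo_in_cfunspace:
  fixes g :: "'x::metric_space \<Rightarrow> 'x"
  assumes "compact (UNIV :: 'x set)" "g \<in> Homeo"
  shows "g \<in> mspace (cfunspace euclidean euclidean_metric)"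
proof -
  have cont: "continuous_on UNIV g" using assms(2) unfolding Homeo_def homeomorphism_def by blast
  then have "bounded (range g)" using assms(1) by (intro compact_imp_bounded compact_continuous_image)
  then obtain y e where "\<forall>x\<in>range g. dist y x \<le> e" unfolding bounded_def by blast
  then have "Met_TC.mbounded (range g)" unfolding Met_TC.mbounded by blast
  then show ?thesis using cont by simp
qed

lemma in_closure_uniform_topology_iff:
  fixes f :: "'x::metric_space \<Rightarrow> 'x"
  assumes "compact (UNIV :: 'x set)" "A \<subseteq> Homeo"
  shows "f \<in> uniform_topology closure_of A \<longleftrightarrow>
    f \<in> Homeo \<and> (\<forall>\<epsilon>>0. \<exists>g\<in>A. \<forall>x. dist (f x) (g x) < \<epsilon>)"
proof -
  let ?m = "cfunspace (euclidean :: 'x topology) (euclidean_metric :: 'x metric)"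
  interpret M: Metric_space "mspace ?m" "mdist ?m" by (rule Metric_space_mspace_mdist)
  note sp = Homeo_in_cfunspace[OF assms(1)]
  have lt: "dist (g x) (h x) < \<epsilon>" if "g \<in> Homeo" "h \<in> Homeo" "mdist ?m g h < \<epsilon>" for g h \<epsilon> x
    using cfunspace_mdist_lt[OF _ sp[OF that(1)] sp[OF that(2)] that(3), of x] assms(1) by simp
  \<comment> \<open>The supremum of distances below a bound may equal the bound, hence the
    half.\<close>
  have le: "mdist ?m g h < \<epsilon>" if "\<epsilon> > 0" "\<And>x. dist (g x) (h x) < \<epsilon> / 2" for g h \<epsilon>
  proof -
    have "mdist ?m g h \<le> \<epsilon> / 2"
      by (rule mdist_cfunspace_le) (use that in \<open>auto intro: less_imp_le\<close>)
    then show ?thesis using that(1) by simp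
  qed
  have "f \<in> uniform_topology closure_of A \<longleftrightarrow> f \<in> Homeo \<and> f \<in> M.mtopology closure_of A"
    using assms(2) unfolding uniform_topology_def mtopology_of_def
    by (simp add: closure_of_subtopology Int_absorb1 del: mspace_cfunspace)
  also have "\<dots> \<longleftrightarrow> f \<in> Homeo \<and> (\<forall>\<epsilon>>0. \<exists>g\<in>A. mdist ?m f g < \<epsilon>)"
    using sp assms(2) unfolding M.metric_closure_of M.in_mball by blast
  also have "\<dots> \<longleftrightarrow> f \<in> Homeo \<and> (\<forall>\<epsilon>>0. \<exists>g\<in>A. \<forall>x. dist (f x) (g x) < \<epsilon>)"
  proof (intro conj_cong refl iffI allI impI)
    fix \<epsilon> :: real
    assume f: "f \<in> Homeo" "\<forall>\<epsilon>>0. \<exists>g\<in>A. mdist ?m f g < \<epsilon>" "\<epsilon> > 0"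
    then show "\<exists>g\<in>A. \<forall>x. dist (f x) (g x) < \<epsilon>" using lt[OF f(1)] assms(2) by blast
  next
    fix \<epsilon> :: real
    assume f: "f \<in> Homeo" "\<forall>\<epsilon>>0. \<exists>g\<in>A. \<forall>x. dist (f x) (g x) < \<epsilon>" "\<epsilon> > 0"
    then obtain g where "g \<in> A" "\<forall>x. dist (f x) (g x) < \<epsilon> / 2" using half_gt_zero by blast
    then show "\<exists>g\<in>A. mdist ?m f g < \<epsilon>" using le f(3) by blast
  qed
  finally show ?thesis .
qed

lemma openin_uniform_topologyI:
  fixes N :: "('x::metric_space \<Rightarrow> 'x) set"
  assumes "compact (UNIV :: 'x set)" "N \<subseteq> C" "C \<subseteq> Homeo" "\<delta> > 0"
    and ball: "\<And>f g. \<lbrakk>f \<in> N; g \<in> C; \<And>x. dist (f x) (g x) < \<delta>\<rbrakk> \<Longrightarrow> g \<in> N"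
  shows "openin (subtopology uniform_topology C) N"
proof -
  let ?m = "cfunspace (euclidean :: 'x topology) (euclidean_metric :: 'x metric)"
  interpret M: Metric_space "mspace ?m" "mdist ?m" by (rule Metric_space_mspace_mdist)
  note sp = Homeo_in_cfunspace[OF assms(1)]
  define U where "U = (\<Union>f\<in>N. M.mball f \<delta>)"
  have "openin M.mtopology U" unfolding U_def by (intro openin_Union ballI) (blast intro: M.openin_mball)
  moreover have "N = U \<inter> Homeo \<inter> C"
  proof
    show "N \<subseteq> U \<inter> Homeo \<inter> C"
      using assms(2,3,4) sp M.centre_in_mball_iff unfolding U_def by blast
    show "U \<inter> Homeo \<inter> C \<subseteq> N"
    proof
      fix g assume g: "g \<in> U \<inter> Homeo \<inter> C"
      then obtain f where f: "f \<in> N" "mdist ?m f g < \<delta>" unfolding U_def by (auto simp del: mspace_cfunspace)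
      have "f \<in> mspace ?m" "g \<in> mspace ?m" using sp f(1) g assms(2,3) by blast+
      then have "dist (f x) (g x) < \<delta>" for x
        using cfunspace_mdist_lt[OF _ _ _ f(2), of x] assms(1) by simp
      then show "g \<in> N" using ball[OF f(1)] g by blast
    qed
  qed
  ultimately show ?thesis
    unfolding uniform_topology_def mtopology_of_def openin_subtopology by blast
qed

section \<open>The group of limits and its finite level quotients\<close>

context equicontinuous_cantor_action
begin

lemma near_act_inv:
  assumes "g \<in> carrier \<Gamma>" "h \<in> carrier \<Gamma>" "near n (\<Phi> g) (\<Phi> h)"
  shows "near n (\<Phi> (inv g)) (\<Phi> (inv h))"
  unfolding near_def
proof
  fix x
  have "inv g \<in> carrier \<Gamma>" using assms(1) act_group by (simp add: group.inv_closed)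
  moreover have "(\<Phi> g (\<Phi> (inv h) x), \<Phi> h (\<Phi> (inv h) x)) \<in> level n"
    using assms(3) unfolding near_def by blast
  ultimately have "(\<Phi> (inv g) (\<Phi> g (\<Phi> (inv h) x)), \<Phi> (inv g) (\<Phi> h (\<Phi> (inv h) x))) \<in> level n"
    by (rule level_act[rotated])
  then show "(\<Phi> (inv g) x, \<Phi> (inv h) x) \<in> level n"
    using assms(1,2) by (simp add: level_sym)
qed

lemma limits_comp:
  assumes H: "subgroup H \<Gamma>" and f: "f \<in> limits H" and g: "g \<in> limits H"
  shows "f \<circ> g \<in> limits H"
  unfolding limits_def
proof safe
  fix n
  obtain a where a: "a \<in> H" "near n f (\<Phi> a)" using f by (rule limitsE)
  obtain b where b: "b \<in> H" "near n g (\<Phi> b)" using g by (rule limitsE)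
  have ab: "a \<in> carrier \<Gamma>" "b \<in> carrier \<Gamma>" using a b subgroup.mem_carrier[OF H] by auto
  have "near n (f \<circ> g) (f \<circ> \<Phi> b)" using f subgroup.subset[OF H] b(2) by (rule near_comp_left)
  moreover have "near n (f \<circ> \<Phi> b) (\<Phi> a \<circ> \<Phi> b)" using a(2) by (rule near_comp_right)
  moreover have "\<Phi> a \<circ> \<Phi> b = \<Phi> (a \<otimes> b)" using act_mult[OF ab] by (simp add: fun_eq_iff)
  ultimately have "near n (f \<circ> g) (\<Phi> (a \<otimes> b))" using near_trans by metis
  then show "\<exists>h\<in>H. near n (f \<circ> g) (\<Phi> h)" using subgroup.m_closed[OF H a(1) b(1)] by blast
qed

lemma act_comp_inv:
  assumes "a \<in> carrier \<Gamma>"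
  shows "\<Phi> a \<circ> \<Phi> (inv a) = id" "\<Phi> (inv a) \<circ> \<Phi> a = id"
  using assms by (simp_all add: fun_eq_iff)

text \<open>Inversion preserves nearness of group elements, so the inverses of an approximating
  sequence converge as well; their limit inverts \<open>f\<close> on both sides.\<close>

lemma limits_inverse:
  assumes H: "subgroup H \<Gamma>" and f: "f \<in> limits H"
  obtains f' where "f' \<in> limits H" "f \<circ> f' = id" "f' \<circ> f = id"
proof -
  have "\<forall>n. \<exists>a\<in>H. near n f (\<Phi> a)" using f unfolding limits_def by blast
  then obtain a where a: "\<And>n. a n \<in> H" "\<And>n. near n f (\<Phi> (a n))" by metis
  have aG: "a n \<in> carrier \<Gamma>" "inv (a n) \<in> carrier \<Gamma>" for n
    using a(1) subgroup.mem_carrier[OF H] subgroup.m_inv_closed[OF H] by auto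
  have "near n (\<Phi> (inv (a (Suc n)))) (\<Phi> (inv (a n)))" for n
  proof (rule near_act_inv[OF aG(1) aG(1)])
    have "near n f (\<Phi> (a (Suc n)))" using a(2)[of "Suc n"] by (rule near_antimono[rotated]) simp
    then show "near n (\<Phi> (a (Suc n))) (\<Phi> (a n))" using a(2)[of n] near_sym near_trans by blast
  qed
  then obtain f' where f': "\<And>n. near n f' (\<Phi> (inv (a n)))"
    using near_complete[of "\<lambda>n. \<Phi> (inv (a n))"] by blast
  have f'L: "f' \<in> limits H" unfolding limits_def using f' a(1) subgroup.m_inv_closed[OF H] by blast
  have "near n (f \<circ> f') id" for n
  proof -
    have "near n (f \<circ> f') (f \<circ> \<Phi> (inv (a n)))"
      using f subgroup.subset[OF H] f' by (rule near_comp_left)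
    moreover have "near n (f \<circ> \<Phi> (inv (a n))) (\<Phi> (a n) \<circ> \<Phi> (inv (a n)))"
      using a(2) by (rule near_comp_right)
    ultimately show ?thesis using near_trans unfolding act_comp_inv(1)[OF aG(1)] by blast
  qed
  then have "f \<circ> f' = id" by (rule near_separated)
  moreover have "near n (f' \<circ> f) id" for n
  proof -
    have "near n (f' \<circ> f) (f' \<circ> \<Phi> (a n))"
      using f'L subgroup.subset[OF H] a(2) by (rule near_comp_left)
    moreover have "near n (f' \<circ> \<Phi> (a n)) (\<Phi> (inv (a n)) \<circ> \<Phi> (a n))"
      using f' by (rule near_comp_right)
    ultimately show ?thesis using near_trans unfolding act_comp_inv(2)[OF aG(1)] by blast
  qed
  then have "f' \<circ> f = id" by (rule near_separated)
  ultimately show ?thesis using that f'L by blast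
qed

lemma limits_bij:
  assumes "subgroup H \<Gamma>" "f \<in> limits H"
  shows "bij f"
  by (rule limits_inverse[OF assms]) (blast intro: o_bij)

lemma subgroup_limits:
  assumes H: "subgroup H \<Gamma>"
  shows "subgroup (limits H) (BijGroup UNIV)"
proof (rule group.subgroupI[OF group_BijGroup])
  show "limits H \<subseteq> carrier (BijGroup UNIV)" using limits_bij[OF H] by auto
  show "limits H \<noteq> {}" using act_in_limits subgroup.one_closed[OF H] by blast
next
  fix f assume f: "f \<in> limits H"
  obtain f' where f': "f' \<in> limits H" "f \<circ> f' = id" "f' \<circ> f = id" using limits_inverse[OF H f] .
  have "inv\<^bsub>BijGroup UNIV\<^esub> f = f'"
    using f f' limits_bij[OF H] by (intro group.inv_equality[OF group_BijGroup]) auto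
  then show "inv\<^bsub>BijGroup UNIV\<^esub> f \<in> limits H" using f' by simp
next
  fix f g assume "f \<in> limits H" "g \<in> limits H"
  then show "f \<otimes>\<^bsub>BijGroup UNIV\<^esub> g \<in> limits H" using limits_comp[OF H] limits_bij[OF H] by simp
qed

definition limit_group :: "'a set \<Rightarrow> ('c \<Rightarrow> 'c) monoid" where
  "limit_group H = (BijGroup UNIV)\<lparr>carrier := limits H\<rparr>"

lemma carrier_limit_group [simp]: "carrier (limit_group H) = limits H"
  unfolding limit_group_def by simp

lemma one_limit_group [simp]: "\<one>\<^bsub>limit_group H\<^esub> = id"
  using one_BijGroup_UNIV unfolding limit_group_def by simp

lemma mult_limit_group [simp]:
  "subgroup H \<Gamma> \<Longrightarrow> f \<in> limits H \<Longrightarrow> g \<in> limits H \<Longrightarrow> f \<otimes>\<^bsub>limit_group H\<^esub> g = f \<circ> g"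
  using mult_BijGroup_UNIV limits_bij unfolding limit_group_def by simp

lemma group_limit_group: "subgroup H \<Gamma> \<Longrightarrow> group (limit_group H)"
  unfolding limit_group_def by (intro subgroup.subgroup_is_group subgroup_limits group_BijGroup)

lemma limit_group_inv:
  assumes "subgroup H \<Gamma>" "f \<in> limits H"
  shows "inv\<^bsub>limit_group H\<^esub> f \<in> limits H" "f \<circ> inv\<^bsub>limit_group H\<^esub> f = id" "inv\<^bsub>limit_group H\<^esub> f \<circ> f = id"
proof -
  interpret L: group "limit_group H" using assms(1) by (rule group_limit_group)
  show 1: "inv\<^bsub>limit_group H\<^esub> f \<in> limits H" using assms L.inv_closed[of f] by simp
  show "f \<circ> inv\<^bsub>limit_group H\<^esub> f = id" using L.r_inv[of f] assms 1 by simp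
  show "inv\<^bsub>limit_group H\<^esub> f \<circ> f = id" using L.l_inv[of f] assms 1 by simp
qed

lemma limits_continuous:
  assumes "subgroup H \<Gamma>" "f \<in> limits H"
  shows "continuous_on UNIV f"
  unfolding continuous_on_iff
proof (intro ballI allI impI)
  fix x and e :: real assume "e > 0"
  then obtain n where n: "\<And>x y. (x, y) \<in> level n \<Longrightarrow> dist x y < e" using level_small by blast
  obtain d where d: "d > 0" "\<And>x y. dist x y < d \<Longrightarrow> (x, y) \<in> level n" using level_uniform[of n] by blast
  show "\<exists>d>0. \<forall>x'\<in>UNIV. dist x' x < d \<longrightarrow> dist (f x') (f x) < e"
    using d n limits_level[OF assms(2) subgroup.subset[OF assms(1)]] by blast
qed

lemma limits_Homeo:
  assumes "subgroup H \<Gamma>" "f \<in> limits H"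
  shows "f \<in> Homeo"
proof -
  obtain f' where f': "f' \<in> limits H" "f \<circ> f' = id" "f' \<circ> f = id" using limits_inverse[OF assms] .
  have "homeomorphism UNIV UNIV f f'"
    using limits_continuous[OF assms(1)] f' assms(2)
    by (intro homeomorphismI) (auto simp: fun_eq_iff)
  then show ?thesis unfolding Homeo_def by blast
qed

lemma subgroup_carrier: "subgroup (carrier \<Gamma>) \<Gamma>"
  using act_group by (rule group.subgroup_self)

text \<open>By \<open>level_uniform\<close> and \<open>level_small\<close> the levels and the metric
  define the same uniform structure.\<close>

lemma closure_eq_limits: "uniform_topology closure_of (\<Phi> ` carrier \<Gamma>) = limits (carrier \<Gamma>)"
proof -
  have "\<Phi> ` carrier \<Gamma> \<subseteq> Homeo" using homeo by blast
  note iff = in_closure_uniform_topology_iff[OF compact_UNIV this]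
  show ?thesis
  proof (intro subset_antisym subsetI)
    fix f assume "f \<in> uniform_topology closure_of (\<Phi> ` carrier \<Gamma>)"
    then have f: "\<forall>\<epsilon>>0. \<exists>g\<in>\<Phi> ` carrier \<Gamma>. \<forall>x. dist (f x) (g x) < \<epsilon>" unfolding iff by blast
    show "f \<in> limits (carrier \<Gamma>)" unfolding limits_def
    proof safe
      fix n
      obtain d where d: "d > 0" "\<And>x y. dist x y < d \<Longrightarrow> (x, y) \<in> level n" using level_uniform[of n] by blast
      obtain h where "h \<in> carrier \<Gamma>" "\<forall>x. dist (f x) (\<Phi> h x) < d" using f d(1) by blast
      then show "\<exists>h\<in>carrier \<Gamma>. near n f (\<Phi> h)" using d(2) unfolding near_def by blast
    qed
  next
    fix f assume f: "f \<in> limits (carrier \<Gamma>)"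
    show "f \<in> uniform_topology closure_of (\<Phi> ` carrier \<Gamma>)" unfolding iff
    proof (intro conjI allI impI)
      show "f \<in> Homeo" using subgroup_carrier f by (rule limits_Homeo)
      fix e :: real assume "e > 0"
      then obtain n where n: "\<And>x y. (x, y) \<in> level n \<Longrightarrow> dist x y < e" using level_small by blast
      obtain h where "h \<in> carrier \<Gamma>" "near n f (\<Phi> h)" using f by (rule limitsE)
      then show "\<exists>g\<in>\<Phi> ` carrier \<Gamma>. \<forall>x. dist (f x) (g x) < e" using n unfolding near_def by blast
    qed
  qed
qed

lemma closure_group_eq: "closure_group \<Gamma> \<Phi> = limit_group (carrier \<Gamma>)"
  unfolding closure_group_def limit_group_def closure_eq_limits ..

text \<open>The kernel of the action of \<open>limits H\<close> on the set of classes at level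
  \<open>n\<close>.\<close>

definition level_kernel :: "'a set \<Rightarrow> nat \<Rightarrow> ('c \<Rightarrow> 'c) set" where
  "level_kernel H n = {f \<in> limits H. near n f id}"

text \<open>Openness makes the orders of the level quotients contribute to the Steinitz
  order.\<close>

lemma openin_level_kernel:
  "openin (subtopology uniform_topology (carrier (closure_group \<Gamma> \<Phi>))) (level_kernel (carrier \<Gamma>) n)"
proof -
  obtain d where d: "d > 0" "\<And>x y. dist x y < d \<Longrightarrow> (x, y) \<in> level n" using level_uniform[of n] by blast
  show ?thesis unfolding closure_group_eq carrier_limit_group
  proof (rule openin_uniform_topologyI[OF compact_UNIV _ _ d(1)])
    show "limits (carrier \<Gamma>) \<subseteq> Homeo" using limits_Homeo[OF subgroup_carrier] by blast
    fix f g assume f: "f \<in> level_kernel (carrier \<Gamma>) n" and g: "g \<in> limits (carrier \<Gamma>)"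
      and "\<And>x. dist (f x) (g x) < d"
    then have "near n f g" using d(2) unfolding near_def by blast
    then show "g \<in> level_kernel (carrier \<Gamma>) n"
      using f g near_sym near_trans unfolding level_kernel_def by blast
  qed (auto simp: level_kernel_def)
qed

lemma normal_level_kernel:
  assumes H: "subgroup H \<Gamma>"
  shows "level_kernel H n \<lhd> limit_group H"
proof -
  interpret L: group "limit_group H" using H by (rule group_limit_group)
  note left = near_comp_left[OF _ subgroup.subset[OF H]]
  show ?thesis unfolding L.normal_inv_iff
  proof (intro conjI ballI L.subgroupI)
    show "level_kernel H n \<subseteq> carrier (limit_group H)" unfolding level_kernel_def by auto
    have "id \<in> limits H" using L.one_closed by simp
    then show "level_kernel H n \<noteq> {}" unfolding level_kernel_def by auto
  next
    fix f assume "f \<in> level_kernel H n"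
    then have f: "f \<in> limits H" "near n f id" unfolding level_kernel_def by auto
    have "near n (inv\<^bsub>limit_group H\<^esub> f \<circ> f) (inv\<^bsub>limit_group H\<^esub> f \<circ> id)"
      using f limit_group_inv[OF H f(1)] by (intro left)
    then show "inv\<^bsub>limit_group H\<^esub> f \<in> level_kernel H n"
      using limit_group_inv[OF H f(1)] near_sym unfolding level_kernel_def by simp
  next
    fix f g assume "f \<in> level_kernel H n" "g \<in> level_kernel H n"
    then have f: "f \<in> limits H" "near n f id" and g: "g \<in> limits H" "near n g id"
      unfolding level_kernel_def by auto
    have "near n (f \<circ> g) (f \<circ> id)" using f(1) g(2) by (rule left)
    then have "near n (f \<circ> g) id" using f(2) near_trans by simp
    then show "f \<otimes>\<^bsub>limit_group H\<^esub> g \<in> level_kernel H n"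
      using f g H limits_comp[OF H] unfolding level_kernel_def by simp
  next
    fix x h assume "x \<in> carrier (limit_group H)" "h \<in> level_kernel H n"
    then have x: "x \<in> limits H" and h: "h \<in> limits H" "near n h id" unfolding level_kernel_def by auto
    note i = limit_group_inv[OF H x]
    have "near n (x \<circ> (h \<circ> inv\<^bsub>limit_group H\<^esub> x)) (x \<circ> (id \<circ> inv\<^bsub>limit_group H\<^esub> x))"
      using x h(2) by (intro left near_comp_right)
    then have "near n (x \<circ> h \<circ> inv\<^bsub>limit_group H\<^esub> x) id" using i by (simp add: comp_assoc)
    then show "x \<otimes>\<^bsub>limit_group H\<^esub> h \<otimes>\<^bsub>limit_group H\<^esub> inv\<^bsub>limit_group H\<^esub> x \<in> level_kernel H n"
      using x h i H limits_comp[OF H] unfolding level_kernel_def by simp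
  qed
qed

lemma level_coset_eq_iff:
  assumes H: "subgroup H \<Gamma>" and f: "f \<in> limits H" and g: "g \<in> limits H"
  shows "level_kernel H n #>\<^bsub>limit_group H\<^esub> f = level_kernel H n #>\<^bsub>limit_group H\<^esub> g \<longleftrightarrow> near n f g"
proof -
  interpret K: normal "level_kernel H n" "limit_group H" using H by (rule normal_level_kernel)
  note i = limit_group_inv[OF H g]
  have fg: "f \<circ> inv\<^bsub>limit_group H\<^esub> g \<in> limits H" using H f i(1) by (rule limits_comp)
  have "level_kernel H n #>\<^bsub>limit_group H\<^esub> f = level_kernel H n #>\<^bsub>limit_group H\<^esub> g
      \<longleftrightarrow> f \<in> level_kernel H n #>\<^bsub>limit_group H\<^esub> g"
    using f g K.repr_independence[OF _ _ K.is_subgroup] K.rcos_self[OF _ K.is_subgroup]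
    by (metis carrier_limit_group)
  also have "\<dots> \<longleftrightarrow> f \<otimes>\<^bsub>limit_group H\<^esub> inv\<^bsub>limit_group H\<^esub> g \<in> level_kernel H n"
    using f g K.rcos_module[OF K.is_group, of g f] by simp
  also have "\<dots> \<longleftrightarrow> near n (f \<circ> inv\<^bsub>limit_group H\<^esub> g) id"
    using f i H fg unfolding level_kernel_def by simp
  also have "\<dots> \<longleftrightarrow> near n f g"
  proof
    assume "near n (f \<circ> inv\<^bsub>limit_group H\<^esub> g) id"
    then have "near n (f \<circ> inv\<^bsub>limit_group H\<^esub> g \<circ> g) (id \<circ> g)" by (rule near_comp_right)
    then show "near n f g" using i by (simp add: comp_assoc)
  next
    assume "near n f g"
    then have "near n (f \<circ> inv\<^bsub>limit_group H\<^esub> g) (g \<circ> inv\<^bsub>limit_group H\<^esub> g)" by (rule near_comp_right)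
    then show "near n (f \<circ> inv\<^bsub>limit_group H\<^esub> g) id" using i by simp
  qed
  finally show ?thesis .
qed

text \<open>A coset is determined by its action on the finitely many classes, which
  \<open>code\<close> records as a map between representatives.\<close>

lemma finite_level_quotient:
  assumes H: "subgroup H \<Gamma>"
  shows "finite (carrier (limit_group H Mod level_kernel H n))"
proof -
  let ?\<pi> = "\<lambda>f. level_kernel H n #>\<^bsub>limit_group H\<^esub> f"
  obtain R where R: "finite R" "\<forall>x. \<exists>r\<in>R. (r, x) \<in> level n" using level_finite by blast
  then obtain c where c: "\<And>x. c x \<in> R" "\<And>x. (c x, x) \<in> level n" by metis
  define code where "code f = restrict (c \<circ> f) R" for f
  have same: "near n f g" if f: "f \<in> limits H" and g: "g \<in> limits H" and eq: "code f = code g" for f g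
    unfolding near_def
  proof
    fix x
    obtain r where r: "r \<in> R" "(r, x) \<in> level n" using R(2) by blast
    have "c (f r) = c (g r)" using eq r(1) unfolding code_def by (metis comp_apply restrict_apply')
    then have "(f r, g r) \<in> level n" using c(2) level_sym level_trans by metis
    moreover have "(f r, f x) \<in> level n" "(g r, g x) \<in> level n"
      using limits_level[OF _ subgroup.subset[OF H] r(2)] f g by blast+
    ultimately show "(f x, g x) \<in> level n" using level_sym level_trans by blast
  qed
  have "code ` limits H \<subseteq> R \<rightarrow>\<^sub>E R" unfolding code_def using c(1) by auto
  then have fin: "finite (code ` limits H)" using R(1) by (meson finite_PiE finite_subset)
  have "?\<pi> ` limits H \<subseteq> (\<lambda>u. ?\<pi> (SOME f. f \<in> limits H \<and> code f = u)) ` (code ` limits H)"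
  proof
    fix y assume "y \<in> ?\<pi> ` limits H"
    then obtain f where f: "f \<in> limits H" "y = ?\<pi> f" by blast
    let ?g = "SOME g. g \<in> limits H \<and> code g = code f"
    have "?g \<in> limits H \<and> code ?g = code f" 
      by (rule someI[where x = f]) (simp add: f(1))
    then have "?\<pi> ?g = y" using level_coset_eq_iff[OF H] same f by metis
    then show "y \<in> (\<lambda>u. ?\<pi> (SOME f. f \<in> limits H \<and> code f = u)) ` (code ` limits H)"
      using f(1) by blast
  qed
  then have "finite (?\<pi> ` limits H)" using fin by (meson finite_imageI finite_subset)
  then show ?thesis by (simp add: carrier_FactGroup)
qed

lemma finite_quotients_limit_group:
  assumes H: "subgroup H \<Gamma>"
  shows "finite_quotients (limit_group H) (\<lambda>n. limit_group H Mod level_kernel H n)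
    (\<lambda>n f. level_kernel H n #>\<^bsub>limit_group H\<^esub> f)"
proof (intro finite_quotients.intro group_limit_group[OF H] finite_quotients_axioms.intro)
  fix n
  show "group_hom (limit_group H) (limit_group H Mod level_kernel H n) (\<lambda>f. level_kernel H n #>\<^bsub>limit_group H\<^esub> f)"
    using normal_level_kernel[OF H] by (rule normal.group_hom_Mod)
  show "(\<lambda>f. level_kernel H n #>\<^bsub>limit_group H\<^esub> f) ` carrier (limit_group H) = carrier (limit_group H Mod level_kernel H n)"
    by (simp add: carrier_FactGroup)
  show "finite (carrier (limit_group H Mod level_kernel H n))" using H by (rule finite_level_quotient)
next
  fix x y n
  assume "x \<in> carrier (limit_group H)" "y \<in> carrier (limit_group H)"
    "level_kernel H (Suc n) #>\<^bsub>limit_group H\<^esub> x = level_kernel H (Suc n) #>\<^bsub>limit_group H\<^esub> y"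
  then show "level_kernel H n #>\<^bsub>limit_group H\<^esub> x = level_kernel H n #>\<^bsub>limit_group H\<^esub> y"
    using near_antimono[of n "Suc n" x y] by (simp add: level_coset_eq_iff[OF H])
next
  fix x y
  assume "x \<in> carrier (limit_group H)" "y \<in> carrier (limit_group H)"
    "\<And>n. level_kernel H n #>\<^bsub>limit_group H\<^esub> x = level_kernel H n #>\<^bsub>limit_group H\<^esub> y"
  then show "x = y" by (intro near_separated) (simp add: level_coset_eq_iff[OF H])
next
  fix f
  assume f: "\<And>n. f n \<in> carrier (limit_group H)"
    "\<And>n. level_kernel H n #>\<^bsub>limit_group H\<^esub> f (Suc n) = level_kernel H n #>\<^bsub>limit_group H\<^esub> f n"
  then have "near n (f (Suc n)) (f n)" for n using level_coset_eq_iff[OF H] by simp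
  then obtain g where g: "\<And>n. near n g (f n)" using near_complete by blast
  have "g \<in> limits H" unfolding limits_def
  proof safe
    fix n
    have "f n \<in> limits H" using f(1) by simp
    then obtain h where "h \<in> H" "near n (f n) (\<Phi> h)" by (rule limitsE)
    then show "\<exists>h\<in>H. near n g (\<Phi> h)" using g near_trans by blast
  qed
  then show "\<exists>x\<in>carrier (limit_group H). \<forall>n. level_kernel H n #>\<^bsub>limit_group H\<^esub> x = level_kernel H n #>\<^bsub>limit_group H\<^esub> f n"
    using g f(1) level_coset_eq_iff[OF H] by (intro bexI[of _ g]) auto
qed

text \<open>Equality of cosets is nearness for both groups, so the quotient for \<open>H\<close>
  embeds into the quotient for \<Gamma>, and Lagrange's theorem applies. This carries the bound on
  multiplicities over to the closure of \<open>H\<close>.\<close>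

lemma order_level_quotient_dvd:
  assumes H: "subgroup H \<Gamma>"
  shows "order (limit_group H Mod level_kernel H n)
    dvd order (limit_group (carrier \<Gamma>) Mod level_kernel (carrier \<Gamma>) n)"
proof -
  let ?\<pi> = "\<lambda>H f. level_kernel H n #>\<^bsub>limit_group H\<^esub> f" and ?C = "carrier \<Gamma>"
  interpret \<pi>: group_hom "limit_group ?C" "limit_group ?C Mod level_kernel ?C n" "?\<pi> ?C"
    using normal_level_kernel[OF subgroup_carrier] by (rule normal.group_hom_Mod)
  have sub: "limits H \<subseteq> limits ?C" using subgroup.subset[OF H] by (rule limits_mono)
  have "subgroup (limits H) (limit_group ?C)"
    using group.subgroup_incl[OF group_BijGroup subgroup_limits[OF H] subgroup_limits[OF subgroup_carrier] sub]
    unfolding limit_group_def .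
  then have "subgroup (?\<pi> ?C ` limits H) (limit_group ?C Mod level_kernel ?C n)"
    by (rule \<pi>.subgroup_img_is_subgroup)
  then have "card (?\<pi> ?C ` limits H) dvd order (limit_group ?C Mod level_kernel ?C n)"
    using \<pi>.H.lagrange by (metis dvd_triv_right)
  moreover have "bij_betw (\<lambda>u. ?\<pi> ?C (SOME f. f \<in> limits H \<and> ?\<pi> H f = u)) (?\<pi> H ` limits H) (?\<pi> ?C ` limits H)"
  proof -
    have eq: "?\<pi> ?C f = ?\<pi> ?C g \<longleftrightarrow> ?\<pi> H f = ?\<pi> H g" if "f \<in> limits H" "g \<in> limits H" for f g
      using level_coset_eq_iff[OF H that] level_coset_eq_iff[OF subgroup_carrier, of f g n] that sub by blast
    have some: "(SOME f. f \<in> limits H \<and> ?\<pi> H f = ?\<pi> H g) \<in> limits H \<and>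
        ?\<pi> H (SOME f. f \<in> limits H \<and> ?\<pi> H f = ?\<pi> H g) = ?\<pi> H g" if "g \<in> limits H" for g
      by (rule someI[of _ g]) (simp add: that)
    then have val: "?\<pi> ?C (SOME f. f \<in> limits H \<and> ?\<pi> H f = ?\<pi> H g) = ?\<pi> ?C g" if "g \<in> limits H" for g
      using eq that by blast
    show ?thesis unfolding bij_betw_def
    proof
      show "inj_on (\<lambda>u. ?\<pi> ?C (SOME f. f \<in> limits H \<and> ?\<pi> H f = u)) (?\<pi> H ` limits H)"
        by (rule inj_onI) (auto simp: val eq)
      show "(\<lambda>u. ?\<pi> ?C (SOME f. f \<in> limits H \<and> ?\<pi> H f = u)) ` (?\<pi> H ` limits H) = ?\<pi> ?C ` limits H"
        unfolding image_image using val by (intro image_cong) auto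
    qed
  qed
  ultimately show ?thesis
    by (simp add: order_def carrier_FactGroup bij_betw_same_card)
qed

end


section \<open>Pointwise fixers\<close>

text \<open>If each \<open>r\<close> failed at some index, all of them would fail at the largest of
  these indices.\<close>

lemma finite_choice_antimono:
  fixes P :: "nat \<Rightarrow> 'r \<Rightarrow> bool"
  assumes "finite R" "\<And>m. \<exists>r\<in>R. P m r" "\<And>m n r. m \<le> n \<Longrightarrow> P n r \<Longrightarrow> P m r"
  shows "\<exists>r\<in>R. \<forall>m. P m r"
proof (rule ccontr)
  assume "\<not> (\<exists>r\<in>R. \<forall>m. P m r)"
  then obtain k where k: "\<And>r. r \<in> R \<Longrightarrow> \<not> P (k r) r" by metis
  obtain r where r: "r \<in> R" "P (Max (k ` R)) r" using assms(2) by blast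
  have "k r \<le> Max (k ` R)" using assms(1) r(1) by simp
  then show False using assms(3) r k by blast
qed

text \<open>A finite form of Baire's theorem: closed sets with empty interior are joined one at a
  time without creating interior.\<close>

lemma finite_closed_cover_interior:
  assumes "finite R" "\<And>r. r \<in> R \<Longrightarrow> closed (C r)" "(\<Union>r\<in>R. C r) = (UNIV :: 'x::topological_space set)"
  shows "\<exists>r\<in>R. interior (C r) \<noteq> {}"
proof (rule ccontr)
  assume "\<not> (\<exists>r\<in>R. interior (C r) \<noteq> {})"
  then have "\<And>r. r \<in> R \<Longrightarrow> interior (C r) = {}" by blast
  with assms(1,2) have "interior (\<Union>r\<in>R. C r) = {}"
  proof (induction R rule: finite_induct)
    case (insert r R)
    have "interior (C r \<union> (\<Union>r\<in>R. C r)) = interior (C r)"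
      using insert by (intro interior_closed_Un_empty_interior) auto
    then show ?case using insert.prems(2) by simp
  qed simp
  then show False using assms(3) by simp
qed

lemma (in group) finite_coset_representatives:
  assumes H: "subgroup H G" and fin: "finite (rcosets H)"
  obtains R where "finite R" "R \<subseteq> carrier G" "\<forall>g\<in>carrier G. \<exists>r\<in>R. g \<otimes> inv r \<in> H"
proof -
  define rep where "rep C = (SOME r. r \<in> C)" for C :: "'a set"
  have rep: "rep (H #> g) \<in> H #> g" if "g \<in> carrier G" for g
    unfolding rep_def using rcos_self[OF that H] by (rule someI)
  show ?thesis
  proof (rule that[of "rep ` (rcosets H)"], safe)
    show "finite (rep ` (rcosets H))" using fin by simp
    fix C assume "C \<in> rcosets H"
    then show "rep C \<in> carrier G"
      using rep r_coset_subset_G[OF subgroup.subset[OF H]] unfolding RCOSETS_def by blast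
  next
    fix g assume g: "g \<in> carrier G"
    let ?r = "rep (H #> g)"
    have r: "?r \<in> carrier G" using rep[OF g] r_coset_subset_G[OF subgroup.subset[OF H] g] by blast
    have "H #> g = H #> ?r" using repr_independence[OF rep[OF g] g H] .
    then have "g \<in> H #> ?r" using rcos_self[OF g H] by simp
    then have "g \<otimes> inv ?r \<in> H" using subgroup.rcos_module[OF H is_group r g] by simp
    then show "\<exists>r\<in>rep ` (rcosets H). g \<otimes> inv r \<in> H"
      using rcosetsI[OF subgroup.subset[OF H] g] by blast
  qed
qed

section \<open>Orbit closures, fixers at a base point, and passage to finite index\<close>

context equicontinuous_cantor_action
begin

lemma minimal_level: "\<exists>g\<in>carrier \<Gamma>. (y, \<Phi> g x) \<in> level n"
proof -
  have "level n `` {y} \<inter> closure (orbit \<Gamma> \<Phi> x) \<noteq> {}" using minimal level_refl by blast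
  then have "level n `` {y} \<inter> orbit \<Gamma> \<Phi> x \<noteq> {}"
    using open_Int_closure_eq_empty[OF level_class_open] by blast
  then show ?thesis unfolding orbit_def by blast
qed

text \<open>\<open>Y\<close> is the closure of the \<open>H\<close>-orbit of \<open>x\<close>. By
  minimality finitely many translates of it cover the space, so one has interior points, and so has
  \<open>Y\<close>. A class inside \<open>Y\<close> meets the orbit, and an element of
  \<open>H\<close> moves it to the class of \<open>x\<close>.\<close>

lemma orbit_closure_neighbourhood:
  assumes H: "subgroup H \<Gamma>" and fin: "finite (rcosets H)"
  obtains n where "\<And>y m. (x, y) \<in> level n \<Longrightarrow> \<exists>h\<in>H. (y, \<Phi> h x) \<in> level m"
proof -
  interpret G: group \<Gamma> by (rule act_group)
  note HG = subgroup.mem_carrier[OF H]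
  define Y where "Y = {y. \<forall>m. \<exists>h\<in>H. (y, \<Phi> h x) \<in> level m}"
  have "open (- Y)"
  proof (subst open_subopen, intro ballI)
    fix y assume "y \<in> - Y"
    then obtain m where m: "\<And>h. h \<in> H \<Longrightarrow> (y, \<Phi> h x) \<notin> level m" unfolding Y_def by blast
    have "level m `` {y} \<subseteq> - Y"
    proof
      fix z assume "z \<in> level m `` {y}"
      then have "\<And>h. h \<in> H \<Longrightarrow> (z, \<Phi> h x) \<notin> level m" using m level_trans by blast
      then show "z \<in> - Y" unfolding Y_def by blast
    qed
    then show "\<exists>T. open T \<and> y \<in> T \<and> T \<subseteq> - Y" using level_class_open[of m y] level_refl by blast
  qed
  then have Y: "closed Y" by (simp add: closed_def)
  have Ymult: "\<Phi> (inv h) y \<in> Y" if y: "y \<in> Y" and h: "h \<in> H" for h y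
    unfolding Y_def
  proof safe
    fix m
    obtain k where k: "k \<in> H" "(y, \<Phi> k x) \<in> level m" using y unfolding Y_def by blast
    have "(\<Phi> (inv h) y, \<Phi> (inv h) (\<Phi> k x)) \<in> level m" using k(2) HG[OF h] by (intro level_act) auto
    then have "(\<Phi> (inv h) y, \<Phi> (inv h \<otimes> k) x) \<in> level m" using HG[OF h] HG[OF k(1)] by (simp add: act_mult)
    then show "\<exists>k\<in>H. (\<Phi> (inv h) y, \<Phi> k x) \<in> level m"
      using subgroup.m_closed[OF H subgroup.m_inv_closed[OF H h] k(1)] by blast
  qed
  obtain R where R': "finite R" "R \<subseteq> carrier \<Gamma>" "\<forall>g\<in>carrier \<Gamma>. \<exists>r\<in>R. g \<otimes> inv r \<in> H"
    using G.finite_coset_representatives[OF H fin] .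
  note R = R'(1,2) R'(3)[rule_format]
  have cover: "(\<Union>r\<in>R. \<Phi> r -` Y) = UNIV"
  proof -
    have "\<exists>r\<in>R. \<forall>m. \<exists>h\<in>H. (\<Phi> r y, \<Phi> h x) \<in> level m" for y
    proof (rule finite_choice_antimono[OF R(1)])
      fix m
      obtain g where g: "g \<in> carrier \<Gamma>" "(y, \<Phi> g x) \<in> level m" using minimal_level by blast
      \<comment> \<open>The representatives are those of right cosets; applying them to
        \<open>inv g\<close> gives \<open>r \<otimes> g \<in> H\<close>, so that
        \<open>\<Phi> r y\<close> is close to the \<open>H\<close>-orbit.\<close>
      then obtain r where r: "r \<in> R" "inv g \<otimes> inv r \<in> H" using R(3)[of "inv g"] by auto
      then have rG: "r \<in> carrier \<Gamma>" using R(2) by blast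
      have "inv (inv g \<otimes> inv r) \<in> H" using subgroup.m_inv_closed[OF H r(2)] .
      then have "r \<otimes> g \<in> H" using g(1) rG by (simp add: G.inv_mult_group)
      moreover have "(\<Phi> r y, \<Phi> (r \<otimes> g) x) \<in> level m" using level_act[OF g(2) rG] g(1) rG by (simp add: act_mult)
      ultimately show "\<exists>r\<in>R. \<exists>h\<in>H. (\<Phi> r y, \<Phi> h x) \<in> level m" using r(1) by blast
    next
      fix m n r assume "m \<le> n" "\<exists>h\<in>H. (\<Phi> r y, \<Phi> h x) \<in> level n"
      then show "\<exists>h\<in>H. (\<Phi> r y, \<Phi> h x) \<in> level m" using level_antimono by blast
    qed
    then have "\<exists>r\<in>R. \<Phi> r y \<in> Y" for y unfolding Y_def by simp
    then show ?thesis by auto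
  qed
  have "closed (\<Phi> r -` Y)" if r: "r \<in> R" for r
  proof -
    have "\<Phi> r \<in> limits (carrier \<Gamma>)" using r R(2) by (intro act_in_limits) blast
    then show ?thesis using Y limits_continuous[OF subgroup_carrier] by (intro closed_vimage) auto
  qed
  then obtain r where r: "r \<in> R" "interior (\<Phi> r -` Y) \<noteq> {}"
    using finite_closed_cover_interior[OF R(1) _ cover] by blast
  have rG: "r \<in> carrier \<Gamma>" using r(1) R(2) by blast
  obtain w where w: "w \<in> interior (\<Phi> r -` Y)" using r(2) by blast
  obtain n where n: "level n `` {w} \<subseteq> interior (\<Phi> r -` Y)"
    using level_neighbourhood[OF open_interior w] by metis
  have 1: "v \<in> Y" if v: "(\<Phi> r w, v) \<in> level n" for v
  proof -
    have "(w, \<Phi> (inv r) v) \<in> level n" using level_act[OF v, of "inv r"] rG by simp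
    then have "\<Phi> (inv r) v \<in> \<Phi> r -` Y" using n interior_subset by blast
    then show ?thesis using rG by simp
  qed
  have "\<Phi> r w \<in> Y" using 1 by simp
  then obtain h where h: "h \<in> H" "(\<Phi> r w, \<Phi> h x) \<in> level n" unfolding Y_def by blast
  have "y \<in> Y" if y: "(x, y) \<in> level n" for y
  proof -
    have "(\<Phi> r w, \<Phi> h y) \<in> level n" using level_trans[OF h(2) level_act[OF y HG[OF h(1)]]] .
    then have "\<Phi> h y \<in> Y" by (rule 1)
    then have "\<Phi> (inv h) (\<Phi> h y) \<in> Y" using h(1) by (rule Ymult)
    then show ?thesis using HG[OF h(1)] by simp
  qed
  then show ?thesis using that[of n] unfolding Y_def by blast
qed

definition fixer :: "'a set \<Rightarrow> 'c \<Rightarrow> nat \<Rightarrow> ('c \<Rightarrow> 'c) set" where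
  "fixer H x n = {f \<in> limits H. \<forall>y\<in>level n `` {x}. f y = y}"

lemma fixer_mono: "m \<le> n \<Longrightarrow> fixer H x m \<subseteq> fixer H x n"
  unfolding fixer_def using level_antimono by blast

lemma fixer_inverse:
  assumes "subgroup H \<Gamma>" "f \<in> fixer H x n" "f' \<in> limits H" "f' \<circ> f = id"
  shows "f' \<in> fixer H x n"
proof -
  have "f' y = y" if "y \<in> level n `` {x}" for y
  proof -
    have "f y = y" using assms(2) that unfolding fixer_def by blast
    moreover have "f' (f y) = y" using assms(4) by (simp add: fun_eq_iff)
    ultimately show ?thesis by simp
  qed
  then show ?thesis using assms(3) unfolding fixer_def by blast
qed

lemma fixer_comp:
  assumes "subgroup H \<Gamma>" "f \<in> fixer H x n" "g \<in> fixer H x n"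
  shows "f \<circ> g \<in> fixer H x n"
  using assms limits_comp unfolding fixer_def by auto

lemma subgroup_fixer:
  assumes H: "subgroup H \<Gamma>"
  shows "subgroup (fixer H x n) (limit_group H)"
proof (rule group.subgroupI[OF group_limit_group[OF H]])
  interpret L: group "limit_group H" using H by (rule group_limit_group)
  show "fixer H x n \<subseteq> carrier (limit_group H)" unfolding fixer_def by auto
  have "id \<in> limits H" using L.one_closed by simp
  then have "id \<in> fixer H x n" unfolding fixer_def by auto
  then show "fixer H x n \<noteq> {}" by blast
next
  fix f assume f: "f \<in> fixer H x n"
  then have "f \<in> limits H" unfolding fixer_def by blast
  then show "inv\<^bsub>limit_group H\<^esub> f \<in> fixer H x n"
    using limit_group_inv[OF H] by (intro fixer_inverse[OF H f]) auto
next
  fix f g assume fg: "f \<in> fixer H x n" "g \<in> fixer H x n"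
  then have "f \<in> limits H" "g \<in> limits H" unfolding fixer_def by auto
  then show "f \<otimes>\<^bsub>limit_group H\<^esub> g \<in> fixer H x n" using fixer_comp[OF H fg] H by simp
qed

text \<open>A central element that fixes \<open>x\<close> fixes the closure of the orbit of \<open>x\<close>.\<close>

lemma central_in_fixer:
  assumes H: "subgroup H \<Gamma>" and z: "z \<in> fixer H x m"
    and central: "\<And>f. f \<in> limits H \<Longrightarrow> z \<circ> f = f \<circ> z"
    and n: "\<And>y m. (x, y) \<in> level n \<Longrightarrow> \<exists>h\<in>H. (y, \<Phi> h x) \<in> level m"
  shows "z \<in> fixer H x n"
proof -
  have zL: "z \<in> limits H" and zx: "z x = x" using z unfolding fixer_def by auto
  have "z y = y" if y: "(x, y) \<in> level n" for y
  proof (rule level_separated)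
    fix m
    obtain h where h: "h \<in> H" "(y, \<Phi> h x) \<in> level m" using n[OF y] by blast
    have "z (\<Phi> h x) = \<Phi> h x" using central[OF act_in_limits[OF h(1)]] zx by (metis comp_apply)
    then have "(z y, \<Phi> h x) \<in> level m"
      using limits_level[OF zL subgroup.subset[OF H] h(2)] by simp
    then show "(z y, y) \<in> level m" using h(2) level_sym level_trans by blast
  qed
  then show ?thesis using zL unfolding fixer_def by blast
qed

lemma fixer_stationary_subgroup:
  assumes H: "subgroup H \<Gamma>" and fin: "finite (rcosets H)"
    and fg: "finitely_generated_group (\<Gamma>\<lparr>carrier := H\<rparr>)" and nil: "nilpotent_group (\<Gamma>\<lparr>carrier := H\<rparr>)"
    and S: "finite S" "\<And>n p. prime p \<Longrightarrow> p \<notin> S \<Longrightarrow>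
      \<not> p ^ 3 dvd order (limit_group (carrier \<Gamma>) Mod level_kernel (carrier \<Gamma>) n)"
  shows "\<exists>n0. \<forall>n\<ge>n0. fixer H x n = fixer H x n0"
proof -
  let ?\<Delta> = "\<Gamma>\<lparr>carrier := H\<rparr>" and ?\<pi> = "\<lambda>n f. level_kernel H n #>\<^bsub>limit_group H\<^esub> f"
  have \<Delta>: "group ?\<Delta>" using fg unfolding finitely_generated_group_def by blast
  note HG = subgroup.mem_carrier[OF H]
  interpret F: finite_quotients "limit_group H" "\<lambda>n. limit_group H Mod level_kernel H n" ?\<pi>
    using H by (rule finite_quotients_limit_group)
  have hom: "group_hom ?\<Delta> (limit_group H) \<Phi>"
    using \<Delta> F.is_group H act_in_limits HG
    by (intro group_hom.intro group_hom_axioms.intro homI) (auto simp: act_mult fun_eq_iff)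
  interpret D: finite_quotients_dense_hom ?\<Delta> "limit_group H" \<Phi> "\<lambda>n. limit_group H Mod level_kernel H n" ?\<pi>
  proof (intro finite_quotients_dense_hom.intro hom F.finite_quotients_axioms finite_quotients_dense_hom_axioms.intro)
    fix f n assume "f \<in> carrier (limit_group H)"
    then have f: "f \<in> limits H" by simp
    obtain h where "h \<in> H" "near n f (\<Phi> h)" using f by (rule limitsE)
    then show "\<exists>d\<in>carrier ?\<Delta>. ?\<pi> n f = ?\<pi> n (\<Phi> d)"
      using level_coset_eq_iff[OF H f act_in_limits] by auto
  qed
  obtain n1 where n1: "\<And>y m. (x, y) \<in> level n1 \<Longrightarrow> \<exists>h\<in>H. (y, \<Phi> h x) \<in> level m"
    using orbit_closure_neighbourhood[OF H fin, of x] by blast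
  \<comment> \<open>The chain starts at \<open>n1\<close> because there the class of
    \<open>x\<close> is contained in the closure of its \<open>H\<close>-orbit; central elements of
    any later fixer therefore belong to the first one.\<close>
  have "\<exists>k0. \<forall>k\<ge>k0. fixer H x (n1 + k) = fixer H x (n1 + k0)"
  proof (rule D.closed_subgroup_chain_stationary[OF _ S(1)])
    show "central_cyclic_series ?\<Delta> (carrier ?\<Delta>)"
      using \<Delta> fg nil by (rule group.finitely_generated_nilpotent_central_cyclic_series)
    show "\<not> p ^ 3 dvd order (limit_group H Mod level_kernel H n)" if "prime p" "p \<notin> S" for n p
      using S(2)[OF that, of n] order_level_quotient_dvd[OF H, of n] dvd_trans by blast
    show "subgroup (fixer H x (n1 + k)) (limit_group H)" for k using H by (rule subgroup_fixer)
    show "fixer H x (n1 + k) \<subseteq> fixer H x (n1 + l)" if "k \<le> l" for k l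
      using that by (intro fixer_mono) simp
    show "F.closure_set (fixer H x (n1 + k)) \<subseteq> fixer H x (n1 + k)" for k
    proof
      fix f assume f: "f \<in> F.closure_set (fixer H x (n1 + k))"
      then have fL: "f \<in> limits H" unfolding F.closure_set_def by simp
      have "f y = y" if y: "y \<in> level (n1 + k) `` {x}" for y
      proof (rule level_separated)
        fix m
        obtain a where a: "a \<in> fixer H x (n1 + k)" "?\<pi> m f = ?\<pi> m a"
          using f unfolding F.closure_set_def by blast
        have "a \<in> limits H" "a y = y" using a(1) y unfolding fixer_def by auto
        moreover from this have "near m f a" using level_coset_eq_iff[OF H fL] a(2) by blast
        ultimately show "(f y, y) \<in> level m" unfolding near_def by metis
      qed
      then show "f \<in> fixer H x (n1 + k)" using fL unfolding fixer_def by blast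
    qed
    fix k z assume z: "z \<in> fixer H x (n1 + k)"
      and central: "\<And>f. f \<in> carrier (limit_group H) \<Longrightarrow> z \<otimes>\<^bsub>limit_group H\<^esub> f = f \<otimes>\<^bsub>limit_group H\<^esub> z"
    have "z \<in> limits H" using z unfolding fixer_def by blast
    then have "z \<circ> f = f \<circ> z" if "f \<in> limits H" for f using central[of f] that H by simp
    then show "z \<in> fixer H x (n1 + 0)" using central_in_fixer[OF H z _ n1] by simp
  qed
  then obtain k0 where k0: "\<And>k. k \<ge> k0 \<Longrightarrow> fixer H x (n1 + k) = fixer H x (n1 + k0)" by blast
  have "fixer H x n = fixer H x (n1 + k0)" if "n \<ge> n1 + k0" for n
    using k0[of "n - n1"] that by simp
  then show ?thesis by blast
qed

text \<open>The closure of \<Gamma> is a finite union of translates of the closure of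
  \<open>H\<close>: every approximation of \<open>f\<close> lies in one of finitely many cosets, and
  a single coset serves all levels.\<close>

lemma limits_coset:
  assumes H: "subgroup H \<Gamma>" and R: "finite R" "R \<subseteq> carrier \<Gamma>"
    "\<forall>g\<in>carrier \<Gamma>. \<exists>r\<in>R. g \<otimes> inv r \<in> H"
    and f: "f \<in> limits (carrier \<Gamma>)"
  shows "\<exists>r\<in>R. f \<circ> \<Phi> (inv r) \<in> limits H"
proof -
  have "\<exists>r\<in>R. \<forall>m. \<exists>h\<in>H. near m (f \<circ> \<Phi> (inv r)) (\<Phi> h)"
  proof (rule finite_choice_antimono[OF R(1)])
    fix m
    obtain g where g: "g \<in> carrier \<Gamma>" "near m f (\<Phi> g)" using f by (rule limitsE)
    obtain r where r: "r \<in> R" "g \<otimes> inv r \<in> H" using R(3) g(1) by blast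
    have "inv r \<in> carrier \<Gamma>" using r(1) R(2) act_group by (auto simp: group.inv_closed)
    then have "\<Phi> g \<circ> \<Phi> (inv r) = \<Phi> (g \<otimes> inv r)" using act_mult[OF g(1)] by (simp add: fun_eq_iff)
    then show "\<exists>r\<in>R. \<exists>h\<in>H. near m (f \<circ> \<Phi> (inv r)) (\<Phi> h)"
      using r near_comp_right[OF g(2)] by metis
  next
    fix m n r assume "m \<le> n" "\<exists>h\<in>H. near n (f \<circ> \<Phi> (inv r)) (\<Phi> h)"
    then show "\<exists>h\<in>H. near m (f \<circ> \<Phi> (inv r)) (\<Phi> h)" using near_antimono by blast
  qed
  then show ?thesis unfolding limits_def by blast
qed

text \<open>The increasing fixers meet each of the finitely many cosets of the closure of
  \<open>H\<close> from some level on, or never. Beyond these levels an element of a fixer differs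
  by an element of \<open>fixer (carrier \<Gamma>) x n0\<close> from one in the closure of
  \<open>H\<close>, where the chain is stationary.\<close>

lemma fixer_stationary:
  assumes H: "subgroup H \<Gamma>" and fin: "finite (rcosets H)"
    and stat: "\<exists>n0. \<forall>n\<ge>n0. fixer H x n = fixer H x n0"
  shows "\<exists>n0. \<forall>n\<ge>n0. fixer (carrier \<Gamma>) x n = fixer (carrier \<Gamma>) x n0"
proof -
  let ?C = "carrier \<Gamma>"
  interpret G: group \<Gamma> by (rule act_group)
  obtain R where R: "finite R" "R \<subseteq> ?C" "\<forall>g\<in>?C. \<exists>r\<in>R. g \<otimes> inv r \<in> H"
    using G.finite_coset_representatives[OF H fin] .
  obtain n1 where n1: "\<And>n. n \<ge> n1 \<Longrightarrow> fixer H x n = fixer H x n1" using stat by blast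
  define hit where "hit r n \<longleftrightarrow> (\<exists>f\<in>fixer ?C x n. f \<circ> \<Phi> (inv r) \<in> limits H)" for r n
  have hit_mono: "hit r n" if "m \<le> n" "hit r m" for r m n
    using that fixer_mono[OF that(1)] unfolding hit_def by blast
  \<comment> \<open>For a coset that is never hit this value is arbitrary and at most enlarges the
    maximum \<open>n0\<close>.\<close>
  define k where "k r = (SOME n. hit r n)" for r
  have k: "hit r (k r)" if "hit r n" for r n unfolding k_def using that by (rule someI)
  define n0 where "n0 = Max (insert n1 (k ` R))"
  have n0: "n1 \<le> n0" "\<And>r. r \<in> R \<Longrightarrow> k r \<le> n0" unfolding n0_def using R(1) by auto
  have "fixer ?C x n \<subseteq> fixer ?C x n0" if n: "n \<ge> n0" for n
  proof
    fix f assume f: "f \<in> fixer ?C x n"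
    then have fL: "f \<in> limits ?C" unfolding fixer_def by blast
    obtain r where r: "r \<in> R" "f \<circ> \<Phi> (inv r) \<in> limits H" using limits_coset[OF H R fL] by blast
    then have "hit r n0" using k[of r n] hit_mono[OF n0(2)[OF r(1)]] f unfolding hit_def by blast
    then obtain g where g: "g \<in> fixer ?C x n0" "g \<circ> \<Phi> (inv r) \<in> limits H" unfolding hit_def by blast
    have gL: "g \<in> limits ?C" using g(1) unfolding fixer_def by blast
    obtain g' where g': "g' \<in> limits ?C" "g \<circ> g' = id" "g' \<circ> g = id"
      using limits_inverse[OF subgroup_carrier gL] .
    obtain q where q: "q \<in> limits H" "g \<circ> \<Phi> (inv r) \<circ> q = id" "q \<circ> (g \<circ> \<Phi> (inv r)) = id"
      using limits_inverse[OF H g(2)] .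
    have "\<Phi> (inv r) \<circ> q = g'"
    proof -
      have "\<Phi> (inv r) \<circ> q = g' \<circ> g \<circ> (\<Phi> (inv r) \<circ> q)" using g' by simp
      also have "\<dots> = g' \<circ> (g \<circ> \<Phi> (inv r) \<circ> q)" by (simp add: comp_assoc)
      finally show ?thesis using q by simp
    qed
    then have "f \<circ> g' = f \<circ> \<Phi> (inv r) \<circ> q" by (simp add: comp_assoc)
    then have fg'H: "f \<circ> g' \<in> limits H" using limits_comp[OF H r(2) q(1)] by simp
    have "g' \<in> fixer ?C x n0" using subgroup_carrier g(1) g'(1,3) by (rule fixer_inverse)
    then have "g' \<in> fixer ?C x n" using fixer_mono[OF n] by blast
    then have "f \<circ> g' \<in> fixer ?C x n" using fixer_comp[OF subgroup_carrier f] by blast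
    then have "f \<circ> g' \<in> fixer H x n" using fg'H unfolding fixer_def by blast
    then have "f \<circ> g' \<in> fixer H x n0" using n1[of n] n1[of n0] n0(1) n by simp
    then have "f \<circ> g' \<in> fixer ?C x n0"
      using limits_mono[OF subgroup.subset[OF H]] unfolding fixer_def by blast
    then have "f \<circ> g' \<circ> g \<in> fixer ?C x n0" using fixer_comp[OF subgroup_carrier _ g(1)] by blast
    then show "f \<in> fixer ?C x n0" using g' by (simp add: comp_assoc)
  qed
  then have "\<forall>n\<ge>n0. fixer ?C x n = fixer ?C x n0" using fixer_mono by blast
  then show ?thesis by blast
qed

text \<open>By minimality, \<open>\<Gamma>\<close> moves the class of any point to the class of the base point.\<close>

lemma stable_if_fixer_stationary:
  assumes stat: "\<exists>n0. \<forall>n\<ge>n0. fixer (carrier \<Gamma>) x n = fixer (carrier \<Gamma>) x n0"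
  shows "stable_action \<Gamma> \<Phi>"
proof -
  let ?C = "carrier \<Gamma>"
  obtain n where n: "\<And>m. m \<ge> n \<Longrightarrow> fixer ?C x m = fixer ?C x n" using stat by blast
  \<comment> \<open>A set of diameter below \<open>\<epsilon>\<close> lies in a single class at
    level \<open>n\<close>; this is the constant of local quasi-analyticity.\<close>
  obtain \<epsilon> where \<epsilon>: "\<epsilon> > 0" "\<And>y z. dist y z < \<epsilon> \<Longrightarrow> (y, z) \<in> level n" using level_uniform[of n] by blast
  have key: "g u = u"
    if U: "diameter U < \<epsilon>" "u \<in> U" and V: "open V" "V \<noteq> {}" "V \<subseteq> U"
      and g: "g \<in> limits ?C" "\<And>v. v \<in> V \<Longrightarrow> g v = v" for U V g u
  proof -
    obtain y where y: "y \<in> V" using V(2) by blast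
    have "bounded U" using bounded_subset[OF compact_imp_bounded[OF compact_UNIV]] by simp
    then have "dist y u \<le> diameter U" using U(2) y V(3) by (intro diameter_bounded_bound) auto
    then have yu: "(y, u) \<in> level n" using U(1) by (intro \<epsilon>(2)) simp
    obtain m where m: "m \<ge> n" "level m `` {y} \<subseteq> V" using level_neighbourhood[OF V(1) y] .
    obtain a where a: "a \<in> ?C" "(y, \<Phi> a x) \<in> level m" using minimal_level by blast
    have ia: "inv a \<in> ?C" using a(1) act_group by (simp add: group.inv_closed)
    \<comment> \<open>The conjugate fixes the class of \<open>x\<close> at level \<open>m\<close>,
      hence by stationarity the one at level \<open>n\<close>; moved back by \<open>a\<close>, the
      latter contains \<open>U\<close>.\<close>
    define f where "f = \<Phi> (inv a) \<circ> g \<circ> \<Phi> a"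
    have fL: "f \<in> limits ?C" unfolding f_def
      using limits_comp[OF subgroup_carrier] act_in_limits a(1) ia g(1) by metis
    have "f z = z" if z: "(x, z) \<in> level m" for z
    proof -
      have "(y, \<Phi> a z) \<in> level m" using level_trans[OF a(2) level_act[OF z a(1)]] .
      then have "g (\<Phi> a z) = \<Phi> a z" using m(2) g(2) by blast
      then show ?thesis unfolding f_def using a(1) by simp
    qed
    then have "f \<in> fixer ?C x m" using fL unfolding fixer_def by blast
    then have f: "f \<in> fixer ?C x n" using n[OF m(1)] by simp
    have "(\<Phi> a x, u) \<in> level n"
      using level_trans[OF level_sym[OF level_antimono[OF m(1) a(2)]] yu] .
    then have "(x, \<Phi> (inv a) u) \<in> level n" using level_act[OF _ ia] a(1) by fastforce
    then have "f (\<Phi> (inv a) u) = \<Phi> (inv a) u" using f unfolding fixer_def by blast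
    then have "\<Phi> a (\<Phi> (inv a) (g u)) = \<Phi> a (\<Phi> (inv a) u)" unfolding f_def using a(1) by simp
    then show ?thesis using a(1) by simp
  qed
  show ?thesis
    unfolding stable_action_def locally_quasi_analytic_def closure_group_eq carrier_limit_group
  proof (intro exI[of _ \<epsilon>] conjI allI impI ballI)
    fix U V g u
    assume UV: "open U \<and> U \<noteq> {} \<and> diameter U < \<epsilon> \<and> open V \<and> V \<noteq> {} \<and> V \<subseteq> U"
      and g: "g \<in> limits ?C" and V: "g ` V = V \<and> (\<forall>v\<in>V. g v = v)" and u: "u \<in> U"
    show "g u = u" by (rule key[of U u V g]) (use UV V g u in blast)+
  qed (rule \<epsilon>(1))
qed

text \<open>The supremum bounds the multiplicity of \<open>p\<close> in the order of each level
  quotient. That order is nonzero by finiteness, so its multiplicity does reflect divisibility by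
  powers of \<open>p\<close>.\<close>

lemma order_level_quotient_small:
  assumes "prime p" "steinitz_order uniform_topology (closure_group \<Gamma> \<Phi>) p \<le> 2"
  shows "\<not> p ^ 3 dvd order (limit_group (carrier \<Gamma>) Mod level_kernel (carrier \<Gamma>) n)"
proof
  let ?L = "limit_group (carrier \<Gamma>)" and ?K = "level_kernel (carrier \<Gamma>) n"
  assume dvd: "p ^ 3 dvd order (?L Mod ?K)"
  have pos: "order (?L Mod ?K) \<noteq> 0"
    using finite_level_quotient[OF subgroup_carrier, of n] finite_quotients.order_quotient_pos[OF finite_quotients_limit_group[OF subgroup_carrier]]
    by (metis less_irrefl)
  have "?K \<lhd> closure_group \<Gamma> \<Phi>" unfolding closure_group_eq using subgroup_carrier by (rule normal_level_kernel)
  then have "steinitz_of_nat (order (closure_group \<Gamma> \<Phi> Mod ?K)) p \<le> steinitz_order uniform_topology (closure_group \<Gamma> \<Phi>) p"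
    unfolding steinitz_order_def steinitz_LCM_def using openin_level_kernel by (intro SUP_upper) blast
  then have "steinitz_of_nat (order (closure_group \<Gamma> \<Phi> Mod ?K)) p \<le> 2"
    using assms(2) by (rule order_trans)
  then have "enat (multiplicity p (order (?L Mod ?K))) \<le> enat 2"
    using assms(1) unfolding closure_group_eq steinitz_of_nat_def by (simp add: numeral_eq_enat)
  then have "multiplicity p (order (?L Mod ?K)) \<le> 2" by simp
  moreover have "3 \<le> multiplicity p (order (?L Mod ?K))"
    using dvd pos assms(1) not_prime_unit by (intro multiplicity_geI) blast+
  ultimately show False by simp
qed

end

theorem corollary1p13:
  fixes \<Gamma> :: "('g, 'b) monoid_scheme"
    and \<Phi> :: "'g \<Rightarrow> 'x::metric_space \<Rightarrow> 'x"
  assumes "nilpotent_cantor_action \<Gamma> \<Phi>"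
    and "finite {p. prime p \<and> \<not> steinitz_order uniform_topology (closure_group \<Gamma> \<Phi>) p \<le> 2}"
  shows "stable_action \<Gamma> \<Phi>"
proof -
  interpret nilpotent_cantor_action \<Gamma> \<Phi> by fact
  obtain H where H: "subgroup H \<Gamma>" "finite (rcosets\<^bsub>\<Gamma>\<^esub> H)"
    "finitely_generated_group (\<Gamma>\<lparr>carrier := H\<rparr>)" "nilpotent_group (\<Gamma>\<lparr>carrier := H\<rparr>)"
    using virtually_nilpotent unfolding virtually_fg_nilpotent_def by blast
  obtain x :: 'x where True by blast
  have "\<exists>n0. \<forall>n\<ge>n0. fixer H x n = fixer H x n0"
    using order_level_quotient_small by (intro fixer_stationary_subgroup[OF H assms(2)]) blast
  then show ?thesis by (intro stable_if_fixer_stationary fixer_stationary[OF H(1,2)])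
qed


end
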